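(* Let $n\ge3$, let $\Omega=\{y'=(y_1,\dots,y_{n-1})\in\mathbb{R}^{n-1}:y_2^2+\cdots+y_{n-1}^2<1\}$, let $q(y')=\sqrt{1-y_2^2-\cdots-y_{n-1}^2}$, and let $S=\{(y',q(y')):y'\in\Omega\}$ be the half-cylinder in $\mathbb{R}^n$. Let $A$ be a diagonal $n\times n$ matrix with exactly one diagonal entry equal to $1$ (in any position) and the other $n-1$ diagonal entries equal to $-1$. Let $\mathcal{R}:\mathcal{E}'(\mathbb{R}^n\setminus S)\to\mathcal{D}'(\Omega\times(0,\infty))$ be the Radon transform $$\mathcal{R}f(y',t)=\int_{\mathbb{R}}\int_{\mathbb{R}^n}|\nabla_x\psi|\,f(x)\,e^{i\psi(y',t,x,\omega)}\,dx\,d\omega,\qquad \psi(y',t,x,\omega)=\omega\big(t-x_T^TAx_T\big),\quad x_T=x-(y',q(y')).$$ Then $\mathcal{R}$ is a Fourier integral operator associated to a two-sided fold canonical relation; that is, both projections $\pi_L$ and $\pi_R$ from its canonical relation $C$ have only fold singularities.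
   Context: Points of $\mathbb{R}^n$ are regarded as column vectors. The functions/distributions $f$ have support disjoint from $S$, and $t>0$ throughout. The integral defining $\mathcal{R}$ is understood as an oscillatory integral. A Fourier integral operator (FIO) with nondegenerate phase function $\varphi(u,v;\theta)$ and symbol amplitude $a$ is an operator $\mathcal{E}'(V)\to\mathcal{D}'(U)$ with kernel $\int e^{i\varphi}a\,d\theta$ (as usual, modulo smooth kernels); its canonical relation is $\{(u,d_u\varphi;v,-d_v\varphi): d_\theta\varphi=0\}$. Canonical relation of $\mathcal{R}$: $C=\{(y',t,d_{y'}\psi,\omega;\,x,-d_x\psi):\ \partial_\omega\psi=0\}$, a smooth $2n$-dimensional manifold globally parametrized by $(y',x,\omega)$ with $y'\in\Omega$, $x\in\mathbb{R}^n\setminus S$, $\omega\in\mathbb{R}\setminus\{0\}$, and $t=x_T^TAx_T>0$. With $B$ the $(n-1)\times n$ matrix $B=(I_{n-1}\,|\,\nabla q(y'))$, the projections are $$\pi_L(y',x,\omega)=(y',\,x_T^TAx_T,\,2\omega BAx_T,\,\omega)\in T^*(\Omega\times(0,\infty)),\qquad \pi_R(y',x,\omega)=(x,\,2\omega Ax_T)\in T^*\mathbb{R}^n .$$ For a smooth map $f$ between manifolds of equal dimension (in local coordinates), let $S_1(f)=\{p:\det(df_p)=0,\ d(\det(df))_p\ne0\}$, a smooth hypersurface on which $df$ has corank $1$. $f$ has a fold singularity along $S_1(f)$ if $\ker(df_p)$ is transversal to $T_pS_1(f)$ for all $p\in S_1(f)$. "Only fold singularities" means that every point where $\det(df)=0$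 lies in $S_1(f)$ and the transversality condition holds there. A canonical relation is a two-sided fold if both $\pi_L$ and $\pi_R$ have (only) fold singularities. *)

theory Defs
  imports "HOL-Analysis.Analysis" "HOL-Combinatorics.Permutations"
begin

section \<open>Smooth functions\<close>

primrec iter_deriv :: "'a::euclidean_space list \<Rightarrow> ('a \<Rightarrow> 'b::real_normed_vector) \<Rightarrow> 'a \<Rightarrow> 'b" where
  "iter_deriv [] f = f"
| "iter_deriv (h # hs) f = (\<lambda>x. frechet_derivative (iter_deriv hs f) (at x) h)"

text \<open>Smoothness (\<open>C\<^sup>\<infinity>\<close>) on an open set: every iterated directional derivative exists and is
  differentiable. On an arbitrary set, smooth means smooth on some open neighbourhood.\<close>

definition smooth_on_open :: "'a::euclidean_space set \<Rightarrow> ('a \<Rightarrow> 'b::real_normed_vector) \<Rightarrow> bool" where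
  "smooth_on_open W f \<longleftrightarrow> open W \<and> (\<forall>hs. \<forall>x\<in>W. iter_deriv hs f differentiable (at x))"

definition smooth_near :: "'a::euclidean_space set \<Rightarrow> ('a \<Rightarrow> 'b::real_normed_vector) \<Rightarrow> bool" where
  "smooth_near X f \<longleftrightarrow> (\<exists>W. X \<subseteq> W \<and> smooth_on_open W f)"

definition grad :: "('a::euclidean_space \<Rightarrow> real) \<Rightarrow> 'a \<Rightarrow> 'a" where
  "grad f x = (\<Sum>b\<in>Basis. frechet_derivative f (at x) b *\<^sub>R b)"

section \<open>Distributions\<close>

definition test_functions :: "'a::euclidean_space set \<Rightarrow> ('a \<Rightarrow> complex) set" where
  "test_functions U = {g. smooth_on_open UNIV g \<and>
     (\<exists>K. compact K \<and> K \<subseteq> U \<and> (\<forall>x. x \<notin> K \<longrightarrow> g x = 0))}"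

definition derivs_bounded :: "'a::euclidean_space set \<Rightarrow> nat \<Rightarrow> real \<Rightarrow> ('a \<Rightarrow> complex) \<Rightarrow> bool" where
  "derivs_bounded K N M g \<longleftrightarrow>
     (\<forall>hs. set hs \<subseteq> Basis \<longrightarrow> length hs \<le> N \<longrightarrow> (\<forall>x\<in>K. norm (iter_deriv hs g x) \<le> M))"

text \<open>\<open>distributions U\<close> is \<open>\<D>'(U)\<close> for an open set \<open>U\<close>.\<close>

definition distributions :: "'a::euclidean_space set \<Rightarrow> (('a \<Rightarrow> complex) \<Rightarrow> complex) set" where
  "distributions U = {T.
     (\<forall>g\<in>test_functions U. \<forall>h\<in>test_functions U. \<forall>c. T (\<lambda>x. g x + c * h x) = T g + c * T h) \<and>
     (\<forall>K. compact K \<longrightarrow> K \<subseteq> U \<longrightarrow>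
        (\<exists>N C. \<forall>g\<in>test_functions U. \<forall>M.
           (\<forall>x. x \<notin> K \<longrightarrow> g x = 0) \<longrightarrow> derivs_bounded K N M g \<longrightarrow> norm (T g) \<le> C * M))}"

text \<open>\<open>compact_distributions X\<close> is \<open>\<E>'(X)\<close>. For open \<open>X\<close> this is the topological dual of
  \<open>C\<^sup>\<infinity>(X)\<close>: it suffices to take \<open>W = X\<close> below. For an arbitrary set \<open>X\<close> it is the space of
  compactly supported distributions on the whole space with support contained in \<open>X\<close>, acting on
  functions that are smooth near \<open>X\<close>. (The compact sets \<open>L\<close> for all \<open>W\<close> force the support to lie
  in every neighbourhood of \<open>X\<close>, hence in \<open>X\<close>.) This generality is needed because the half-cylinder
  below is not closed, so that its complement is not open.\<close>

definition compact_distributions :: "'a::euclidean_space set \<Rightarrow> (('a \<Rightarrow> complex) \<Rightarrow> complex) set" where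
  "compact_distributions X = {T.
     (\<forall>g h c. smooth_near X g \<longrightarrow> smooth_near X h \<longrightarrow>
        T (\<lambda>x. g x + c * h x) = T g + c * T h) \<and>
     (\<forall>W. open W \<longrightarrow> X \<subseteq> W \<longrightarrow>
        (\<exists>L N C. compact L \<and> L \<subseteq> W \<and>
           (\<forall>g M. smooth_on_open W g \<longrightarrow> derivs_bounded L N M g \<longrightarrow> norm (T g) \<le> C * M)))}"

section \<open>Fourier integral operators\<close>

text \<open>Phases, amplitudes and kernels live over an open set \<open>Z\<close> of pairs \<open>(u, v)\<close>; they are functions
  of \<open>(u, v, \<theta>)\<close>. The condition on the \<open>(u, \<theta>)\<close>- and \<open>(v, \<theta>)\<close>-gradients is the usual one for
  operator phase functions; the last condition says that the differentials of the \<open>\<partial>\<phi>/\<partial>\<theta>\<^sub>j\<close> are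
  linearly independent where \<open>d\<^sub>\<theta>\<phi> = 0\<close>.\<close>

definition nondegenerate_phase ::
  "('u::euclidean_space \<times> 'v::euclidean_space) set \<Rightarrow> ('u \<times> 'v \<times> 'k::euclidean_space \<Rightarrow> real) \<Rightarrow> bool" where
  "nondegenerate_phase Z \<phi> \<longleftrightarrow>
     smooth_on_open {(u, v, \<theta>). (u, v) \<in> Z \<and> \<theta> \<noteq> 0} \<phi> \<and>
     (\<forall>u v \<theta>. (u, v) \<in> Z \<longrightarrow> \<theta> \<noteq> 0 \<longrightarrow>
        (\<forall>r>0. \<phi> (u, v, r *\<^sub>R \<theta>) = r * \<phi> (u, v, \<theta>)) \<and>
        grad (\<lambda>(u', \<theta>'). \<phi> (u', v, \<theta>')) (u, \<theta>) \<noteq> 0 \<and>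
        grad (\<lambda>(v', \<theta>'). \<phi> (u, v', \<theta>')) (v, \<theta>) \<noteq> 0 \<and>
        (grad (\<lambda>\<theta>'. \<phi> (u, v, \<theta>')) \<theta> = 0 \<longrightarrow>
           (\<forall>c. (\<forall>h. c \<bullet> frechet_derivative
                        (\<lambda>(u', v', \<theta>'). grad (\<lambda>\<theta>''. \<phi> (u', v', \<theta>'')) \<theta>')
                        (at (u, v, \<theta>)) h = 0) \<longrightarrow> c = 0)))"

text \<open>The symbol class \<open>S\<^sup>m(Z \<times> \<real>\<^sup>N)\<close>.\<close>

definition symbol ::
  "('u::euclidean_space \<times> 'v::euclidean_space) set \<Rightarrow> real \<Rightarrow>
     ('u \<times> 'v \<times> 'k::euclidean_space \<Rightarrow> complex) \<Rightarrow> bool" where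
  "symbol Z m a \<longleftrightarrow>
     smooth_on_open {(u, v, \<theta>). (u, v) \<in> Z} a \<and>
     (\<forall>K \<alpha>s \<beta>s. compact K \<longrightarrow> K \<subseteq> Z \<longrightarrow>
        (\<exists>C. \<forall>u v \<theta>. (u, v) \<in> K \<longrightarrow>
           norm (iter_deriv (map (\<lambda>(b, c). (b, c, 0)) \<alpha>s @ map (\<lambda>d. (0, 0, d)) \<beta>s) a (u, v, \<theta>))
             \<le> C * (1 + norm \<theta>) powr (m - real (length \<beta>s))))"

text \<open>The canonical relation, with cotangent vectors written in the standard coordinates: a subset
  of \<open>T\<^sup>*\<real>\<^sup>n \<times> T\<^sup>*\<real>\<^sup>n\<close>, whose points are \<open>((u, \<xi>), (v, \<eta>))\<close>.\<close>

definition canonical_relation ::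
  "('u::euclidean_space \<times> 'v::euclidean_space) set \<Rightarrow> ('u \<times> 'v \<times> 'k::euclidean_space \<Rightarrow> real) \<Rightarrow>
     (('u \<times> 'u) \<times> ('v \<times> 'v)) set" where
  "canonical_relation Z \<phi> =
     {((u, grad (\<lambda>u'. \<phi> (u', v, \<theta>)) u), (v, - grad (\<lambda>v'. \<phi> (u, v', \<theta>)) v)) | u v \<theta>.
        (u, v) \<in> Z \<and> \<theta> \<noteq> 0 \<and> grad (\<lambda>\<theta>'. \<phi> (u, v, \<theta>')) \<theta> = 0}"

text \<open>\<open>osc_pairing \<phi> a f g L\<close>: applying the operator with kernel \<open>\<integral> e\<^sup>i\<^sup>\<phi> a d\<theta>\<close> to the distribution \<open>f\<close>
  and pairing the result with the test function \<open>g\<close> gives \<open>L\<close>, where the integral over \<open>\<theta>\<close> is an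
  oscillatory integral: insert a cutoff \<open>\<rho>(\<epsilon>\<theta>)\<close> with \<open>\<rho>(0) = 1\<close> and let \<open>\<epsilon>\<close> tend to \<open>0\<close>; the limit has
  to be independent of the cutoff. The value of \<open>f\<close> at \<open>e\<^sup>i\<^sup>\<phi> a\<close> is the \<open>v\<close>-integral of
  \<open>f(v) e\<^sup>i\<^sup>\<phi> a\<close> in the sense of distributions.\<close>

definition osc_regularized ::
  "('u \<times> 'v \<times> 'k::euclidean_space \<Rightarrow> real) \<Rightarrow> ('u \<times> 'v \<times> 'k \<Rightarrow> complex) \<Rightarrow>
     ('k \<Rightarrow> complex) \<Rightarrow> real \<Rightarrow> (('v \<Rightarrow> complex) \<Rightarrow> complex) \<Rightarrow> 'u \<Rightarrow> complex" where
  "osc_regularized \<phi> a \<rho> \<epsilon> f u =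
     (\<integral>\<theta>. \<rho> (\<epsilon> *\<^sub>R \<theta>) * f (\<lambda>v. exp (\<i> * complex_of_real (\<phi> (u, v, \<theta>))) * a (u, v, \<theta>)) \<partial>lborel)"

definition osc_pairing ::
  "('u::euclidean_space \<times> 'v \<times> 'k::euclidean_space \<Rightarrow> real) \<Rightarrow> ('u \<times> 'v \<times> 'k \<Rightarrow> complex) \<Rightarrow>
     (('v \<Rightarrow> complex) \<Rightarrow> complex) \<Rightarrow> ('u \<Rightarrow> complex) \<Rightarrow> complex \<Rightarrow> bool" where
  "osc_pairing \<phi> a f g L \<longleftrightarrow>
     (\<forall>\<rho>\<in>test_functions UNIV. \<rho> 0 = 1 \<longrightarrow>
        ((\<lambda>\<epsilon>. \<integral>u. g u * osc_regularized \<phi> a \<rho> \<epsilon> f u \<partial>lborel) \<longlongrightarrow> L) (at_right 0))"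

text \<open>\<open>F : \<E>'(V) \<rightarrow> \<D>'(U)\<close> is a Fourier integral operator with nondegenerate phase \<open>\<phi>\<close>, hence with
  canonical relation \<open>canonical_relation Z \<phi>\<close>; \<open>k\<close> is the smooth error allowed in the kernel. If \<open>V\<close> is
  open, the standard notion is the one with \<open>Z = U \<times> V\<close>; in general \<open>Z\<close> is an open neighbourhood of
  \<open>U \<times> V\<close> on which the data are defined.\<close>

definition fourier_integral_operator ::
  "'u::euclidean_space set \<Rightarrow> 'v::euclidean_space set \<Rightarrow> ('u \<times> 'v) set \<Rightarrow>
     ('u \<times> 'v \<times> 'k::euclidean_space \<Rightarrow> real) \<Rightarrow>
     ((('v \<Rightarrow> complex) \<Rightarrow> complex) \<Rightarrow> (('u \<Rightarrow> complex) \<Rightarrow> complex)) \<Rightarrow> bool" where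
  "fourier_integral_operator U V Z \<phi> F \<longleftrightarrow>
     open U \<and> open Z \<and> U \<times> V \<subseteq> Z \<and> Z \<subseteq> U \<times> UNIV \<and>
     nondegenerate_phase Z \<phi> \<and>
     (\<forall>f\<in>compact_distributions V. F f \<in> distributions U) \<and>
     (\<exists>m a k. symbol Z m a \<and> smooth_on_open Z k \<and>
        (\<forall>f\<in>compact_distributions V. \<forall>g\<in>test_functions U.
           \<exists>L. osc_pairing \<phi> a f g L \<and>
               F f g = L + (\<integral>u. g u * f (\<lambda>v. k (u, v)) \<partial>lborel)))"

section \<open>Fold singularities\<close>

text \<open>The determinant of a linear map between Euclidean spaces of the same dimension, with respect to
  the coordinates given by the standard bases, which are matched by the bijection \<open>e\<close>; up to sign it
  does not depend on \<open>e\<close>.\<close>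

definition lin_det :: "('a \<Rightarrow> 'b) \<Rightarrow> ('a::euclidean_space \<Rightarrow> 'b::euclidean_space) \<Rightarrow> real" where
  "lin_det e f = (\<Sum>\<sigma> | \<sigma> permutes (Basis :: 'a set).
     of_int (sign \<sigma>) * (\<Prod>b\<in>Basis. f b \<bullet> e (\<sigma> b)))"

definition jac_det :: "('a \<Rightarrow> 'b) \<Rightarrow> ('a::euclidean_space \<Rightarrow> 'b::euclidean_space) \<Rightarrow> 'a \<Rightarrow> real" where
  "jac_det e f p = lin_det e (frechet_derivative f (at p))"

definition S\<^sub>1 :: "('a \<Rightarrow> 'b) \<Rightarrow> 'a set \<Rightarrow> ('a::euclidean_space \<Rightarrow> 'b::euclidean_space) \<Rightarrow> 'a set" where
  "S\<^sub>1 e W f = {p \<in> W. jac_det e f p = 0 \<and> frechet_derivative (jac_det e f) (at p) \<noteq> (\<lambda>_. 0)}"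

text \<open>Tangent vectors of a subset are velocities of smooth curves in it.\<close>

definition tangent_space :: "'a::euclidean_space set \<Rightarrow> 'a \<Rightarrow> 'a set" where
  "tangent_space M p = {v. \<exists>\<gamma> \<delta>. \<delta> > 0 \<and> smooth_on_open {-\<delta><..<\<delta>} \<gamma> \<and> \<gamma> ` {-\<delta><..<\<delta>} \<subseteq> M \<and>
     \<gamma> 0 = p \<and> (\<gamma> has_vector_derivative v) (at (0::real))}"

definition only_folds :: "'a set \<Rightarrow> ('a::euclidean_space \<Rightarrow> 'b::euclidean_space) \<Rightarrow> bool" where
  "only_folds W f \<longleftrightarrow>
     DIM('a) = DIM('b) \<and> smooth_on_open W f \<and>
     (\<forall>e. bij_betw e (Basis :: 'a set) (Basis :: 'b set) \<longrightarrow>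
        (\<forall>p\<in>W. jac_det e f p = 0 \<longrightarrow>
           p \<in> S\<^sub>1 e W f \<and>
           {v + w | v w. frechet_derivative f (at p) v = 0 \<and> w \<in> tangent_space (S\<^sub>1 e W f) p} = UNIV))"

text \<open>Local parametrizations of an embedded submanifold \<open>C\<close> (inverses of charts).\<close>

definition local_parametrization :: "'b set \<Rightarrow> 'a set \<Rightarrow> ('a::euclidean_space \<Rightarrow> 'b::euclidean_space) \<Rightarrow> bool" where
  "local_parametrization C W \<kappa> \<longleftrightarrow>
     smooth_on_open W \<kappa> \<and> (\<forall>p\<in>W. inj (frechet_derivative \<kappa> (at p))) \<and>
     openin (top_of_set C) (\<kappa> ` W) \<and> (\<exists>\<kappa>'. homeomorphism W (\<kappa> ` W) \<kappa> \<kappa>')"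

text \<open>A canonical relation has dimension \<open>DIM('u) + DIM('v)\<close>, so its charts are modelled on \<open>'u \<times> 'v\<close>.
  Having only folds is invariant under changes of coordinates, so one chart around each point is enough.\<close>

definition two_sided_fold ::
  "(('u::euclidean_space \<times> 'u) \<times> ('v::euclidean_space \<times> 'v)) set \<Rightarrow> bool" where
  "two_sided_fold C \<longleftrightarrow>
     (\<forall>c\<in>C. \<exists>(W :: ('u \<times> 'v) set) \<kappa>. local_parametrization C W \<kappa> \<and> c \<in> \<kappa> ` W \<and>
        only_folds W (fst \<circ> \<kappa>) \<and> only_folds W (snd \<circ> \<kappa>))"

section \<open>The Radon transform with centres on a half-cylinder\<close>

text \<open>The coordinates of \<open>\<real>\<^sup>n\<^sup>-\<^sup>1\<close> are indexed by \<open>'m\<close>, those of \<open>\<real>\<^sup>n\<close> by \<open>'m option\<close>, where \<open>None\<close> is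
  the index of the last coordinate. The index \<open>\<iota> :: 'm\<close> is that of the first coordinate \<open>y\<^sub>1\<close>, the
  direction of the axis of the cylinder.\<close>

definition Omega :: "'m::finite \<Rightarrow> (real ^ 'm) set" where
  "Omega \<iota> = {y. (\<Sum>i\<in>UNIV - {\<iota>}. (y $ i)\<^sup>2) < 1}"

definition q_fun :: "'m::finite \<Rightarrow> real ^ 'm \<Rightarrow> real" where
  "q_fun \<iota> y = sqrt (1 - (\<Sum>i\<in>UNIV - {\<iota>}. (y $ i)\<^sup>2))"

definition centre :: "'m::finite \<Rightarrow> real ^ 'm \<Rightarrow> real ^ 'm option" where
  "centre \<iota> y = (\<chi> j. case j of Some i \<Rightarrow> y $ i | None \<Rightarrow> q_fun \<iota> y)"

definition half_cylinder :: "'m::finite \<Rightarrow> (real ^ 'm option) set" where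
  "half_cylinder \<iota> = centre \<iota> ` Omega \<iota>"

definition radon_phase ::
  "real ^ 'm option ^ 'm option \<Rightarrow> 'm::finite \<Rightarrow>
     ((real ^ 'm) \<times> real) \<times> (real ^ 'm option) \<times> real \<Rightarrow> real" where
  "radon_phase A \<iota> = (\<lambda>((y, t), x, \<omega>). \<omega> * (t - (x - centre \<iota> y) \<bullet> (A *v (x - centre \<iota> y))))"

definition radon_amplitude ::
  "real ^ 'm option ^ 'm option \<Rightarrow> 'm::finite \<Rightarrow>
     ((real ^ 'm) \<times> real) \<times> (real ^ 'm option) \<times> real \<Rightarrow> complex" where
  "radon_amplitude A \<iota> =
     (\<lambda>(u, x, \<omega>). complex_of_real (norm (grad (\<lambda>x'. radon_phase A \<iota> (u, x', \<omega>)) x)))"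

text \<open>\<open>radon A \<iota> f g\<close> is the pairing of the distribution \<open>\<R>f\<close> with the test function \<open>g\<close>.\<close>

definition radon ::
  "real ^ 'm option ^ 'm option \<Rightarrow> 'm::finite \<Rightarrow>
     ((real ^ 'm option \<Rightarrow> complex) \<Rightarrow> complex) \<Rightarrow> ((real ^ 'm) \<times> real \<Rightarrow> complex) \<Rightarrow> complex" where
  "radon A \<iota> f g = (THE L. osc_pairing (radon_phase A \<iota>) (radon_amplitude A \<iota>) f g L)"

end

theory Submission
  imports Defs
begin

text \<open>
  Write \<open>w = x - (y, q y)\<close> for the displacement of \<open>x\<close> from the centre over \<open>y\<close>, and let \<open>n\<close> be the normal
  vector \<open>(-\<nabla>q, 1)\<close> of the half-cylinder there.

  The canonical relation is parametrized by \<open>(y, \<omega>, x)\<close>, and both projections are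
  singular exactly where \<open>w\<close> is orthogonal to \<open>n\<close>, that is, where \<open>x\<close> lies in the tangent plane at the
  centre. The kernel of the left projection is spanned by the motion of \<open>x\<close> along \<open>A *v n\<close>, and it is
  transversal to the singular set if and only if \<open>n \<bullet> (A *v n) \<noteq> 0\<close>. This is where the signature of \<open>A\<close>
  enters: on the canonical relation \<open>w \<bullet> (A *v w) = t > 0\<close>, the form has a single positive square, and so
  it is negative on \<open>n\<close>, which is orthogonal to \<open>w\<close> (\<open>sqform_neg_if_orthogonal\<close>). The kernel of the right
  projection moves the centre in the direction of \<open>w\<close>, and it is transversal to the singular set if and
  only if the half-cylinder is curved in this direction (\<open>second_fundamental_form_zero\<close>). The only flat
  direction is the axis, and a point \<open>x\<close> displaced along the axis would lie on the half-cylinder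
  itself. The lemma \<open>only_foldsI\<close> extracts the fold property from such data: it reads off the simple zero
  of the Jacobian determinant by trading one column of the Jacobian matrix for the image of the kernel
  vector, which vanishes to first order.

  As for the operator, the phase depends on \<open>t\<close> only through \<open>\<omega> t\<close>. So applying \<open>f\<close> to the integrand
  gives \<open>e\<^sup>i\<^sup>\<omega>\<^sup>t E (y, \<omega>)\<close>, where \<open>E\<close> is continuous and grows at most polynomially in \<open>\<omega>\<close>
  (\<open>frequency_profile_growth\<close>), because a compactly supported distribution is controlled by finitely
  many derivatives on a compact set. Integrating in \<open>t\<close> against a test function first yields its Fourier
  transform in \<open>t\<close>, which decays faster than any power of \<open>\<omega>\<close>. Hence the regularized integrals converge
  by dominated convergence, the limit does not depend on the cutoff, and it is continuous in the test
  function (\<open>oscillatory_limit\<close>, \<open>pairing_distribution\<close>).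

  The amplitude \<open>2 \<bar>\<omega>\<bar> \<bar>w\<bar>\<close> is homogeneous, but it is not a symbol, since it is not smooth at \<open>\<omega> = 0\<close>. Instead
  of cutting it off, which would leave a smooth remainder in the kernel, the frequency is
  reparametrized by a function \<open>\<mu>\<close> that is the identity at high frequencies and vanishes near \<open>0\<close>. The
  substitution \<open>\<omega> = \<mu> \<theta>\<close> changes neither the phase at high frequencies nor the value of the integral, and
  the new amplitude \<open>e\<^sup>i\<^sup>(\<^sup>\<mu>\<^sup>\<theta>\<^sup>-\<^sup>\<theta>\<^sup>)\<^sup>(\<^sup>t\<^sup>-\<^sup>Q\<^sup>) \<bar>\<mu> \<theta>\<bar> \<mu>' \<theta> 2 \<bar>w\<bar>\<close>, where \<open>Q = w \<bullet> (A *v w)\<close>, is a symbol of order \<open>1\<close>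
  (\<open>symbol_flattened_amplitude\<close>, \<open>osc_pairing_flattened_amplitude\<close>).
\<close>


section \<open>Calculus of smooth functions\<close>

lemma iter_deriv_snoc:
  "iter_deriv (hs @ [h]) f = iter_deriv hs (\<lambda>x. frechet_derivative f (at x) h)"
  by (induction hs) auto

lemma frechet_derivative_cong_open:
  assumes "open W" "x \<in> W" "\<And>y. y \<in> W \<Longrightarrow> f y = g y"
  shows "frechet_derivative f (at x) = frechet_derivative g (at x)"
proof -
  have "(f has_derivative D) (at x) \<longleftrightarrow> (g has_derivative D) (at x)" for D
    using has_derivative_transform_within_open[OF _ assms(1,2), of f D UNIV g]
      has_derivative_transform_within_open[OF _ assms(1,2), of g D UNIV f] assms(3)
    by auto
  then show ?thesis by (simp add: frechet_derivative_def)
qed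

lemma differentiable_cong_open:
  assumes "open W" "x \<in> W" "\<And>y. y \<in> W \<Longrightarrow> f y = g y" "f differentiable (at x)"
  shows "g differentiable (at x)"
  using assms has_derivative_transform_within_open[OF _ assms(1,2), of f _ UNIV g]
  unfolding differentiable_def by blast

lemma iter_deriv_cong_open:
  assumes "open W" "\<And>y. y \<in> W \<Longrightarrow> f y = g y" "x \<in> W"
  shows "iter_deriv hs f x = iter_deriv hs g x"
  using assms(3)
proof (induction hs arbitrary: x)
  case (Cons h hs)
  then show ?case
    using frechet_derivative_cong_open[OF assms(1) Cons.prems Cons.IH] by simp
qed (use assms in simp)

text \<open>The finite orders of differentiability carry the inductions: the derivative of a product or
  of a composition is again built from products and compositions, of one order less.\<close>

primrec times_differentiable ::
  "nat \<Rightarrow> 'a::euclidean_space set \<Rightarrow> ('a \<Rightarrow> 'b::real_normed_vector) \<Rightarrow> bool" where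
  "times_differentiable 0 W f \<longleftrightarrow> (\<forall>x\<in>W. f differentiable (at x))"
| "times_differentiable (Suc k) W f \<longleftrightarrow> (\<forall>x\<in>W. f differentiable (at x)) \<and>
     (\<forall>h. times_differentiable k W (\<lambda>x. frechet_derivative f (at x) h))"

lemma times_differentiable_iff:
  "times_differentiable k W f \<longleftrightarrow>
     (\<forall>hs. length hs \<le> k \<longrightarrow> (\<forall>x\<in>W. iter_deriv hs f differentiable (at x)))"
proof (induction k arbitrary: f)
  case (Suc k)
  show ?case (is "?L \<longleftrightarrow> ?R")
  proof
    assume L: ?L
    show ?R
    proof (intro allI impI)
      fix hs :: "'a list" assume len: "length hs \<le> Suc k"
      show "\<forall>x\<in>W. iter_deriv hs f differentiable (at x)"
      proof (cases hs rule: rev_cases)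
        case Nil
        then show ?thesis using L by simp
      next
        case (snoc ks h)
        then show ?thesis using L len Suc.IH by (auto simp: iter_deriv_snoc)
      qed
    qed
  next
    assume R: ?R
    have "\<forall>x\<in>W. f differentiable (at x)"
      using R[rule_format, of "[]"] by simp
    moreover have "times_differentiable k W (\<lambda>x. frechet_derivative f (at x) h)" for h
      unfolding Suc.IH using R iter_deriv_snoc[of _ h f]
      by (metis Suc_le_mono length_append_singleton)
    ultimately show ?L by simp
  qed
qed auto

lemma smooth_on_open_iff_times_differentiable:
  "smooth_on_open W f \<longleftrightarrow> open W \<and> (\<forall>k. times_differentiable k W f)"
  unfolding smooth_on_open_def times_differentiable_iff by blast

lemma times_differentiable_imp_differentiable:
  "times_differentiable k W f \<Longrightarrow> x \<in> W \<Longrightarrow> f differentiable (at x)"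
  by (cases k) auto

lemma times_differentiable_SucD: "times_differentiable (Suc k) W f \<Longrightarrow> times_differentiable k W f"
  by (simp add: times_differentiable_iff)

lemma times_differentiable_cong:
  assumes "open W" "\<And>y. y \<in> W \<Longrightarrow> f y = g y" "times_differentiable k W f"
  shows "times_differentiable k W g"
  unfolding times_differentiable_iff
proof (intro allI impI ballI)
  fix hs :: "'a list" and x assume "length hs \<le> k" "x \<in> W"
  then show "iter_deriv hs g differentiable at x"
    using assms(3) iter_deriv_cong_open[OF assms(1), of f g _ hs, OF assms(2)]
    unfolding times_differentiable_iff
    by (intro differentiable_cong_open[OF assms(1) \<open>x \<in> W\<close>, of "iter_deriv hs f" "iter_deriv hs g"]) auto
qed

lemma times_differentiableI:
  assumes "open W" "\<And>x. x \<in> W \<Longrightarrow> (f has_derivative f' x) (at x)"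
    and "\<And>h j. k = Suc j \<Longrightarrow> times_differentiable j W (\<lambda>x. f' x h)"
  shows "times_differentiable k W f"
proof (cases k)
  case 0
  then show ?thesis using assms(2) by (auto simp: differentiable_def)
next
  case (Suc j)
  have "times_differentiable j W (\<lambda>x. frechet_derivative f (at x) h)" for h
    by (rule times_differentiable_cong[OF assms(1) _ assms(3)[OF Suc]])
      (simp add: frechet_derivative_at[OF assms(2), symmetric])
  then show ?thesis using Suc assms(2) by (auto simp: differentiable_def)
qed

lemma times_differentiable_has_derivative:
  "times_differentiable k W f \<Longrightarrow> x \<in> W \<Longrightarrow>
     (f has_derivative frechet_derivative f (at x)) (at x)"
  using times_differentiable_imp_differentiable frechet_derivative_works by blast

lemma times_differentiable_const: "open W \<Longrightarrow> times_differentiable k W (\<lambda>x. c)"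
proof (induction k arbitrary: c)
  case 0
  then show ?case by simp
next
  case (Suc k)
  show ?case
    by (rule times_differentiableI[where f' = "\<lambda>_ _. 0", OF \<open>open W\<close>])
       (auto intro: Suc.IH Suc.prems)
qed

lemma times_differentiable_bounded_linear:
  assumes "open W" "bounded_linear f"
  shows "times_differentiable k W f"
  by (rule times_differentiableI[OF assms(1) bounded_linear_imp_has_derivative[OF assms(2)]])
     (rule times_differentiable_const[OF assms(1)])

lemma times_differentiable_linear_image:
  assumes "open W" "bounded_linear L" "times_differentiable k W f"
  shows "times_differentiable k W (\<lambda>x. L (f x))"
  using assms(3)
proof (induction k arbitrary: f)
  case 0
  then show ?case using assms(2)
    by (auto simp: differentiable_def intro: bounded_linear.has_derivative[OF assms(2)])
next
  case (Suc k)
  show ?case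
    by (rule times_differentiableI[OF assms(1) bounded_linear.has_derivative[OF assms(2)
          times_differentiable_has_derivative[OF Suc.prems]]])
       (use Suc in auto)
qed

lemma times_differentiable_add:
  assumes "open W" "times_differentiable k W f" "times_differentiable k W g"
  shows "times_differentiable k W (\<lambda>x. f x + g x)"
  using assms(2,3)
proof (induction k arbitrary: f g)
  case 0
  then show ?case by auto
next
  case (Suc k)
  show ?case
    by (rule times_differentiableI[OF assms(1) has_derivative_add[OF
          times_differentiable_has_derivative[OF Suc.prems(1)]
          times_differentiable_has_derivative[OF Suc.prems(2)]]])
       (use Suc in auto)
qed

lemma times_differentiable_sum:
  assumes "open W" "\<And>i. i \<in> I \<Longrightarrow> times_differentiable k W (f i)"
  shows "times_differentiable k W (\<lambda>x. \<Sum>i\<in>I. f i x)"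
  using assms(2)
  by (induction I rule: infinite_finite_induct)
     (auto intro: times_differentiable_add times_differentiable_const assms(1))

lemma times_differentiable_bilinear:
  assumes "open W" "bounded_bilinear B" "times_differentiable k W f" "times_differentiable k W g"
  shows "times_differentiable k W (\<lambda>x. B (f x) (g x))"
  using assms(3,4)
proof (induction k arbitrary: f g)
  case 0
  then show ?case
    unfolding times_differentiable.simps differentiable_def
    by (blast intro: bounded_bilinear.FDERIV[OF assms(2)])
next
  case (Suc k)
  show ?case
    by (rule times_differentiableI[OF assms(1) bounded_bilinear.FDERIV[OF assms(2)
          times_differentiable_has_derivative[OF Suc.prems(1)]
          times_differentiable_has_derivative[OF Suc.prems(2)]]])
       (use Suc Suc.prems[THEN times_differentiable_SucD] in
         \<open>auto intro!: times_differentiable_add[OF assms(1)]\<close>)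
qed

lemma frechet_derivative_basis_expansion:
  fixes g :: "'a::euclidean_space \<Rightarrow> 'b::real_normed_vector"
  assumes "g differentiable (at y)"
  shows "frechet_derivative g (at y) v = (\<Sum>b\<in>Basis. (v \<bullet> b) *\<^sub>R frechet_derivative g (at y) b)"
proof -
  have lin: "linear (frechet_derivative g (at y))"
    using assms by (rule linear_frechet_derivative)
  have "frechet_derivative g (at y) v = frechet_derivative g (at y) (\<Sum>b\<in>Basis. (v \<bullet> b) *\<^sub>R b)"
    by (simp add: euclidean_representation)
  then show ?thesis by (simp add: linear_sum[OF lin] linear_scale[OF lin])
qed

text \<open>The chain rule is expanded over the basis. This separates the point from the direction: the
  derivative becomes a sum of products of functions of the point, to which the product rule and the
  induction hypothesis apply.\<close>

lemma times_differentiable_compose: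
  fixes f :: "'a::euclidean_space \<Rightarrow> 'b::euclidean_space"
  assumes "open W" "open V" "f ` W \<subseteq> V" "times_differentiable k W f" "times_differentiable k V g"
  shows "times_differentiable k W (\<lambda>x. g (f x))"
  using assms(4,5)
proof (induction k arbitrary: g)
  case 0
  then show ?case
    using assms(3) differentiable_chain_at[of f _ g] unfolding o_def by auto
next
  case (Suc k)
  have fV: "f x \<in> V" if "x \<in> W" for x using that assms(3) by auto
  have der: "((\<lambda>x. g (f x)) has_derivative
      (\<lambda>h. \<Sum>b\<in>Basis. (frechet_derivative f (at x) h \<bullet> b) *\<^sub>R frechet_derivative g (at (f x)) b)) (at x)"
    if x: "x \<in> W" for x
  proof -
    have "((\<lambda>x. g (f x)) has_derivative
      (\<lambda>h. frechet_derivative g (at (f x)) (frechet_derivative f (at x) h))) (at x)"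
      by (rule has_derivative_compose[OF times_differentiable_has_derivative[OF Suc.prems(1) x]
            times_differentiable_has_derivative[OF Suc.prems(2) fV[OF x]]])
    then show ?thesis
      by (rule has_derivative_eq_rhs) (rule ext frechet_derivative_basis_expansion
          times_differentiable_imp_differentiable[OF Suc.prems(2) fV[OF x]])+
  qed
  have "times_differentiable k W
      (\<lambda>x. \<Sum>b\<in>Basis. (frechet_derivative f (at x) h \<bullet> b) *\<^sub>R frechet_derivative g (at (f x)) b)" for h
    using Suc.prems Suc.IH[OF times_differentiable_SucD[OF Suc.prems(1)],
        of "\<lambda>y. frechet_derivative g (at y) b" for b]
    by (intro times_differentiable_sum times_differentiable_bilinear[OF _ bounded_bilinear_scaleR]
        times_differentiable_bilinear[OF _ bounded_bilinear_inner] times_differentiable_const assms(1))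
       auto
  then show ?case
    by (intro times_differentiableI[OF assms(1) der]) (simp_all only: nat.inject)
qed

lemma smooth_imp_open: "smooth_on_open W f \<Longrightarrow> open W"
  by (simp add: smooth_on_open_def)

lemma smooth_imp_differentiable: "smooth_on_open W f \<Longrightarrow> x \<in> W \<Longrightarrow> f differentiable (at x)"
  unfolding smooth_on_open_def by (metis iter_deriv.simps(1))

lemma smooth_has_derivative:
  "smooth_on_open W f \<Longrightarrow> x \<in> W \<Longrightarrow> (f has_derivative frechet_derivative f (at x)) (at x)"
  using smooth_imp_differentiable frechet_derivative_works by blast

lemma smooth_imp_continuous_on: "smooth_on_open W f \<Longrightarrow> continuous_on W f"
  by (meson continuous_at_imp_continuous_on differentiable_imp_continuous_within smooth_imp_differentiable)

lemma smooth_subset: "smooth_on_open W f \<Longrightarrow> open V \<Longrightarrow> V \<subseteq> W \<Longrightarrow> smooth_on_open V f"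
  unfolding smooth_on_open_def by blast

lemma smooth_cong: "smooth_on_open W f \<Longrightarrow> (\<And>y. y \<in> W \<Longrightarrow> f y = g y) \<Longrightarrow> smooth_on_open W g"
  unfolding smooth_on_open_iff_times_differentiable using times_differentiable_cong by blast

lemma smooth_local:
  assumes "\<And>x. x \<in> W \<Longrightarrow> \<exists>V. x \<in> V \<and> smooth_on_open V f" "open W"
  shows "smooth_on_open W f"
  using assms unfolding smooth_on_open_def by blast

lemma smooth_iter_deriv: "smooth_on_open W f \<Longrightarrow> smooth_on_open W (iter_deriv hs f)"
proof -
  have "iter_deriv ks (iter_deriv hs f) = iter_deriv (ks @ hs) f" for ks
    by (induction ks) auto
  then show "smooth_on_open W f \<Longrightarrow> smooth_on_open W (iter_deriv hs f)"
    unfolding smooth_on_open_def by auto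
qed

lemma smooth_frechet_derivative:
  "smooth_on_open W f \<Longrightarrow> smooth_on_open W (\<lambda>x. frechet_derivative f (at x) h)"
  using smooth_iter_deriv[of W f "[h]"] by simp

named_theorems smooth_intros

lemma smooth_const [smooth_intros]: "open W \<Longrightarrow> smooth_on_open W (\<lambda>x. c)"
  by (simp add: smooth_on_open_iff_times_differentiable times_differentiable_const)

lemma smooth_bounded_linear: "open W \<Longrightarrow> bounded_linear f \<Longrightarrow> smooth_on_open W f"
  by (simp add: smooth_on_open_iff_times_differentiable times_differentiable_bounded_linear)

lemma smooth_ident [smooth_intros]: "open W \<Longrightarrow> smooth_on_open W (\<lambda>x. x)"
  by (simp add: smooth_bounded_linear)

lemma smooth_linear_image:
  "bounded_linear L \<Longrightarrow> smooth_on_open W f \<Longrightarrow> smooth_on_open W (\<lambda>x. L (f x))"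
  by (simp add: smooth_on_open_iff_times_differentiable times_differentiable_linear_image)

lemma smooth_add [smooth_intros]:
  "smooth_on_open W f \<Longrightarrow> smooth_on_open W g \<Longrightarrow> smooth_on_open W (\<lambda>x. f x + g x)"
  by (simp add: smooth_on_open_iff_times_differentiable times_differentiable_add)

lemma smooth_minus [smooth_intros]: "smooth_on_open W f \<Longrightarrow> smooth_on_open W (\<lambda>x. - f x)"
  by (rule smooth_linear_image[OF bounded_linear_minus[OF bounded_linear_ident]])

lemma smooth_diff [smooth_intros]:
  "smooth_on_open W f \<Longrightarrow> smooth_on_open W g \<Longrightarrow> smooth_on_open W (\<lambda>x. f x - g x)"
  using smooth_add[of W f "\<lambda>x. - g x"] smooth_minus[of W g] by simp

lemma smooth_sum [smooth_intros]:
  "open W \<Longrightarrow> (\<And>i. i \<in> I \<Longrightarrow> smooth_on_open W (f i)) \<Longrightarrow> smooth_on_open W (\<lambda>x. \<Sum>i\<in>I. f i x)"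
  by (auto simp: smooth_on_open_iff_times_differentiable intro: times_differentiable_sum)

lemma smooth_bilinear:
  "bounded_bilinear B \<Longrightarrow> smooth_on_open W f \<Longrightarrow> smooth_on_open W g \<Longrightarrow>
     smooth_on_open W (\<lambda>x. B (f x) (g x))"
  by (auto simp: smooth_on_open_iff_times_differentiable intro: times_differentiable_bilinear)

lemmas smooth_mult [smooth_intros] = smooth_bilinear[OF bounded_bilinear_mult]
lemmas smooth_scaleR [smooth_intros] = smooth_bilinear[OF bounded_bilinear_scaleR]
lemmas smooth_inner [smooth_intros] = smooth_bilinear[OF bounded_bilinear_inner]
lemmas smooth_of_real [smooth_intros] = smooth_linear_image[OF bounded_linear_of_real]
lemmas smooth_fst [smooth_intros] = smooth_linear_image[OF bounded_linear_fst]
lemmas smooth_snd [smooth_intros] = smooth_linear_image[OF bounded_linear_snd]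
lemmas smooth_vec_nth [smooth_intros] = smooth_linear_image[OF bounded_linear_vec_nth]
lemmas smooth_matrix_vector [smooth_intros] = smooth_linear_image[OF matrix_vector_mul_bounded_linear]

lemma smooth_compose:
  fixes f :: "'a::euclidean_space \<Rightarrow> 'b::euclidean_space"
  assumes "smooth_on_open V g" "smooth_on_open W f" "\<And>x. x \<in> W \<Longrightarrow> f x \<in> V"
  shows "smooth_on_open W (\<lambda>x. g (f x))"
proof -
  have "f ` W \<subseteq> V" using assms(3) by auto
  then have "times_differentiable k W (\<lambda>x. g (f x))" for k
    using assms(1,2) times_differentiable_compose[of W V f k g]
    by (simp add: smooth_on_open_iff_times_differentiable)
  then show ?thesis
    using assms(2) by (simp add: smooth_on_open_iff_times_differentiable)
qed

lemma smooth_Pair [smooth_intros]: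
  assumes "smooth_on_open W f" "smooth_on_open W g"
  shows "smooth_on_open W (\<lambda>x. (f x, g x))"
proof -
  have "smooth_on_open W (\<lambda>x. (f x, 0) + (0, g x))"
    by (intro smooth_add smooth_linear_image[where L = "\<lambda>v. (v, 0)"]
        smooth_linear_image[where L = "\<lambda>v. (0, v)"] assms bounded_linear_Pair
        bounded_linear_ident bounded_linear_zero)
  then show ?thesis by simp
qed

lemma smooth_inverse_pos:
  "smooth_on_open {0<..} (inverse :: real \<Rightarrow> real)"
proof -
  have "times_differentiable k {0<..} (inverse :: real \<Rightarrow> real)" for k
  proof (induction k)
    case (Suc k)
    show ?case
    proof (rule times_differentiableI)
      show "(inverse has_derivative (\<lambda>h. - (inverse x * h * inverse x))) (at x)"
        if "x \<in> {0<..}" for x :: real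
        using that by (auto intro: has_derivative_inverse')
      show "times_differentiable j {0<..} (\<lambda>x. - (inverse x * h * inverse x))"
        if "Suc k = Suc j" for h :: real and j
        using that Suc
        by (intro times_differentiable_linear_image[OF _ bounded_linear_minus[OF bounded_linear_ident]]
             times_differentiable_bilinear[OF _ bounded_bilinear_mult] times_differentiable_const)
           auto
    qed simp
  qed (auto intro!: derivative_intros)
  then show ?thesis by (simp add: smooth_on_open_iff_times_differentiable)
qed

lemma smooth_sqrt_pos: "smooth_on_open {0<..} sqrt"
proof -
  have "times_differentiable k {0<..} sqrt" for k
  proof (induction k)
    case 0
    then show ?case by (auto simp: differentiable_def has_field_derivative_def dest!: DERIV_real_sqrt)
  next
    case (Suc k)
    show ?case
    proof (rule times_differentiableI)
      show "(sqrt has_derivative (\<lambda>h. h * (inverse (sqrt x) / 2))) (at x)"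
        if "x \<in> {0<..}" for x :: real
        by (rule has_derivative_eq_rhs[OF DERIV_real_sqrt[unfolded has_field_derivative_def]])
          (use that in auto)
      show "times_differentiable j {0<..} (\<lambda>x. h * (inverse (sqrt x) / 2))"
        if "Suc k = Suc j" for h :: real and j
      proof -
        have "times_differentiable j {0<..} sqrt" using that Suc by simp
        then have "times_differentiable j {0<..} (\<lambda>x. inverse (sqrt x))"
          using smooth_inverse_pos unfolding smooth_on_open_iff_times_differentiable
          by - (rule times_differentiable_compose[where V = "{0<..}" and g = inverse], auto)
        moreover have "bounded_linear (\<lambda>y. h * (y / 2))"
          by (intro bounded_linear_const_mult bounded_linear_divide)
        ultimately show ?thesis
          by - (rule times_differentiable_linear_image[where L = "\<lambda>y. h * (y / 2)"], auto)
      qed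
    qed simp
  qed
  then show ?thesis by (simp add: smooth_on_open_iff_times_differentiable)
qed

lemma smooth_exp: "smooth_on_open UNIV (exp :: 'a::{real_normed_field, banach, euclidean_space} \<Rightarrow> 'a)"
proof -
  have "times_differentiable k UNIV (exp :: 'a \<Rightarrow> 'a)" for k
  proof (induction k)
    case 0
    then show ?case by (auto simp: differentiable_def intro!: DERIV_exp[unfolded has_field_derivative_def])
  next
    case (Suc k)
    show ?case
      using Suc by (intro times_differentiableI[OF open_UNIV DERIV_exp[unfolded has_field_derivative_def]])
        (auto intro!: times_differentiable_bilinear[OF _ bounded_bilinear_mult] times_differentiable_const)
  qed
  then show ?thesis by (simp add: smooth_on_open_iff_times_differentiable)
qed

lemma smooth_inverse [smooth_intros]:
  fixes f :: "'a::euclidean_space \<Rightarrow> real"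
  shows "smooth_on_open W f \<Longrightarrow> (\<And>x. x \<in> W \<Longrightarrow> f x > 0) \<Longrightarrow> smooth_on_open W (\<lambda>x. inverse (f x))"
  by (rule smooth_compose[OF smooth_inverse_pos]) auto

lemma smooth_divide [smooth_intros]:
  fixes f :: "'a::euclidean_space \<Rightarrow> real"
  shows "smooth_on_open W f \<Longrightarrow> smooth_on_open W g \<Longrightarrow> (\<And>x. x \<in> W \<Longrightarrow> g x > 0) \<Longrightarrow>
    smooth_on_open W (\<lambda>x. f x / g x)"
  unfolding divide_inverse by (intro smooth_intros)

lemma smooth_sqrt [smooth_intros]:
  "smooth_on_open W f \<Longrightarrow> (\<And>x. x \<in> W \<Longrightarrow> f x > 0) \<Longrightarrow> smooth_on_open W (\<lambda>x. sqrt (f x))"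
  by (rule smooth_compose[OF smooth_sqrt_pos]) auto

lemma smooth_exp_compose [smooth_intros]:
  fixes f :: "'a::euclidean_space \<Rightarrow> 'b::{real_normed_field, banach, euclidean_space}"
  shows "smooth_on_open W f \<Longrightarrow> smooth_on_open W (\<lambda>x. exp (f x))"
  by (rule smooth_compose[OF smooth_exp]) auto

lemma smooth_power [smooth_intros]:
  fixes f :: "'a::euclidean_space \<Rightarrow> 'b::real_normed_field"
  shows "smooth_on_open W f \<Longrightarrow> smooth_on_open W (\<lambda>x. f x ^ n)"
proof (induction n)
  case 0
  then show ?case by (simp add: smooth_const smooth_imp_open)
qed (simp add: smooth_mult)

lemma smooth_norm [smooth_intros]:
  fixes f :: "'a::euclidean_space \<Rightarrow> 'b::euclidean_space"
  assumes "smooth_on_open W f" "\<And>x. x \<in> W \<Longrightarrow> f x \<noteq> 0"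
  shows "smooth_on_open W (\<lambda>x. norm (f x))"
  unfolding norm_eq_sqrt_inner using assms by (intro smooth_intros) auto

text \<open>Differentiating in one group of variables only is differentiating jointly in special directions.
  So the partial derivatives of a jointly smooth function are jointly continuous, which is what makes
  estimates uniform in the other variables.\<close>

lemma iter_deriv_partial:
  assumes "smooth_on_open Z F" "(p, x) \<in> Z"
  shows "iter_deriv hs (\<lambda>x. F (p, x)) x = iter_deriv (map (\<lambda>h. (0, h)) hs) F (p, x)"
  using assms(2)
proof (induction hs arbitrary: x)
  case (Cons h hs)
  let ?G = "iter_deriv (map (\<lambda>h. (0, h)) hs) F"
  have op: "open {x. (p, x) \<in> Z}"
    using open_vimage[OF smooth_imp_open[OF assms(1)] continuous_on_Pair[OF continuous_on_const continuous_on_id]]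
    by (simp add: vimage_def)
  have "(?G has_derivative frechet_derivative ?G (at (p, x))) (at (p, x))"
    by (rule smooth_has_derivative[OF smooth_iter_deriv[OF assms(1)] Cons.prems])
  then have "((\<lambda>x. ?G (p, x)) has_derivative (\<lambda>k. frechet_derivative ?G (at (p, x)) (0, k))) (at x)"
    by (intro has_derivative_compose[where f = "Pair p" and g = ?G]) (auto intro!: derivative_eq_intros)
  then have "frechet_derivative (\<lambda>x. ?G (p, x)) (at x) = (\<lambda>k. frechet_derivative ?G (at (p, x)) (0, k))"
    by (rule frechet_derivative_at[symmetric])
  moreover have "frechet_derivative (iter_deriv hs (\<lambda>x. F (p, x))) (at x) =
      frechet_derivative (\<lambda>x. ?G (p, x)) (at x)"
    by (rule frechet_derivative_cong_open[OF op]) (use Cons in auto)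
  ultimately show ?case by simp
qed simp

lemma smooth_partial:
  assumes "smooth_on_open Z F"
  shows "smooth_on_open {x. (p, x) \<in> Z} (\<lambda>x. F (p, x))"
proof (rule smooth_compose[OF assms])
  have "open {x. (p, x) \<in> Z}"
    using open_vimage[OF smooth_imp_open[OF assms] continuous_on_Pair[OF continuous_on_const continuous_on_id]]
    by (simp add: vimage_def)
  then show "smooth_on_open {x. (p, x) \<in> Z} (Pair p)"
    by (intro smooth_Pair smooth_const smooth_ident)
qed simp


section \<open>Determinants and a criterion for folds\<close>

lemma lin_det_eq_det:
  fixes idx :: "'i::finite \<Rightarrow> 'a::euclidean_space" and c :: "'a \<Rightarrow> 'b::euclidean_space"
  assumes idx: "bij_betw idx UNIV Basis"
  shows "lin_det e c = det (\<chi> i j. c (idx i) \<bullet> e (idx j))"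
proof -
  define m where "m = (\<lambda>\<pi>. map_permutation UNIV idx \<pi>)"
  have inj: "inj idx" using idx by (simp add: bij_betw_def)
  have inv: "map_permutation Basis (inv idx) (m p) = p" if "p permutes UNIV" for p
    unfolding m_def by (rule map_permutation_compose_inv[OF idx that]) (simp add: inj)
  have inv': "m (map_permutation Basis (inv idx) p) = p" if "p permutes Basis" for p
    unfolding m_def
    by (rule map_permutation_compose_inv[OF bij_betw_inv_into[OF idx] that])
       (use idx in \<open>auto simp: bij_betw_def f_inv_into_f\<close>)
  have "det (\<chi> i j. c (idx i) \<bullet> e (idx j)) =
      (\<Sum>p | p permutes UNIV. of_int (sign p) * (\<Prod>i\<in>UNIV. c (idx i) \<bullet> e (idx (p i))))"
    by (simp add: det_def)
  also have "\<dots> = (\<Sum>p | p permutes (Basis :: 'a set). of_int (sign p) * (\<Prod>b\<in>Basis. c b \<bullet> e (p b)))"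
  proof (rule sum.reindex_bij_witness[where i = "\<lambda>p. map_permutation Basis (inv idx) p" and j = m])
    fix p :: "'i \<Rightarrow> 'i" assume p: "p \<in> {p. p permutes UNIV}"
    then show "map_permutation Basis (inv idx) (m p) = p" using inv by simp
    show "m p \<in> {p. p permutes Basis}"
      unfolding m_def using p idx map_permutation_permutes by blast
    have "sign (m p) = sign p" unfolding m_def using inj p by (simp add: sign_map_permutation)
    moreover have "(\<Prod>b\<in>Basis. c b \<bullet> e (m p b)) = (\<Prod>i\<in>UNIV. c (idx i) \<bullet> e (m p (idx i)))"
      by (rule prod.reindex_bij_betw[OF idx, symmetric])
    ultimately show "of_int (sign (m p)) * (\<Prod>b\<in>Basis. c b \<bullet> e (m p b)) =
      of_int (sign p) * (\<Prod>i\<in>UNIV. c (idx i) \<bullet> e (idx (p i)))"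
      unfolding m_def using inj by (simp add: map_permutation_apply)
  next
    fix p :: "'a \<Rightarrow> 'a" assume p: "p \<in> {p. p permutes Basis}"
    then show "m (map_permutation Basis (inv idx) p) = p" using inv' by simp
    show "map_permutation Basis (inv idx) p \<in> {p. p permutes UNIV}"
      using p map_permutation_permutes[OF bij_betw_inv_into[OF idx]] by simp
  qed
  finally show ?thesis by (simp add: lin_det_def)
qed

text \<open>The coordinates of a Euclidean space are indexed by a set of basis vectors, those of a matrix by a
  type. A type of the right cardinality allows the criterion for matrices to be transferred.\<close>

lemma lin_det_eq_0_iff:
  fixes c :: "'a::euclidean_space \<Rightarrow> 'b::euclidean_space"
  assumes card: "CARD('i::finite) = DIM('a)"
    and e: "bij_betw e (Basis :: 'a set) (Basis :: 'b set)"
  shows "lin_det e c = 0 \<longleftrightarrow> (\<exists>v. v \<noteq> 0 \<and> (\<Sum>b\<in>Basis. (v \<bullet> b) *\<^sub>R c b) = 0)"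
proof -
  obtain idx :: "'i \<Rightarrow> 'a" where idx: "bij_betw idx UNIV Basis"
    using finite_same_card_bij[OF finite_class.finite_UNIV finite_Basis] card by blast
  define M :: "real^'i^'i" where "M = (\<chi> i j. c (idx i) \<bullet> e (idx j))"
  have eidx: "bij_betw (e \<circ> idx) UNIV Basis"
    using bij_betw_trans[OF idx e] .
  have rows: "(\<Sum>i\<in>UNIV. a i *s row i M) = 0 \<longleftrightarrow> (\<Sum>i\<in>UNIV. a i *\<^sub>R c (idx i)) = 0" for a
  proof -
    have "(\<Sum>i\<in>UNIV. a i *s row i M) = 0 \<longleftrightarrow>
        (\<forall>j. (\<Sum>i\<in>UNIV. a i *\<^sub>R c (idx i)) \<bullet> (e \<circ> idx) j = 0)"
      by (simp add: vec_eq_iff row_def M_def inner_sum_left)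
    also have "\<dots> \<longleftrightarrow> (\<forall>b\<in>Basis. (\<Sum>i\<in>UNIV. a i *\<^sub>R c (idx i)) \<bullet> b = 0)"
      by (metis (no_types, lifting) eidx bij_betw_def rangeI imageE)
    finally show ?thesis by (simp add: euclidean_all_zero_iff)
  qed
  have "lin_det e c \<noteq> 0 \<longleftrightarrow> (\<exists>B. M ** B = mat 1)"
    unfolding lin_det_eq_det[OF idx] M_def[symmetric] invertible_det_nz[symmetric]
    by (rule invertible_right_inverse)
  also have "\<dots> \<longleftrightarrow> (\<forall>a. (\<Sum>i\<in>UNIV. a i *\<^sub>R c (idx i)) = 0 \<longrightarrow> (\<forall>i. a i = 0))"
    by (simp add: matrix_right_invertible_independent_rows rows)
  also have "\<dots> \<longleftrightarrow> (\<forall>v. (\<Sum>b\<in>Basis. (v \<bullet> b) *\<^sub>R c b) = 0 \<longrightarrow> v = 0)"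
  proof -
    have sum: "(\<Sum>b\<in>Basis. (v \<bullet> b) *\<^sub>R c b) = (\<Sum>i\<in>UNIV. (v \<bullet> idx i) *\<^sub>R c (idx i))" for v
      by (rule sum.reindex_bij_betw[OF idx, symmetric])
    have zero: "v = 0 \<longleftrightarrow> (\<forall>i. v \<bullet> idx i = 0)" for v
    proof -
      have "v = 0 \<longleftrightarrow> (\<forall>b\<in>range idx. v \<bullet> b = 0)"
        using idx euclidean_all_zero_iff[of v] by (simp add: bij_betw_def)
      then show ?thesis by simp
    qed
    have ex: "\<exists>v. \<forall>i. v \<bullet> idx i = a i" for a
    proof (intro exI allI)
      fix i
      have bas: "idx i \<in> Basis" using idx by (auto simp: bij_betw_def)
      have "(\<Sum>b\<in>Basis. a (inv idx b) *\<^sub>R b) \<bullet> idx i = a (inv idx (idx i))"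
        using bas by (simp add: inner_sum_left_Basis)
      then show "(\<Sum>b\<in>Basis. a (inv idx b) *\<^sub>R b) \<bullet> idx i = a i"
        using idx by (simp add: bij_betw_def)
    qed
    show ?thesis
    proof (intro iffI allI impI)
      fix v assume *: "\<forall>a. (\<Sum>i\<in>UNIV. a i *\<^sub>R c (idx i)) = 0 \<longrightarrow> (\<forall>i. a i = 0)"
        "(\<Sum>b\<in>Basis. (v \<bullet> b) *\<^sub>R c b) = 0"
      then show "v = 0" using *(1)[rule_format, of "\<lambda>i. v \<bullet> idx i"] by (simp add: sum zero)
    next
      fix a i assume *: "\<forall>v. (\<Sum>b\<in>Basis. (v \<bullet> b) *\<^sub>R c b) = 0 \<longrightarrow> v = 0"
        "(\<Sum>i\<in>UNIV. a i *\<^sub>R c (idx i)) = 0"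
      obtain v where v: "\<forall>i. v \<bullet> idx i = a i" using ex by blast
      then have "v = 0" using * by (simp add: sum)
      then show "a i = 0" using v by auto
    qed
  qed
  finally show ?thesis by blast
qed

lemma lin_det_column_linear:
  assumes "b0 \<in> Basis"
  shows "linear (\<lambda>z. lin_det e (c(b0 := z)))"
proof -
  have split: "(\<Prod>b\<in>Basis. (c(b0 := z)) b \<bullet> e (\<sigma> b)) =
      (z \<bullet> e (\<sigma> b0)) * (\<Prod>b\<in>Basis - {b0}. c b \<bullet> e (\<sigma> b))" for z \<sigma>
    using assms by (subst prod.remove[of _ b0]) (auto intro!: prod.cong arg_cong2[of _ _ _ _ "(*)"])
  show ?thesis
    unfolding lin_det_def split
    by (rule linearI) (simp_all add: inner_add_left algebra_simps sum.distrib sum_distrib_left)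
qed

text \<open>The image of \<open>k\<close> is the combination of the columns with the coordinates of \<open>k\<close> as coefficients. By
  linearity in the column \<open>b0\<close>, every other column that enters produces a determinant with a repeated
  column.\<close>

lemma lin_det_replace_column:
  fixes c :: "'a::euclidean_space \<Rightarrow> 'b::euclidean_space"
  assumes card: "CARD('i::finite) = DIM('a)"
    and e: "bij_betw e (Basis :: 'a set) (Basis :: 'b set)"
    and c: "linear c" and b0: "b0 \<in> Basis"
  shows "(k \<bullet> b0) * lin_det e c = lin_det e (c(b0 := c k))"
proof -
  interpret l: linear "\<lambda>z. lin_det e (c(b0 := z))"
    by (rule lin_det_column_linear[OF b0])
  have other: "lin_det e (c(b0 := c b)) = 0" if b: "b \<in> Basis" "b \<noteq> b0" for b
  proof -
    have "(\<Sum>b'\<in>Basis. ((b - b0) \<bullet> b') *\<^sub>R (c(b0 := c b)) b') =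
        (\<Sum>b'\<in>Basis. (if b' = b then c b else if b' = b0 then - c b else 0))"
      using b b0 by (intro sum.cong) (auto simp: inner_diff_left inner_Basis)
    also have "\<dots> = (\<Sum>b'\<in>{b, b0}. (if b' = b then c b else if b' = b0 then - c b else 0))"
      using b b0 by (intro sum.mono_neutral_right) auto
    also have "\<dots> = 0" using b by simp
    finally show ?thesis
      unfolding lin_det_eq_0_iff[OF card e] using b by (intro exI[of _ "b - b0"]) auto
  qed
  have "c (\<Sum>b\<in>Basis. (k \<bullet> b) *\<^sub>R b) = (\<Sum>b\<in>Basis. (k \<bullet> b) *\<^sub>R c b)"
    by (simp add: linear_sum[OF c] linear_scale[OF c])
  then have "c k = (\<Sum>b\<in>Basis. (k \<bullet> b) *\<^sub>R c b)"
    by (simp add: euclidean_representation)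
  then have "lin_det e (c(b0 := c k)) = (\<Sum>b\<in>Basis. (k \<bullet> b) * lin_det e (c(b0 := c b)))"
    by (simp add: l.sum l.scale)
  also have "\<dots> = (k \<bullet> b0) * lin_det e (c(b0 := c b0))"
    using b0 other by (subst sum.remove[of _ b0]) auto
  finally show ?thesis by simp
qed

lemma differentiable_prod:
  fixes f :: "'i \<Rightarrow> 'a::real_normed_vector \<Rightarrow> real"
  assumes "\<And>i. i \<in> I \<Longrightarrow> f i differentiable (at x)"
  shows "(\<lambda>x. \<Prod>i\<in>I. f i x) differentiable (at x)"
  using assms by (induction I rule: infinite_finite_induct) auto

lemma jac_det_differentiable:
  assumes f: "smooth_on_open W f" and p: "p \<in> W"
  shows "jac_det e f differentiable (at p)"
proof -
  have "(\<lambda>p. frechet_derivative f (at p) b \<bullet> z) differentiable (at p)" for b z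
    using smooth_imp_differentiable[OF smooth_frechet_derivative[OF f] p]
    by (intro differentiable_inner) auto
  then have "(\<lambda>p. \<Prod>b\<in>Basis. frechet_derivative f (at p) b \<bullet> e (\<sigma> b)) differentiable (at p)" for \<sigma>
    by (rule differentiable_prod)
  then show ?thesis
    unfolding jac_det_def lin_det_def
    by (intro differentiable_sum differentiable_mult) (auto simp: finite_permutations)
qed

lemma smooth_line: "smooth_on_open UNIV (\<lambda>\<tau>::real. p + \<tau> *\<^sub>R v)"
  by (intro smooth_intros) auto

text \<open>Here the kernel of \<open>df\<close> is a line \<open>\<real>k\<close> at the zeros of \<open>D\<close> and trivial elsewhere. Trading one
  column of the Jacobian matrix for the image of \<open>k\<close>, which near a zero of \<open>D\<close> is \<open>\<tau> w\<close> along the line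
  with direction \<open>v\<close>, exhibits the Jacobian determinant as \<open>\<tau>\<close> times the determinant of a map
  that is invertible at \<open>\<tau> = 0\<close>, because \<open>w\<close> is not in the range of \<open>df\<close>. So the determinant has a simple zero.
  The zero set of \<open>D\<close> is a graph in the direction \<open>v\<close>, so that every vector killed by \<open>dD\<close> is the
  velocity of a curve that is pushed back into it along \<open>v\<close>.\<close>

lemma only_foldsI:
  fixes f :: "'a::euclidean_space \<Rightarrow> 'b::euclidean_space" and D :: "'a \<Rightarrow> real"
  assumes card: "CARD('i::finite) = DIM('a)" and dim: "DIM('a) = DIM('b)"
    and f: "smooth_on_open W f" and D: "smooth_on_open W D"
    and D_shift: "\<And>p s. D (p + s *\<^sub>R v) = D p + s"
    and regular: "\<And>p u. p \<in> W \<Longrightarrow> D p \<noteq> 0 \<Longrightarrow> frechet_derivative f (at p) u = 0 \<Longrightarrow> u = 0"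
    and kernel: "\<And>p. p \<in> W \<Longrightarrow> D p = 0 \<Longrightarrow> \<exists>k w.
       k \<noteq> 0 \<and> (\<forall>u. frechet_derivative f (at p) u = 0 \<longrightarrow> (\<exists>s. u = s *\<^sub>R k)) \<and>
       (\<forall>\<tau>. p + \<tau> *\<^sub>R v \<in> W \<longrightarrow> frechet_derivative f (at (p + \<tau> *\<^sub>R v)) k = \<tau> *\<^sub>R w) \<and>
       w \<notin> range (frechet_derivative f (at p)) \<and> frechet_derivative D (at p) k \<noteq> 0"
  shows "only_folds W f"
  unfolding only_folds_def
proof (intro conjI allI impI ballI dim f)
  fix e :: "'a \<Rightarrow> 'b" assume e: "bij_betw e Basis Basis"
  have W: "open W" using f smooth_imp_open by blast
  have lin: "linear (frechet_derivative f (at p))" if "p \<in> W" for p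
    using smooth_imp_differentiable[OF f that] by (rule linear_frechet_derivative)
  have expand: "(\<Sum>b\<in>Basis. (u \<bullet> b) *\<^sub>R frechet_derivative f (at p) b) = frechet_derivative f (at p) u"
    if "p \<in> W" for p u
    by (rule frechet_derivative_basis_expansion[OF smooth_imp_differentiable[OF f that], symmetric])
  have zero: "jac_det e f p = 0 \<longleftrightarrow> D p = 0" if p: "p \<in> W" for p
  proof
    show "D p = 0" if "jac_det e f p = 0"
      using that regular[OF p]
      unfolding jac_det_def lin_det_eq_0_iff[OF card e] expand[OF p] by blast
  next
    assume "D p = 0"
    from kernel[OF p this] obtain k w where k: "k \<noteq> 0"
      "\<forall>\<tau>. p + \<tau> *\<^sub>R v \<in> W \<longrightarrow> frechet_derivative f (at (p + \<tau> *\<^sub>R v)) k = \<tau> *\<^sub>R w" by blast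
    from k(2)[rule_format, of 0] p have "frechet_derivative f (at p) k = 0" by simp
    then show "jac_det e f p = 0"
      using k(1) unfolding jac_det_def lin_det_eq_0_iff[OF card e] expand[OF p] by blast
  qed
  have simple: "frechet_derivative (jac_det e f) (at p) v \<noteq> 0" if p: "p \<in> W" and Dp: "D p = 0" for p
  proof -
    from kernel[OF p Dp] obtain k w where k: "k \<noteq> 0"
      and line: "\<And>u. frechet_derivative f (at p) u = 0 \<Longrightarrow> \<exists>s. u = s *\<^sub>R k"
      and k_shift: "\<And>\<tau>. p + \<tau> *\<^sub>R v \<in> W \<Longrightarrow> frechet_derivative f (at (p + \<tau> *\<^sub>R v)) k = \<tau> *\<^sub>R w"
      and w: "w \<notin> range (frechet_derivative f (at p))" by blast
    obtain b0 where b0: "b0 \<in> Basis" "k \<bullet> b0 \<noteq> 0"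
      using k euclidean_all_zero_iff by blast
    \<comment> \<open>The traded column has to be one that occurs in \<open>k\<close>.\<close>
    define F where "F = (\<lambda>\<tau>. (frechet_derivative f (at (p + \<tau> *\<^sub>R v)))(b0 := w))"
    define h where "h = (\<lambda>\<tau>. lin_det e (F \<tau>) / (k \<bullet> b0))"
    define I where "I = (\<lambda>\<tau>. p + \<tau> *\<^sub>R v) -` W"
    have I: "open I" "0 \<in> I"
      unfolding I_def using p by (auto intro!: open_vimage W continuous_intros)
    have J: "jac_det e f (p + \<tau> *\<^sub>R v) = \<tau> * h \<tau>" if "\<tau> \<in> I" for \<tau>
    proof -
      have q: "p + \<tau> *\<^sub>R v \<in> W" using that by (simp add: I_def)
      have "(k \<bullet> b0) * jac_det e f (p + \<tau> *\<^sub>R v) =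
          lin_det e ((frechet_derivative f (at (p + \<tau> *\<^sub>R v)))(b0 := \<tau> *\<^sub>R w))"
        unfolding jac_det_def lin_det_replace_column[OF card e lin[OF q] b0(1)] k_shift[OF q] ..
      also have "\<dots> = \<tau> * lin_det e (F \<tau>)"
        using linear_scale[OF lin_det_column_linear[OF b0(1)]] unfolding F_def by auto
      finally show ?thesis using b0 by (simp add: h_def field_simps)
    qed
    have "isCont (\<lambda>\<tau>. frechet_derivative f (at (p + \<tau> *\<^sub>R v)) b) 0" for b
    proof -
      have "smooth_on_open I (\<lambda>\<tau>. frechet_derivative f (at (p + \<tau> *\<^sub>R v)) b)"
        by (rule smooth_compose[OF smooth_frechet_derivative[OF f] smooth_subset[OF smooth_line]])
          (use I in \<open>auto simp: I_def\<close>)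
      then show ?thesis
        using I smooth_imp_continuous_on continuous_on_eq_continuous_at by blast
    qed
    then have "isCont (\<lambda>\<tau>. F \<tau> b) 0" for b
      by (cases "b = b0") (simp_all add: F_def)
    then have h_cont: "isCont h 0"
      unfolding h_def lin_det_def using b0 by (intro continuous_intros) auto
    have h0: "h 0 \<noteq> 0"
    proof
      assume "h 0 = 0"
      then have "lin_det e (F 0) = 0" using b0 by (simp add: h_def)
      then obtain u where u: "u \<noteq> 0" "(\<Sum>b\<in>Basis. (u \<bullet> b) *\<^sub>R F 0 b) = 0"
        unfolding lin_det_eq_0_iff[OF card e] by blast
      let ?u = "u - (u \<bullet> b0) *\<^sub>R b0"
      have "(\<Sum>b\<in>Basis. (u \<bullet> b) *\<^sub>R F 0 b) =
          (u \<bullet> b0) *\<^sub>R w + (\<Sum>b\<in>Basis - {b0}. (u \<bullet> b) *\<^sub>R frechet_derivative f (at p) b)"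
        using b0 by (subst sum.remove[of _ b0]) (auto simp: F_def)
      also have "(\<Sum>b\<in>Basis - {b0}. (u \<bullet> b) *\<^sub>R frechet_derivative f (at p) b) =
          frechet_derivative f (at p) u - (u \<bullet> b0) *\<^sub>R frechet_derivative f (at p) b0"
        using sum.remove[OF finite_Basis b0(1), of "\<lambda>b. (u \<bullet> b) *\<^sub>R frechet_derivative f (at p) b"]
        unfolding expand[OF p] by simp
      also have "\<dots> = frechet_derivative f (at p) ?u"
        by (simp add: linear_diff[OF lin[OF p]] linear_scale[OF lin[OF p]])
      finally have eq: "(u \<bullet> b0) *\<^sub>R w + frechet_derivative f (at p) ?u = 0" using u by simp
      have "u \<bullet> b0 = 0"
      proof (rule ccontr)
        assume n: "u \<bullet> b0 \<noteq> 0"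
        from eq have "(u \<bullet> b0) *\<^sub>R w = - frechet_derivative f (at p) ?u"
          by (simp add: eq_neg_iff_add_eq_0)
        then have "inverse (u \<bullet> b0) *\<^sub>R (u \<bullet> b0) *\<^sub>R w = inverse (u \<bullet> b0) *\<^sub>R (- frechet_derivative f (at p) ?u)"
          by simp
        then have "w = frechet_derivative f (at p) ((- inverse (u \<bullet> b0)) *\<^sub>R ?u)"
          using n by (subst linear_scale[OF lin[OF p]]) simp
        then show False using w by blast
      qed
      with eq have "frechet_derivative f (at p) u = 0" by simp
      from line[OF this] obtain s where "u = s *\<^sub>R k" by blast
      with \<open>u \<bullet> b0 = 0\<close> b0 u show False by simp
    qed
    have "((\<lambda>\<tau>. \<tau> * h \<tau>) has_field_derivative h 0) (at 0)"
    proof -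
      have "((\<lambda>\<tau>. (\<tau> * h \<tau> - 0 * h 0) / (\<tau> - 0)) \<longlongrightarrow> h 0) (at 0)"
        by (rule Lim_transform_eventually[OF isContD[OF h_cont]])
           (auto simp: eventually_at_filter)
      then show ?thesis by (simp add: has_field_derivative_iff)
    qed
    then have "((\<lambda>\<tau>. jac_det e f (p + \<tau> *\<^sub>R v)) has_field_derivative h 0) (at 0)"
      by (rule has_field_derivative_transform_within_open[OF _ I]) (simp add: J)
    moreover have "((\<lambda>\<tau>. jac_det e f (p + \<tau> *\<^sub>R v)) has_derivative
        (\<lambda>\<tau>. frechet_derivative (jac_det e f) (at p) (\<tau> *\<^sub>R v))) (at 0)"
      by (rule has_derivative_compose[where g = "jac_det e f" and f = "\<lambda>\<tau>. p + \<tau> *\<^sub>R v"])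
         (use jac_det_differentiable[OF f p] in
           \<open>auto intro!: derivative_eq_intros simp: frechet_derivative_works\<close>)
    ultimately have "h 0 * 1 = frechet_derivative (jac_det e f) (at p) (1 *\<^sub>R v)"
      unfolding has_field_derivative_def by (metis has_derivative_unique)
    then show ?thesis using h0 by simp
  qed
  have S1: "S\<^sub>1 e W f = {p \<in> W. D p = 0}"
    unfolding S\<^sub>1_def using zero simple by force
  fix p assume p: "p \<in> W" and "jac_det e f p = 0"
  then have Dp: "D p = 0" using zero by simp
  show "p \<in> S\<^sub>1 e W f" using S1 p Dp by simp
  have linD: "linear (frechet_derivative D (at p))"
    using smooth_imp_differentiable[OF D p] by (rule linear_frechet_derivative)
  have Dv: "frechet_derivative D (at p) v = 1"
  proof -
    have "((\<lambda>\<tau>. D (p + \<tau> *\<^sub>R v)) has_derivative (\<lambda>\<tau>. frechet_derivative D (at p) (\<tau> *\<^sub>R v))) (at 0)"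
      by (rule has_derivative_compose[where g = D and f = "\<lambda>\<tau>. p + \<tau> *\<^sub>R v"])
         (use smooth_has_derivative[OF D p] in \<open>auto intro!: derivative_eq_intros\<close>)
    moreover have "((\<lambda>\<tau>. D p + \<tau>) has_derivative (\<lambda>\<tau>. \<tau>)) (at 0)"
      by (auto intro!: derivative_eq_intros)
    ultimately have "(\<lambda>\<tau>. frechet_derivative D (at p) (\<tau> *\<^sub>R v)) = (\<lambda>\<tau>. \<tau>)"
      unfolding D_shift by (rule has_derivative_unique)
    from fun_cong[OF this, of 1] show ?thesis by simp
  qed
  have tangent: "u \<in> tangent_space (S\<^sub>1 e W f) p" if u: "frechet_derivative D (at p) u = 0" for u
  proof -
    \<comment> \<open>The straight line with velocity \<open>u\<close>, pushed back along \<open>v\<close> into the zero set of \<open>D\<close>.\<close>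
    define \<gamma> where "\<gamma> = (\<lambda>\<tau>. p + \<tau> *\<^sub>R u - D (p + \<tau> *\<^sub>R u) *\<^sub>R v)"
    define I where "I = (\<lambda>\<tau>. p + \<tau> *\<^sub>R u) -` W"
    have I: "open I" "0 \<in> I"
      unfolding I_def using p by (auto intro!: open_vimage W continuous_intros)
    have D_line: "smooth_on_open I (\<lambda>\<tau>. D (p + \<tau> *\<^sub>R u))"
      by (rule smooth_compose[OF D smooth_subset[OF smooth_line]]) (use I in \<open>auto simp: I_def\<close>)
    have sm: "smooth_on_open I \<gamma>"
      unfolding \<gamma>_def by (intro smooth_intros D_line I smooth_subset[OF smooth_line]) auto
    have \<gamma>0: "\<gamma> 0 = p" by (simp add: \<gamma>_def Dp)
    have "continuous_on I \<gamma>" using sm by (rule smooth_imp_continuous_on)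
    then have "open (I \<inter> \<gamma> -` W)" using I W by (simp add: continuous_on_open_vimage Int_commute)
    moreover have "0 \<in> I \<inter> \<gamma> -` W" using I \<gamma>0 p by simp
    ultimately obtain \<delta> where \<delta>: "\<delta> > 0" "ball 0 \<delta> \<subseteq> I \<inter> \<gamma> -` W"
      using open_contains_ball by blast
    have ball: "{-\<delta><..<\<delta>} = ball 0 \<delta>" by (auto simp: dist_real_def)
    have "D (\<gamma> \<tau>) = 0" for \<tau>
      using D_shift[of "p + \<tau> *\<^sub>R u" "- D (p + \<tau> *\<^sub>R u)"] by (simp add: \<gamma>_def)
    then have "\<gamma> ` {-\<delta><..<\<delta>} \<subseteq> S\<^sub>1 e W f" using \<delta> unfolding ball S1 by auto
    moreover have "smooth_on_open {-\<delta><..<\<delta>} \<gamma>"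
      by (rule smooth_subset[OF sm]) (use \<delta> ball in auto)
    moreover have "(\<gamma> has_vector_derivative u) (at 0)"
    proof -
      have "((\<lambda>\<tau>. D (p + \<tau> *\<^sub>R u)) has_derivative (\<lambda>\<tau>. frechet_derivative D (at p) (\<tau> *\<^sub>R u))) (at 0)"
        by (rule has_derivative_compose[where g = D and f = "\<lambda>\<tau>. p + \<tau> *\<^sub>R u"])
           (use smooth_has_derivative[OF D p] in \<open>auto intro!: derivative_eq_intros\<close>)
      then have "((\<lambda>\<tau>. D (p + \<tau> *\<^sub>R u)) has_derivative (\<lambda>\<tau>. 0)) (at 0)"
        using u by (simp add: linear_scale[OF linD])
      then show ?thesis
        unfolding \<gamma>_def has_vector_derivative_def by (auto intro!: derivative_eq_intros)
    qed
    ultimately show ?thesis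
      unfolding tangent_space_def using \<delta>(1) \<gamma>0 by blast
  qed
  from kernel[OF p Dp] obtain k w where k: "frechet_derivative D (at p) k \<noteq> 0"
    and k_shift: "\<And>\<tau>. p + \<tau> *\<^sub>R v \<in> W \<Longrightarrow> frechet_derivative f (at (p + \<tau> *\<^sub>R v)) k = \<tau> *\<^sub>R w" by blast
  from k_shift[of 0] p have fk: "frechet_derivative f (at p) k = 0" by simp
  show "{v + w | v w. frechet_derivative f (at p) v = 0 \<and> w \<in> tangent_space (S\<^sub>1 e W f) p} = UNIV"
  proof -
    have "\<exists>a b. u = a + b \<and> frechet_derivative f (at p) a = 0 \<and> b \<in> tangent_space (S\<^sub>1 e W f) p" for u
    proof (intro exI conjI)
      define s where "s = frechet_derivative D (at p) u / frechet_derivative D (at p) k"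
      show "u = s *\<^sub>R k + (u - s *\<^sub>R k)" by simp
      show "frechet_derivative f (at p) (s *\<^sub>R k) = 0"
        by (simp add: linear_scale[OF lin[OF p]] fk)
      show "u - s *\<^sub>R k \<in> tangent_space (S\<^sub>1 e W f) p"
        by (rule tangent) (use k in \<open>simp add: linear_diff[OF linD] linear_scale[OF linD] s_def\<close>)
    qed
    then show ?thesis by blast
  qed
qed


section \<open>Geometry of the half-cylinder\<close>

text \<open>The half-cylinder is a graph over the first \<open>n - 1\<close> coordinates, so vectors are taken apart into
  these coordinates and the last one.\<close>

definition up :: "real ^ 'm \<Rightarrow> real \<Rightarrow> real ^ 'm::finite option" where
  "up h s = (\<chi> j. case j of Some i \<Rightarrow> h $ i | None \<Rightarrow> s)"

definition tail :: "real ^ 'm::finite option \<Rightarrow> real ^ 'm" where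
  "tail z = (\<chi> i. z $ Some i)"

lemma up_nth [simp]: "up h s $ None = s" "up h s $ Some i = h $ i" "tail z $ i = z $ Some i"
  by (simp_all add: up_def tail_def)

lemma tail_up [simp]: "tail (up h s) = h"
  by (simp add: vec_eq_iff)

lemma up_tail [simp]: "up (tail z) (z $ None) = z"
  by (simp add: vec_eq_iff up_def split: option.split)

lemma vec_option_eq_iff: "z = z' \<longleftrightarrow> tail z = tail z' \<and> z $ None = z' $ None"
  by (metis up_tail)

lemma inner_option: "z \<bullet> z' = tail z \<bullet> tail z' + z $ None * z' $ None"
proof -
  have "(\<Sum>j\<in>UNIV. f j) = f None + (\<Sum>i\<in>UNIV. f (Some i))" for f :: "'a option \<Rightarrow> real"
    by (simp add: UNIV_option_conv sum.reindex)
  then show ?thesis by (simp add: inner_vec_def)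
qed

lemma tail_linear [simp]:
  "tail (a + b) = tail a + tail b" "tail (a - b) = tail a - tail b" "tail (r *\<^sub>R a) = r *\<^sub>R tail a" "tail 0 = 0"
  "tail (- a) = - tail a"
  by (simp_all add: vec_eq_iff)

lemma bounded_linear_tail: "bounded_linear tail"
  unfolding linear_conv_bounded_linear[symmetric] by (intro linearI) simp_all

lemma bounded_linear_up: "bounded_linear (\<lambda>z. up (fst z) (snd z))"
  unfolding linear_conv_bounded_linear[symmetric] by (intro linearI) (simp_all add: vec_option_eq_iff)

lemma smooth_up [smooth_intros]:
  "smooth_on_open W f \<Longrightarrow> smooth_on_open W s \<Longrightarrow> smooth_on_open W (\<lambda>x. up (f x) (s x))"
  using smooth_linear_image[OF bounded_linear_up, of W "\<lambda>x. (f x, s x)"] smooth_Pair by auto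

lemmas smooth_tail [smooth_intros] = smooth_linear_image[OF bounded_linear_tail]

lemma has_derivative_up [derivative_intros]:
  assumes "(f has_derivative f') (at x within S)" "(s has_derivative s') (at x within S)"
  shows "((\<lambda>x. up (f x) (s x)) has_derivative (\<lambda>h. up (f' h) (s' h))) (at x within S)"
  using bounded_linear.has_derivative[OF bounded_linear_up has_derivative_Pair[OF assms]] by simp

lemmas has_derivative_tail [derivative_intros] = bounded_linear.has_derivative[OF bounded_linear_tail]
lemmas has_derivative_matrix_vector [derivative_intros] =
  bounded_linear.has_derivative[OF matrix_vector_mul_bounded_linear]

definition cross_section :: "'m::finite \<Rightarrow> real ^ 'm \<Rightarrow> real ^ 'm" where
  "cross_section \<iota> y = (\<chi> i. if i = \<iota> then 0 else y $ i)"

lemma bounded_linear_cross_section: "bounded_linear (cross_section \<iota>)"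
  unfolding linear_conv_bounded_linear[symmetric]
  by (intro linearI) (simp_all add: cross_section_def vec_eq_iff)

lemmas smooth_cross_section [smooth_intros] = smooth_linear_image[OF bounded_linear_cross_section]
lemmas has_derivative_cross_section [derivative_intros] =
  bounded_linear.has_derivative[OF bounded_linear_cross_section]

lemma inner_cross_section: "cross_section \<iota> y \<bullet> cross_section \<iota> z = y \<bullet> cross_section \<iota> z"
  by (auto simp: inner_vec_def cross_section_def intro!: sum.cong)

lemma sum_squares_cross_section: "(\<Sum>i\<in>UNIV - {\<iota>}. (y $ i)\<^sup>2) = cross_section \<iota> y \<bullet> cross_section \<iota> y"
proof -
  have "cross_section \<iota> y \<bullet> cross_section \<iota> y = (\<Sum>i\<in>UNIV - {\<iota>}. cross_section \<iota> y $ i * cross_section \<iota> y $ i)"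
    unfolding inner_vec_def inner_real_def
    by (intro sum.mono_neutral_right) (auto simp: cross_section_def)
  also have "\<dots> = (\<Sum>i\<in>UNIV - {\<iota>}. (y $ i)\<^sup>2)"
    by (intro sum.cong) (auto simp: cross_section_def power2_eq_square)
  finally show ?thesis by simp
qed

lemma Omega_eq: "Omega \<iota> = {y. cross_section \<iota> y \<bullet> cross_section \<iota> y < 1}"
  by (simp add: Omega_def sum_squares_cross_section)

lemma q_fun_eq: "q_fun \<iota> y = sqrt (1 - cross_section \<iota> y \<bullet> cross_section \<iota> y)"
  by (simp add: q_fun_def sum_squares_cross_section)

lemma centre_eq: "centre \<iota> y = up y (q_fun \<iota> y)"
  by (simp add: centre_def up_def)

lemma open_Omega: "open (Omega \<iota>)"
  unfolding Omega_eq
  by (intro open_Collect_less continuous_intros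
      bounded_linear.continuous_on[OF bounded_linear_cross_section])

lemma q_fun_pos: "y \<in> Omega \<iota> \<Longrightarrow> q_fun \<iota> y > 0"
  by (simp add: Omega_eq q_fun_eq)

lemma smooth_q_fun: "smooth_on_open (Omega \<iota>) (q_fun \<iota>)"
  unfolding q_fun_eq by (intro smooth_intros open_Omega) (simp add: Omega_eq)

lemma smooth_centre: "smooth_on_open (Omega \<iota>) (centre \<iota>)"
  unfolding centre_eq by (intro smooth_intros smooth_q_fun open_Omega)

text \<open>The vector \<open>-\<nabla>q\<close>.\<close>

definition slope :: "'m::finite \<Rightarrow> real ^ 'm \<Rightarrow> real ^ 'm" where
  "slope \<iota> y = (1 / q_fun \<iota> y) *\<^sub>R cross_section \<iota> y"

definition normal :: "'m::finite \<Rightarrow> real ^ 'm \<Rightarrow> real ^ 'm option" where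
  "normal \<iota> y = up (slope \<iota> y) 1"

definition d_centre :: "'m::finite \<Rightarrow> real ^ 'm \<Rightarrow> real ^ 'm \<Rightarrow> real ^ 'm option" where
  "d_centre \<iota> y h = up h (- (slope \<iota> y \<bullet> h))"

text \<open>The negative Hessian of \<open>q\<close> at \<open>y\<close>, applied to \<open>h\<close>.\<close>

definition d_slope :: "'m::finite \<Rightarrow> real ^ 'm \<Rightarrow> real ^ 'm \<Rightarrow> real ^ 'm" where
  "d_slope \<iota> y h = (1 / q_fun \<iota> y) *\<^sub>R (cross_section \<iota> h + (slope \<iota> y \<bullet> h) *\<^sub>R slope \<iota> y)"

text \<open>The adjoint of \<open>d_centre\<close>, which is multiplication by the matrix \<open>B\<close>.\<close>

definition B_map :: "'m::finite \<Rightarrow> real ^ 'm \<Rightarrow> real ^ 'm option \<Rightarrow> real ^ 'm" where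
  "B_map \<iota> y z = tail z - (z $ None) *\<^sub>R slope \<iota> y"

lemma smooth_slope: "smooth_on_open (Omega \<iota>) (slope \<iota>)"
  unfolding slope_def by (intro smooth_intros smooth_q_fun open_Omega q_fun_pos)

lemma q_fun_has_derivative:
  assumes "y \<in> Omega \<iota>"
  shows "(q_fun \<iota> has_derivative (\<lambda>h. - (slope \<iota> y \<bullet> h))) (at y)"
proof -
  have pos: "1 - cross_section \<iota> y \<bullet> cross_section \<iota> y > 0" using assms by (simp add: Omega_eq)
  show ?thesis
    unfolding q_fun_eq slope_def
    by (rule derivative_eq_intros refl pos)+
       (auto simp: inner_commute divide_simps inner_cross_section[of \<iota> _ y, symmetric] fun_eq_iff)
qed

lemma centre_has_derivative:
  "y \<in> Omega \<iota> \<Longrightarrow> (centre \<iota> has_derivative d_centre \<iota> y) (at y)"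
  unfolding centre_eq d_centre_def by (auto intro!: derivative_eq_intros q_fun_has_derivative)

lemma slope_has_derivative:
  assumes "y \<in> Omega \<iota>"
  shows "(slope \<iota> has_derivative d_slope \<iota> y) (at y)"
proof -
  have "q_fun \<iota> y \<noteq> 0" using q_fun_pos[OF assms] by simp
  then show ?thesis
    unfolding slope_def[of \<iota>, abs_def] d_slope_def
    by (auto intro!: derivative_eq_intros q_fun_has_derivative[OF assms]
        simp: fun_eq_iff slope_def scaleR_add_right power2_eq_square field_simps)
qed

lemma normal_d_centre: "normal \<iota> y \<bullet> d_centre \<iota> y h = 0"
  by (simp add: normal_def d_centre_def inner_option)

lemma d_centre_adjoint: "d_centre \<iota> y h \<bullet> z = h \<bullet> B_map \<iota> y z"
  by (simp add: d_centre_def B_map_def inner_option inner_diff_right inner_commute algebra_simps)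

lemma B_map_kernel: "B_map \<iota> y z = 0 \<longleftrightarrow> z = (z $ None) *\<^sub>R normal \<iota> y"
  by (auto simp: B_map_def normal_def vec_option_eq_iff)

lemma tangent_iff: "z \<bullet> normal \<iota> y = 0 \<longleftrightarrow> z = d_centre \<iota> y (tail z)"
  by (auto simp: normal_def d_centre_def vec_option_eq_iff inner_option inner_commute)

text \<open>The Hessian of \<open>q\<close> is negative definite in the directions across the axis: the half-cylinder is
  curved in all its tangential directions except that of the axis.\<close>

lemma second_fundamental_form_zero:
  assumes y: "y \<in> Omega \<iota>" and z: "z \<bullet> normal \<iota> y = 0" and "tail z \<bullet> d_slope \<iota> y (tail z) = 0"
  shows "z \<in> range (\<lambda>s. s *\<^sub>R axis (Some \<iota>) 1)"
proof -
  let ?h = "tail z" and ?c = "cross_section \<iota> (tail z)"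
  have q: "q_fun \<iota> y > 0" using q_fun_pos[OF y] .
  have "?h \<bullet> d_slope \<iota> y ?h = (1 / q_fun \<iota> y) * (?c \<bullet> ?c + (slope \<iota> y \<bullet> ?h)\<^sup>2)"
    by (simp add: d_slope_def inner_add_right inner_cross_section power2_eq_square inner_commute)
  then have "?c \<bullet> ?c + (slope \<iota> y \<bullet> ?h)\<^sup>2 = 0" using assms(3) q by simp
  then have c: "?c = 0" and s: "slope \<iota> y \<bullet> ?h = 0"
    by (simp_all add: add_nonneg_eq_0_iff)
  have "z $ None = 0" using z s by (simp add: normal_def inner_option inner_commute)
  moreover have "z $ Some i = 0" if "i \<noteq> \<iota>" for i
  proof -
    have "cross_section \<iota> (tail z) $ i = 0" using c by simp
    then show ?thesis using that by (simp add: cross_section_def)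
  qed
  ultimately have "z $ j = (z $ Some \<iota> *\<^sub>R axis (Some \<iota>) 1) $ j" for j
    by (cases j) (auto simp: axis_def)
  then have "z = z $ Some \<iota> *\<^sub>R axis (Some \<iota>) 1" unfolding vec_eq_iff by blast
  then show ?thesis by blast
qed

section \<open>The phase function\<close>

definition sqform :: "real ^ 'n ^ 'n \<Rightarrow> real ^ 'n \<Rightarrow> real" where
  "sqform A z = z \<bullet> (A *v z)"

definition signature_matrix :: "'n \<Rightarrow> real ^ 'n ^ 'n" where
  "signature_matrix k = (\<chi> i j. if i = j then (if i = k then 1 else - 1) else 0)"

lemma signature_matrix_nth: "(signature_matrix k *v z) $ j = (if j = k then z $ j else - z $ j)"
proof -
  have "(signature_matrix k *v z) $ j = (\<Sum>i\<in>UNIV. if i = j then (if j = k then z $ j else - z $ j) else 0)"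
    unfolding signature_matrix_def matrix_vector_mult_def
    by (simp add: if_distrib[of "\<lambda>a. a * _"] cong: if_cong)
  then show ?thesis by simp
qed

lemma signature_matrix_involution [simp]: "signature_matrix k *v (signature_matrix k *v z) = z"
  by (simp add: vec_eq_iff signature_matrix_nth)

lemma signature_matrix_symmetric: "(signature_matrix k *v z) \<bullet> z' = z \<bullet> (signature_matrix k *v z')"
  by (auto simp: inner_vec_def signature_matrix_nth intro!: sum.cong)

lemma signature_matrix_isometry [simp]: "(signature_matrix k *v z) \<bullet> (signature_matrix k *v z') = z \<bullet> z'"
  by (simp add: signature_matrix_symmetric)

lemma norm_signature_matrix [simp]: "norm (signature_matrix k *v z) = norm z"
  by (simp add: norm_eq_sqrt_inner)

lemma signature_matrix_eq_0_iff: "signature_matrix k *v z = 0 \<longleftrightarrow> z = 0"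
  by (metis norm_eq_zero norm_signature_matrix)

lemma sqform_signature_matrix: "sqform (signature_matrix k) z = 2 * (z $ k)\<^sup>2 - z \<bullet> z"
proof -
  have "sqform (signature_matrix k) z = (\<Sum>j\<in>UNIV. (if j = k then 2 * (z $ k)\<^sup>2 else 0) - z $ j * z $ j)"
    unfolding sqform_def inner_vec_def
    by (intro sum.cong) (auto simp: signature_matrix_nth power2_eq_square)
  also have "\<dots> = 2 * (z $ k)\<^sup>2 - z \<bullet> z"
    by (simp add: sum_subtractf inner_vec_def)
  finally show ?thesis .
qed

text \<open>The quadratic form has exactly one positive square, so it is negative definite on the complement,
  orthogonal with respect to the form, of any vector \<open>w\<close> on which it is positive. If \<open>n\<close> is orthogonal
  to \<open>w\<close> in the Euclidean sense, then \<open>A *v n\<close> lies in that complement, and the form takes the same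
  value on \<open>n\<close> and on \<open>A *v n\<close>. The estimate is the Cauchy-Schwarz inequality for the components
  other than the \<open>k\<close>-th.\<close>

lemma sqform_neg_if_orthogonal:
  assumes w: "sqform (signature_matrix k) w > 0" and wn: "w \<bullet> n = 0" and n: "n \<noteq> 0"
  shows "sqform (signature_matrix k) n < 0"
proof -
  let ?w = "w - w $ k *\<^sub>R axis k 1" and ?n = "n - n $ k *\<^sub>R axis k 1"
  have ww: "?w \<bullet> ?w = w \<bullet> w - (w $ k)\<^sup>2" and nn: "?n \<bullet> ?n = n \<bullet> n - (n $ k)\<^sup>2"
    and cross: "?w \<bullet> ?n = - (w $ k * n $ k)"
    using wn by (simp_all add: inner_diff_left inner_diff_right inner_axis inner_axis' power2_eq_square)
  have w1: "?w \<bullet> ?w < (w $ k)\<^sup>2" using w by (simp only: sqform_signature_matrix ww)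
  have cs: "(w $ k)\<^sup>2 * (n $ k)\<^sup>2 \<le> (?w \<bullet> ?w) * (?n \<bullet> ?n)"
    using Cauchy_Schwarz_ineq[of ?w ?n] unfolding cross by (simp add: power_mult_distrib)
  have "(n $ k)\<^sup>2 < ?n \<bullet> ?n"
  proof (cases "?n = 0")
    case True
    then have "(w $ k)\<^sup>2 * (n $ k)\<^sup>2 \<le> 0" using cs by simp
    moreover have "(w $ k)\<^sup>2 > 0" using w1 inner_ge_zero[of ?w] by linarith
    ultimately have "n $ k = 0" by (simp add: mult_le_0_iff)
    then have "n = 0" using True by simp
    with n show ?thesis by simp
  next
    case False
    then have "(?w \<bullet> ?w) * (?n \<bullet> ?n) < (w $ k)\<^sup>2 * (?n \<bullet> ?n)"
      using w1 by (intro mult_strict_right_mono) (auto simp: inner_gt_zero_iff)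
    with cs have "(w $ k)\<^sup>2 * (n $ k)\<^sup>2 < (w $ k)\<^sup>2 * (?n \<bullet> ?n)" by linarith
    then show ?thesis by (simp add: mult_less_cancel_left_disj)
  qed
  then show ?thesis by (simp only: sqform_signature_matrix nn)
qed

lemma grad_eqI:
  assumes "(f has_derivative (\<lambda>h. g \<bullet> h)) (at x)"
  shows "grad f x = g"
proof -
  have "frechet_derivative f (at x) = (\<lambda>h. g \<bullet> h)" using frechet_derivative_at[OF assms] by simp
  then show ?thesis by (simp add: grad_def euclidean_representation)
qed

lemma sqform_has_derivative [derivative_intros]:
  assumes "(f has_derivative f') (at x)"
  shows "((\<lambda>x. sqform (signature_matrix k) (f x)) has_derivative
    (\<lambda>h. 2 * ((signature_matrix k *v f x) \<bullet> f' h))) (at x)"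
proof -
  let ?A = "signature_matrix k"
  have "((\<lambda>x. f x \<bullet> (?A *v f x)) has_derivative
      (\<lambda>h. f x \<bullet> (?A *v f' h) + f' h \<bullet> (?A *v f x))) (at x)"
    by (intro derivative_intros assms)
  moreover have "f x \<bullet> (?A *v f' h) + f' h \<bullet> (?A *v f x) = 2 * ((?A *v f x) \<bullet> f' h)" for h
    by (simp add: signature_matrix_symmetric inner_commute[of "f' h"])
  ultimately show ?thesis unfolding sqform_def by simp
qed

lemma smooth_sqform [smooth_intros]: "smooth_on_open W f \<Longrightarrow> smooth_on_open W (\<lambda>x. sqform A (f x))"
  unfolding sqform_def by (intro smooth_intros)

lemma radon_phase_eq: "radon_phase A \<iota> ((y, t), x, \<omega>) = \<omega> * (t - sqform A (x - centre \<iota> y))"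
  by (simp add: radon_phase_def sqform_def)

lemma radon_phase_has_derivative:
  assumes y: "y \<in> Omega \<iota>"
  shows "(radon_phase (signature_matrix k) \<iota> has_derivative (\<lambda>((h, s), l, \<eta>).
      \<eta> * (t - sqform (signature_matrix k) (x - centre \<iota> y)) +
      \<omega> * (s - 2 * ((signature_matrix k *v (x - centre \<iota> y)) \<bullet> (l - d_centre \<iota> y h))))) (at ((y, t), x, \<omega>))"
proof -
  have c: "((\<lambda>p. centre \<iota> (fst (fst p))) has_derivative (\<lambda>h. d_centre \<iota> y (fst (fst h)))) (at ((y, t), x, \<omega>))"
    by (rule has_derivative_compose[where f = "\<lambda>p. fst (fst p)" and g = "centre \<iota>"])
       (auto intro!: derivative_eq_intros centre_has_derivative y)
  have eq: "radon_phase (signature_matrix k) \<iota> = (\<lambda>p. snd (snd p) *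
      (snd (fst p) - sqform (signature_matrix k) (fst (snd p) - centre \<iota> (fst (fst p)))))"
    by (auto simp: radon_phase_eq fun_eq_iff)
  show ?thesis
    unfolding eq by (rule derivative_eq_intros c refl)+ (auto simp: fun_eq_iff algebra_simps)
qed


section \<open>The canonical relation is a two-sided fold\<close>

text \<open>A point that is displaced from the centre along the axis lies on the half-cylinder itself. There
  the kernel of the right projection is a direction in which the cylinder is flat, so that the
  projection would not fold. The displacements along the axis form a closed set, and removing
  them leaves an open set that still contains all pairs with \<open>x\<close> off the half-cylinder.\<close>

definition axis_line :: "'m::finite \<Rightarrow> (real ^ 'm option) set" where
  "axis_line \<iota> = range (\<lambda>s. s *\<^sub>R axis (Some \<iota>) 1)"

definition off_axis :: "'m::finite \<Rightarrow> (((real ^ 'm) \<times> real) \<times> (real ^ 'm option)) set" where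
  "off_axis \<iota> = {((y, t), x). y \<in> Omega \<iota> \<and> t > 0 \<and> x - centre \<iota> y \<notin> axis_line \<iota>}"

lemma zero_in_axis_line: "0 \<in> axis_line \<iota>"
  unfolding axis_line_def by (rule range_eqI[of _ _ 0]) simp

lemma closed_axis_line: "closed (axis_line \<iota>)"
  unfolding axis_line_def span_singleton[symmetric] by (rule closed_span)

lemma smooth_centre_compose [smooth_intros]:
  "smooth_on_open W f \<Longrightarrow> (\<And>x. x \<in> W \<Longrightarrow> f x \<in> Omega \<iota>) \<Longrightarrow> smooth_on_open W (\<lambda>x. centre \<iota> (f x))"
  by (rule smooth_compose[OF smooth_centre])

lemma smooth_slope_compose [smooth_intros]:
  "smooth_on_open W f \<Longrightarrow> (\<And>x. x \<in> W \<Longrightarrow> f x \<in> Omega \<iota>) \<Longrightarrow> smooth_on_open W (\<lambda>x. slope \<iota> (f x))"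
  by (rule smooth_compose[OF smooth_slope])

definition displacement :: "'m::finite \<Rightarrow> ((real ^ 'm) \<times> real) \<times> (real ^ 'm option) \<Rightarrow> real ^ 'm option" where
  "displacement \<iota> p = snd p - centre \<iota> (fst (fst p))"

lemma displacement_Pair [simp]: "displacement \<iota> ((y, t), x) = x - centre \<iota> y"
  by (simp add: displacement_def)

lemma open_over_Omega: "open ((Omega \<iota> \<times> UNIV) \<times> UNIV)"
  by (intro open_Times open_Omega open_UNIV)

lemma smooth_displacement: "smooth_on_open ((Omega \<iota> \<times> UNIV) \<times> UNIV) (displacement \<iota>)"
  unfolding displacement_def by (intro smooth_intros open_over_Omega) auto

lemma displacement_has_derivative:
  assumes "y \<in> Omega \<iota>"
  shows "(displacement \<iota> has_derivative (\<lambda>u. snd u - d_centre \<iota> y (fst (fst u)))) (at ((y, t), x))"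
proof -
  have "((\<lambda>p. centre \<iota> (fst (fst p))) has_derivative (\<lambda>u. d_centre \<iota> y (fst (fst u)))) (at ((y, t), x))"
    by (rule has_derivative_compose[where f = "\<lambda>p. fst (fst p)" and g = "centre \<iota>"])
       (auto intro!: derivative_eq_intros centre_has_derivative assms)
  then show ?thesis
    unfolding displacement_def by (auto intro!: derivative_eq_intros)
qed

lemma off_axis_eq:
  "off_axis \<iota> = (((Omega \<iota> \<times> UNIV) \<times> UNIV) \<inter> displacement \<iota> -` (- axis_line \<iota>)) \<inter> {p. snd (fst p) > 0}"
  by (auto simp: off_axis_def displacement_def)

lemma open_off_axis: "open (off_axis \<iota>)"
  unfolding off_axis_eq
  by (intro open_Int continuous_open_preimage smooth_imp_continuous_on[OF smooth_displacement]
      open_over_Omega open_Collect_less continuous_intros) (auto simp: closed_axis_line open_Compl)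

lemma product_subset_off_axis: "(Omega \<iota> \<times> {0<..}) \<times> (- half_cylinder \<iota>) \<subseteq> off_axis \<iota>"
proof -
  have "x \<in> half_cylinder \<iota>" if "y \<in> Omega \<iota>" "x - centre \<iota> y \<in> axis_line \<iota>" for x y
  proof -
    from that(2) obtain s where s: "x - centre \<iota> y = s *\<^sub>R axis (Some \<iota>) 1"
      unfolding axis_line_def by blast
    let ?y = "y + s *\<^sub>R axis \<iota> 1"
    have c: "cross_section \<iota> ?y = cross_section \<iota> y"
      by (auto simp: cross_section_def vec_eq_iff axis_def)
    have "x = centre \<iota> y + s *\<^sub>R axis (Some \<iota>) 1" using s by (simp add: algebra_simps)
    also have "\<dots> = centre \<iota> ?y"
      unfolding centre_eq q_fun_eq c by (auto simp: vec_option_eq_iff vec_eq_iff axis_def)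
    finally show ?thesis
      using that(1) unfolding half_cylinder_def Omega_eq by (auto simp: c)
  qed
  then show ?thesis by (auto simp: off_axis_def)
qed

definition chart_domain :: "'m::finite option \<Rightarrow> 'm \<Rightarrow> (((real ^ 'm) \<times> real) \<times> (real ^ 'm option)) set" where
  "chart_domain k \<iota> = {((y, \<omega>), x). y \<in> Omega \<iota> \<and> \<omega> \<noteq> 0 \<and>
     sqform (signature_matrix k) (x - centre \<iota> y) > 0 \<and> x - centre \<iota> y \<notin> axis_line \<iota>}"

text \<open>The two projections of the canonical relation in its parametrization by \<open>(y, \<omega>, x)\<close>: on the canonical
  relation, \<open>t\<close> is the value of the quadratic form at the displacement.\<close>

definition chart_left :: "'m::finite option \<Rightarrow> 'm \<Rightarrow> ((real ^ 'm) \<times> real) \<times> (real ^ 'm option) \<Rightarrow>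
    ((real ^ 'm) \<times> real) \<times> ((real ^ 'm) \<times> real)" where
  "chart_left k \<iota> p = ((fst (fst p), sqform (signature_matrix k) (displacement \<iota> p)),
     ((2 * snd (fst p)) *\<^sub>R B_map \<iota> (fst (fst p)) (signature_matrix k *v displacement \<iota> p), snd (fst p)))"

definition chart_right :: "'m::finite option \<Rightarrow> 'm \<Rightarrow> ((real ^ 'm) \<times> real) \<times> (real ^ 'm option) \<Rightarrow>
    (real ^ 'm option) \<times> (real ^ 'm option)" where
  "chart_right k \<iota> p = (snd p, (2 * snd (fst p)) *\<^sub>R (signature_matrix k *v displacement \<iota> p))"

text \<open>A defining function for the singular set of both projections: \<open>x\<close> lies in the hyperplane that is
  tangent to the half-cylinder at the centre.\<close>

definition over_tangent_plane :: "'m::finite \<Rightarrow> ((real ^ 'm) \<times> real) \<times> (real ^ 'm option) \<Rightarrow> real" where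
  "over_tangent_plane \<iota> p = displacement \<iota> p \<bullet> normal \<iota> (fst (fst p))"

lemma chart_domain_eq:
  "chart_domain k \<iota> = (((Omega \<iota> \<times> UNIV) \<times> UNIV) \<inter>
     displacement \<iota> -` (- axis_line \<iota> \<inter> {z. sqform (signature_matrix k) z > 0})) \<inter> {p. snd (fst p) \<noteq> 0}"
  by (auto simp: chart_domain_def displacement_def)

lemma open_chart_domain: "open (chart_domain k \<iota>)"
  unfolding chart_domain_eq sqform_def
  by (intro open_Int continuous_open_preimage smooth_imp_continuous_on[OF smooth_displacement]
      open_over_Omega open_Collect_less open_Collect_neq continuous_intros)
     (auto simp: closed_axis_line open_Compl intro!: continuous_intros matrix_vector_mult_linear_continuous_on)

lemma chart_domain_subset: "chart_domain k \<iota> \<subseteq> (Omega \<iota> \<times> UNIV) \<times> UNIV"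
  by (auto simp: chart_domain_def)

lemma smooth_displacement_domain: "smooth_on_open (chart_domain k \<iota>) (displacement \<iota>)"
  using smooth_subset[OF smooth_displacement open_chart_domain chart_domain_subset] .

lemma smooth_chart_left: "smooth_on_open (chart_domain k \<iota>) (chart_left k \<iota>)"
  unfolding chart_left_def B_map_def
  by (intro smooth_intros open_chart_domain smooth_displacement_domain)
     (auto simp: chart_domain_def)

lemma smooth_chart_right: "smooth_on_open (chart_domain k \<iota>) (chart_right k \<iota>)"
  unfolding chart_right_def
  by (intro smooth_intros open_chart_domain smooth_displacement_domain)

lemma smooth_over_tangent_plane: "smooth_on_open (chart_domain k \<iota>) (over_tangent_plane \<iota>)"
  unfolding over_tangent_plane_def normal_def
  by (intro smooth_intros open_chart_domain smooth_displacement_domain)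
     (auto simp: chart_domain_def)

lemma slope_fst_has_derivative:
  assumes "y \<in> Omega \<iota>"
  shows "((\<lambda>p. slope \<iota> (fst (fst p))) has_derivative (\<lambda>u. d_slope \<iota> y (fst (fst u)))) (at ((y, t), x))"
  by (rule has_derivative_compose[where f = "\<lambda>p. fst (fst p)" and g = "slope \<iota>"])
     (auto intro!: derivative_eq_intros slope_has_derivative assms)

lemma chart_left_derivative:
  fixes k :: "'m::finite option" and x :: "real ^ 'm option"
  assumes y: "y \<in> Omega \<iota>"
  defines "A \<equiv> signature_matrix k" and "w \<equiv> x - centre \<iota> y"
  shows "frechet_derivative (chart_left k \<iota>) (at ((y, \<omega>), x)) ((h, \<eta>), l) =
    ((h, 2 * ((A *v w) \<bullet> (l - d_centre \<iota> y h))),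
     ((2 * \<eta>) *\<^sub>R B_map \<iota> y (A *v w) +
      (2 * \<omega>) *\<^sub>R (B_map \<iota> y (A *v (l - d_centre \<iota> y h)) - ((A *v w) $ None) *\<^sub>R d_slope \<iota> y h), \<eta>))"
proof -
  have "(chart_left k \<iota> has_derivative (\<lambda>u. ((fst (fst u), 2 * ((A *v w) \<bullet> (snd u - d_centre \<iota> y (fst (fst u))))),
     ((2 * snd (fst u)) *\<^sub>R B_map \<iota> y (A *v w) +
      (2 * \<omega>) *\<^sub>R (B_map \<iota> y (A *v (snd u - d_centre \<iota> y (fst (fst u)))) -
        ((A *v w) $ None) *\<^sub>R d_slope \<iota> y (fst (fst u))), snd (fst u))))) (at ((y, \<omega>), x))"
  proof -
    note d = displacement_has_derivative[OF y, of \<omega> x]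
    note Ad = has_derivative_matrix_vector[OF d, of A]
    have fst: "((\<lambda>p. fst (fst p)) has_derivative (\<lambda>u. fst (fst u))) (at ((y, \<omega>), x))"
      and snd: "((\<lambda>p. snd (fst p)) has_derivative (\<lambda>u. snd (fst u))) (at ((y, \<omega>), x))"
      by (auto intro!: derivative_eq_intros)
    have scal: "((\<lambda>p. 2 * snd (fst p)) has_derivative (\<lambda>u. 2 * snd (fst u))) (at ((y, \<omega>), x))"
      by (rule has_derivative_mult_right[OF snd])
    note B = has_derivative_diff[OF has_derivative_tail[OF Ad] has_derivative_scaleR[OF
          bounded_linear.has_derivative[OF bounded_linear_vec_nth Ad, of None]
          slope_fst_has_derivative[OF y]]]
    show ?thesis
      unfolding chart_left_def[abs_def] A_def w_def B_map_def
      by (rule has_derivative_eq_rhs[OF has_derivative_Pair[OF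
              has_derivative_Pair[OF fst sqform_has_derivative[OF d]]
              has_derivative_Pair[OF has_derivative_scaleR[OF scal B[unfolded A_def]] snd]]])
         (simp add: fun_eq_iff algebra_simps)
  qed
  from frechet_derivative_at[OF this, symmetric] show ?thesis by simp
qed

lemma chart_right_derivative:
  assumes y: "y \<in> Omega \<iota>"
  shows "frechet_derivative (chart_right k \<iota>) (at ((y, \<omega>), x)) ((h, \<eta>), l) =
    (l, 2 *\<^sub>R (signature_matrix k *v (\<eta> *\<^sub>R (x - centre \<iota> y) + \<omega> *\<^sub>R (l - d_centre \<iota> y h))))"
proof -
  have snd: "(snd has_derivative snd) (at ((y, \<omega>), x))"
    and scal: "((\<lambda>p. 2 * snd (fst p)) has_derivative (\<lambda>u. 2 * snd (fst u))) (at ((y, \<omega>), x))"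
    by (auto intro!: derivative_eq_intros)
  have "(chart_right k \<iota> has_derivative (\<lambda>u. (snd u,
      (2 * \<omega>) *\<^sub>R (signature_matrix k *v (snd u - d_centre \<iota> y (fst (fst u)))) +
      (2 * snd (fst u)) *\<^sub>R (signature_matrix k *v (x - centre \<iota> y))))) (at ((y, \<omega>), x))"
    using has_derivative_Pair[OF snd has_derivative_scaleR[OF scal
        has_derivative_matrix_vector[OF displacement_has_derivative[OF y]]]]
    unfolding chart_right_def[abs_def] by simp
  from frechet_derivative_at[OF this, symmetric] show ?thesis
    by (simp add: matrix_vector_right_distrib matrix_vector_mult_scaleR scaleR_add_right)
qed

lemma over_tangent_plane_derivative:
  assumes y: "y \<in> Omega \<iota>"
  shows "frechet_derivative (over_tangent_plane \<iota>) (at ((y, \<omega>), x)) ((h, \<eta>), l) =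
    l \<bullet> normal \<iota> y + tail (x - centre \<iota> y) \<bullet> d_slope \<iota> y h"
proof -
  have "(over_tangent_plane \<iota> has_derivative (\<lambda>u. (x - centre \<iota> y) \<bullet> up (d_slope \<iota> y (fst (fst u))) 0 +
      (snd u - d_centre \<iota> y (fst (fst u))) \<bullet> normal \<iota> y)) (at ((y, \<omega>), x))"
    unfolding over_tangent_plane_def[abs_def] normal_def
    by (rule has_derivative_eq_rhs[OF has_derivative_inner[OF displacement_has_derivative[OF y]
            has_derivative_up[OF slope_fst_has_derivative[OF y] has_derivative_const]]])
       simp
  from frechet_derivative_at[OF this, symmetric] show ?thesis
    by (simp add: inner_diff_left inner_option[of _ "up _ _"])
       (simp add: inner_commute normal_d_centre flip: inner_option)
qed

lemma over_tangent_plane_shift: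
  "over_tangent_plane \<iota> (p + s *\<^sub>R ((0, 0), up 0 1)) = over_tangent_plane \<iota> p + s"
  by (simp add: over_tangent_plane_def displacement_def normal_def inner_option algebra_simps)


lemma card_chart_index:
  "CARD('m::finite option + 'm option) = DIM(((real ^ 'm) \<times> real) \<times> (real ^ 'm option))"
  by (simp add: card_UNIV_option)

text \<open>The image records \<open>y\<close>, \<open>\<omega>\<close> and the part of \<open>A *v w\<close> tangential to the half-cylinder, where \<open>w\<close> is the
  displacement. What is lost is at most the motion of \<open>x\<close> along \<open>A *v n\<close>, with \<open>n\<close> the normal
  vector, and the value of the quadratic form detects it unless \<open>w\<close> is orthogonal to \<open>n\<close>. This motion is
  transversal to the singular set because \<open>n \<bullet> (A *v n)\<close> does not vanish: \<open>w\<close> is orthogonal to \<open>n\<close> and the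
  quadratic form is positive on \<open>w\<close>.\<close>

lemma only_folds_chart_left: "only_folds (chart_domain k \<iota>) (chart_left k \<iota>)"
proof (rule only_foldsI[OF card_chart_index _ smooth_chart_left smooth_over_tangent_plane
      over_tangent_plane_shift], goal_cases)
  case 1
  show ?case by simp
next
  case (2 p u)
  obtain y \<omega> x h \<eta> l where [simp]: "p = ((y, \<omega>), x)" "u = ((h, \<eta>), l)" by (metis prod.collapse)
  let ?A = "signature_matrix k" and ?w = "x - centre \<iota> y"
  from 2(1) have y: "y \<in> Omega \<iota>" and \<omega>: "\<omega> \<noteq> 0" by (auto simp: chart_domain_def)
  have d0: "d_centre \<iota> y 0 = 0" "d_slope \<iota> y 0 = 0"
    by (simp_all add: d_centre_def d_slope_def vec_option_eq_iff cross_section_def vec_eq_iff)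
  from 2(3) have h: "h = 0" "\<eta> = 0"
    unfolding chart_left_derivative[OF y] \<open>p = _\<close> \<open>u = _\<close> by (simp_all add: zero_prod_def)
  with 2(3) \<omega> have l: "(?A *v ?w) \<bullet> l = 0" "B_map \<iota> y (?A *v l) = 0"
    unfolding chart_left_derivative[OF y] \<open>p = _\<close> \<open>u = _\<close> by (simp_all add: zero_prod_def d0)
  obtain s where "?A *v l = s *\<^sub>R normal \<iota> y"
    using l(2) unfolding B_map_kernel by blast
  then have "?w \<bullet> (s *\<^sub>R normal \<iota> y) = 0" and ls: "l = s *\<^sub>R (?A *v normal \<iota> y)"
    using l(1) by (simp_all add: signature_matrix_symmetric)
       (metis matrix_vector_mult_scaleR signature_matrix_involution)
  then have "s = 0"
    using 2(2) by (simp add: over_tangent_plane_def)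
  then show ?case using h ls by (simp add: zero_prod_def)
next
  case (3 p)
  obtain y \<omega> x where p [simp]: "p = ((y, \<omega>), x)" by (metis prod.collapse)
  let ?A = "signature_matrix k" and ?w = "x - centre \<iota> y" and ?n = "normal \<iota> y"
  \<comment> \<open>In the kernel only \<open>x\<close> moves.\<close>
  let ?k = "((0, 0), ?A *v ?n) :: ((real ^ 'a) \<times> real) \<times> (real ^ 'a option)"
  from 3(1) have y: "y \<in> Omega \<iota>" and \<omega>: "\<omega> \<noteq> 0" and pos: "sqform ?A ?w > 0"
    by (auto simp: chart_domain_def)
  from 3(2) have wn: "?w \<bullet> ?n = 0" by (simp add: over_tangent_plane_def)
  have n: "?n \<noteq> 0" by (simp add: normal_def vec_option_eq_iff)
  have d0: "d_centre \<iota> y 0 = 0" "d_slope \<iota> y 0 = 0"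
    by (simp_all add: d_centre_def d_slope_def vec_option_eq_iff cross_section_def vec_eq_iff)
  have Bn: "B_map \<iota> y ?n = 0" by (simp add: B_map_kernel) (simp add: normal_def)
  have kernel: "\<exists>s. l = s *\<^sub>R (?A *v ?n)" if "B_map \<iota> y (?A *v l) = 0" for l
    using that unfolding B_map_kernel
    by (metis matrix_vector_mult_scaleR signature_matrix_involution)
  show ?case
  proof (intro exI[of _ ?k] exI[of _ "((0, 2), (0, 0))"] conjI allI impI)
    show "?k \<noteq> 0" using n by (simp add: zero_prod_def signature_matrix_eq_0_iff)
  next
    fix u assume u0: "frechet_derivative (chart_left k \<iota>) (at p) u = 0"
    obtain h \<eta> l where u [simp]: "u = ((h, \<eta>), l)" by (metis prod.collapse)
    from u0 have h: "h = 0" "\<eta> = 0"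
      unfolding chart_left_derivative[OF y] p u by (simp_all add: zero_prod_def)
    with u0 \<omega> have "B_map \<iota> y (?A *v l) = 0"
      unfolding chart_left_derivative[OF y] p u by (simp_all add: zero_prod_def d0)
    then obtain s where "l = s *\<^sub>R (?A *v ?n)" using kernel by blast
    then show "\<exists>s. u = s *\<^sub>R ?k" using h by (intro exI[of _ s]) simp
  next
    fix \<tau> :: real
    have "up 0 1 \<bullet> ?n = 1" by (simp add: normal_def inner_option)
    then have "(x + \<tau> *\<^sub>R up 0 1 - centre \<iota> y) \<bullet> ?n = \<tau>"
      using wn by (simp add: inner_add_left inner_diff_left)
    then show "frechet_derivative (chart_left k \<iota>) (at (p + \<tau> *\<^sub>R ((0, 0), up 0 1))) ?k =
        \<tau> *\<^sub>R ((0, 2), (0, 0))"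
      by (simp add: chart_left_derivative[OF y] d0 Bn B_map_def[of \<iota> y 0])
  next
    show "((0, 2), (0, 0)) \<notin> range (frechet_derivative (chart_left k \<iota>) (at p))"
    proof
      assume "((0, 2), (0, 0)) \<in> range (frechet_derivative (chart_left k \<iota>) (at p))"
      then obtain u where "((0, 2), (0, 0)) = frechet_derivative (chart_left k \<iota>) (at p) u"
        by (rule rangeE)
      note u0 = this[symmetric]
      obtain h \<eta> l where u [simp]: "u = ((h, \<eta>), l)" by (metis prod.collapse)
      from u0 have h: "h = 0" "\<eta> = 0"
        unfolding chart_left_derivative[OF y] p u by simp_all
      with u0 \<omega> have "B_map \<iota> y (?A *v l) = 0" and two: "(?A *v ?w) \<bullet> l = 1"
        unfolding chart_left_derivative[OF y] p u by (simp_all add: d0)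
      then obtain s where "l = s *\<^sub>R (?A *v ?n)" using kernel by blast
      then show False using two wn by simp
    qed
  next
    have "(?A *v ?n) \<bullet> ?n < 0"
      using sqform_neg_if_orthogonal[OF pos wn n] by (simp add: sqform_def inner_commute)
    then show "frechet_derivative (over_tangent_plane \<iota>) (at p) ?k \<noteq> 0"
      by (simp add: over_tangent_plane_derivative[OF y] d0)
  qed
qed

text \<open>With \<open>x\<close> fixed, the image determines \<open>\<omega> w\<close>, where \<open>w\<close> is the displacement. The two ways of changing this
  vector, rescaling \<open>w\<close> and moving the centre in the tangent space, are independent unless \<open>w\<close> is itself
  tangential; then the centre can move in the direction of \<open>w\<close>. Along this motion the tangent plane turns
  away from \<open>x\<close>, because the half-cylinder is curved in every direction other than its axis.\<close>

lemma only_folds_chart_right: "only_folds (chart_domain k \<iota>) (chart_right k \<iota>)"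
proof (rule only_foldsI[OF card_chart_index _ smooth_chart_right smooth_over_tangent_plane
      over_tangent_plane_shift], goal_cases)
  case 1
  show ?case by simp
next
  case (2 p u)
  obtain y \<omega> x h \<eta> l where p [simp]: "p = ((y, \<omega>), x)" and u [simp]: "u = ((h, \<eta>), l)"
    by (metis prod.collapse)
  let ?A = "signature_matrix k" and ?w = "x - centre \<iota> y" and ?n = "normal \<iota> y"
  from 2(1) have y: "y \<in> Omega \<iota>" and \<omega>: "\<omega> \<noteq> 0" by (auto simp: chart_domain_def)
  from 2(3) have l: "l = 0"
    unfolding chart_right_derivative[OF y] p u by (simp add: zero_prod_def)
  with 2(3) have eq: "\<eta> *\<^sub>R ?w = \<omega> *\<^sub>R d_centre \<iota> y h"
    unfolding chart_right_derivative[OF y] p u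
    by (simp add: zero_prod_def signature_matrix_eq_0_iff)
  from arg_cong[OF this, of "\<lambda>z. ?n \<bullet> z"] have "\<eta> * (?w \<bullet> ?n) = 0"
    by (simp add: normal_d_centre inner_commute)
  then have \<eta>: "\<eta> = 0" using 2(2) by (simp add: over_tangent_plane_def)
  with eq \<omega> have "tail (d_centre \<iota> y h) = 0" by simp
  then have "h = 0" by (simp add: d_centre_def)
  then show ?case using l \<eta> by (simp add: zero_prod_def)
next
  case (3 p)
  obtain y \<omega> x where p [simp]: "p = ((y, \<omega>), x)" by (metis prod.collapse)
  let ?A = "signature_matrix k" and ?w = "x - centre \<iota> y" and ?n = "normal \<iota> y"
  \<comment> \<open>The centre moves by \<open>?w\<close>, and the change of \<open>\<omega>\<close> compensates the change of the displacement.\<close>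
  let ?k = "((tail ?w, \<omega>), 0) :: ((real ^ 'a) \<times> real) \<times> (real ^ 'a option)"
  from 3(1) have y: "y \<in> Omega \<iota>" and \<omega>: "\<omega> \<noteq> 0" and off: "?w \<notin> axis_line \<iota>"
    by (auto simp: chart_domain_def)
  from 3(2) have wn: "?w \<bullet> ?n = 0" by (simp add: over_tangent_plane_def)
  then have w: "d_centre \<iota> y (tail ?w) = ?w" using tangent_iff by metis
  note deriv = chart_right_derivative[OF y, of k]
  have inj: "?A *v z = ?A *v z' \<longleftrightarrow> z = z'" for z z'
    by (metis signature_matrix_involution)
  show ?case
  proof (intro exI[of _ ?k] exI[of _ "(0, 2 *\<^sub>R (\<omega> *\<^sub>R (?A *v up 0 1)))"] conjI allI impI)
    show "?k \<noteq> 0" using \<omega> by (simp add: zero_prod_def)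
  next
    fix u assume u0: "frechet_derivative (chart_right k \<iota>) (at p) u = 0"
    obtain h \<eta> l where u [simp]: "u = ((h, \<eta>), l)" by (metis prod.collapse)
    from u0 have l: "l = 0"
      unfolding p u deriv by (simp add: zero_prod_def)
    with u0 have "\<eta> *\<^sub>R ?w - \<omega> *\<^sub>R d_centre \<iota> y h = 0"
      unfolding p u deriv by (simp add: zero_prod_def signature_matrix_eq_0_iff)
    then have "\<omega> *\<^sub>R tail (d_centre \<iota> y h) = \<eta> *\<^sub>R tail ?w"
      by (metis eq_iff_diff_eq_0 tail_linear(3))
    then have "\<omega> *\<^sub>R h = \<eta> *\<^sub>R tail ?w" by (simp add: d_centre_def)
    then have "inverse \<omega> *\<^sub>R \<omega> *\<^sub>R h = inverse \<omega> *\<^sub>R \<eta> *\<^sub>R tail ?w" by simp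
    then have "h = (\<eta> / \<omega>) *\<^sub>R tail ?w" using \<omega> by (simp add: divide_inverse mult.commute)
    then show "\<exists>s. u = s *\<^sub>R ?k" using l \<omega> by (intro exI[of _ "\<eta> / \<omega>"]) simp
  next
    fix \<tau> :: real
    have line: "\<omega> *\<^sub>R (x + \<tau> *\<^sub>R up 0 1 - centre \<iota> y) + \<omega> *\<^sub>R (0 - d_centre \<iota> y (tail ?w)) =
        (\<tau> * \<omega>) *\<^sub>R up 0 1"
      unfolding w by (simp add: algebra_simps)
    have "p + \<tau> *\<^sub>R ((0, 0), up 0 1) = ((y, \<omega>), x + \<tau> *\<^sub>R up 0 1)" by simp
    then show "frechet_derivative (chart_right k \<iota>) (at (p + \<tau> *\<^sub>R ((0, 0), up 0 1))) ?k =
        \<tau> *\<^sub>R (0, 2 *\<^sub>R (\<omega> *\<^sub>R (?A *v up 0 1)))"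
      by (simp only: deriv line) (simp add: matrix_vector_mult_scaleR)
  next
    show "(0, 2 *\<^sub>R (\<omega> *\<^sub>R (?A *v up 0 1))) \<notin> range (frechet_derivative (chart_right k \<iota>) (at p))"
    proof
      assume "(0, 2 *\<^sub>R (\<omega> *\<^sub>R (?A *v up 0 1))) \<in> range (frechet_derivative (chart_right k \<iota>) (at p))"
      then obtain u where "(0, 2 *\<^sub>R (\<omega> *\<^sub>R (?A *v up 0 1))) = frechet_derivative (chart_right k \<iota>) (at p) u"
        by (rule rangeE)
      then have u0: "frechet_derivative (chart_right k \<iota>) (at p) u = (0, 2 *\<^sub>R (?A *v (\<omega> *\<^sub>R up 0 1)))"
        by (simp add: matrix_vector_mult_scaleR)
      obtain h \<eta> l where u [simp]: "u = ((h, \<eta>), l)" by (metis prod.collapse)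
      from u0 have "l = 0" unfolding p u deriv by simp
      with u0 have "\<eta> *\<^sub>R ?w - \<omega> *\<^sub>R d_centre \<iota> y h = \<omega> *\<^sub>R up 0 1"
        unfolding p u deriv by (simp add: inj)
      from arg_cong[OF this, of "\<lambda>z. ?n \<bullet> z"]
      have "\<eta> * (?n \<bullet> ?w) - \<omega> * (?n \<bullet> d_centre \<iota> y h) = \<omega> * (?n \<bullet> up 0 1)"
        by (simp only: inner_diff_right[of _ "\<eta> *\<^sub>R ?w"] inner_scaleR_right)
      moreover have "?n \<bullet> up 0 1 = 1" by (simp add: normal_def inner_option)
      ultimately have "0 = \<omega>"
        using wn by (simp only: normal_d_centre inner_commute[of ?n ?w])
      then show False using \<omega> by simp
    qed
  next
    have "tail ?w \<bullet> d_slope \<iota> y (tail ?w) \<noteq> 0"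
      using second_fundamental_form_zero[OF y wn] off unfolding axis_line_def by blast
    then show "frechet_derivative (over_tangent_plane \<iota>) (at p) ?k \<noteq> 0"
      by (simp add: over_tangent_plane_derivative[OF y])
  qed
qed

lemma radon_phase_partial_derivatives:
  fixes k :: "'m::finite option" and x :: "real ^ 'm option"
  assumes y: "y \<in> Omega \<iota>"
  shows "((\<lambda>u. radon_phase (signature_matrix k) \<iota> (u, x, \<omega>)) has_derivative (\<lambda>u.
      ((2 * \<omega>) *\<^sub>R B_map \<iota> y (signature_matrix k *v (x - centre \<iota> y)), \<omega>) \<bullet> u)) (at (y, t))"
    and "((\<lambda>x. radon_phase (signature_matrix k) \<iota> ((y, t), x, \<omega>)) has_derivative (\<lambda>l.
      (- ((2 * \<omega>) *\<^sub>R (signature_matrix k *v (x - centre \<iota> y)))) \<bullet> l)) (at x)"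
    and "((\<lambda>(u, \<omega>). radon_phase (signature_matrix k) \<iota> (u, x, \<omega>)) has_derivative (\<lambda>(u, \<eta>).
      ((2 * \<omega>) *\<^sub>R B_map \<iota> y (signature_matrix k *v (x - centre \<iota> y)), \<omega>) \<bullet> u +
      \<eta> * (t - sqform (signature_matrix k) (x - centre \<iota> y)))) (at ((y, t), \<omega>))"
    and "((\<lambda>(x, \<omega>). radon_phase (signature_matrix k) \<iota> ((y, t), x, \<omega>)) has_derivative (\<lambda>(l, \<eta>).
      (- ((2 * \<omega>) *\<^sub>R (signature_matrix k *v (x - centre \<iota> y)))) \<bullet> l +
      \<eta> * (t - sqform (signature_matrix k) (x - centre \<iota> y)))) (at (x, \<omega>))"
proof -
  let ?\<phi> = "radon_phase (signature_matrix k) \<iota>"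
  let ?B = "(2 * \<omega>) *\<^sub>R B_map \<iota> y (signature_matrix k *v (x - centre \<iota> y))"
  let ?C = "- ((2 * \<omega>) *\<^sub>R (signature_matrix k *v (x - centre \<iota> y)))"
  let ?s = "t - sqform (signature_matrix k) (x - centre \<iota> y)"
  let ?D = "\<lambda>p. (?B, \<omega>) \<bullet> fst p + ?C \<bullet> fst (snd p) + snd (snd p) * ?s"
  have d0: "d_centre \<iota> y 0 = 0"
    by (simp add: d_centre_def vec_option_eq_iff)
  have adj: "(signature_matrix k *v z) \<bullet> d_centre \<iota> y h = B_map \<iota> y (signature_matrix k *v z) \<bullet> h" for z h
    by (metis d_centre_adjoint inner_commute)
  have d: "(?\<phi> has_derivative (\<lambda>p. (?B, \<omega>) \<bullet> fst p + ?C \<bullet> fst (snd p) + snd (snd p) * ?s)) (at ((y, t), x, \<omega>))"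
  proof (rule has_derivative_eq_rhs[OF radon_phase_has_derivative[OF y]])
    have "\<eta> * c + \<omega> * (s - 2 * ((signature_matrix k *v z) \<bullet> (l - d_centre \<iota> y h))) =
        ((2 * \<omega>) *\<^sub>R B_map \<iota> y (signature_matrix k *v z), \<omega>) \<bullet> (h, s) +
        (- ((2 * \<omega>) *\<^sub>R (signature_matrix k *v z))) \<bullet> l + \<eta> * c" for \<eta> c s z l h
      by (simp add: inner_diff_right adj algebra_simps)
    then show "(\<lambda>((h, s), l, \<eta>). \<eta> * ?s +
        \<omega> * (s - 2 * ((signature_matrix k *v (x - centre \<iota> y)) \<bullet> (l - d_centre \<iota> y h)))) =
      (\<lambda>p. (?B, \<omega>) \<bullet> fst p + ?C \<bullet> fst (snd p) + snd (snd p) * ?s)"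
      by (simp only: fun_eq_iff split_paired_all split_paired_All prod.case fst_conv snd_conv simp_thms)
  qed
  have "((\<lambda>u. (u, x, \<omega>)) has_derivative (\<lambda>u. (u, 0, 0))) (at (y, t))"
    by (auto intro!: derivative_eq_intros simp: zero_prod_def)
  from has_derivative_compose[OF this d]
  show "((\<lambda>u. ?\<phi> (u, x, \<omega>)) has_derivative (\<lambda>u. (?B, \<omega>) \<bullet> u)) (at (y, t))" by simp
  have "((\<lambda>x. ((y, t), x, \<omega>)) has_derivative (\<lambda>l. (0, l, 0))) (at x)"
    by (auto intro!: derivative_eq_intros)
  from has_derivative_compose[OF this d]
  show "((\<lambda>x. ?\<phi> ((y, t), x, \<omega>)) has_derivative (\<lambda>l. ?C \<bullet> l)) (at x)" by simp
  have "((\<lambda>p. (fst p, x, snd p)) has_derivative (\<lambda>p. (fst p, 0, snd p))) (at ((y, t), \<omega>))"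
    by (auto intro!: derivative_eq_intros)
  from has_derivative_compose[OF this, of ?\<phi> ?D] d
  show "((\<lambda>(u, \<omega>). ?\<phi> (u, x, \<omega>)) has_derivative (\<lambda>(u, \<eta>). (?B, \<omega>) \<bullet> u + \<eta> * ?s)) (at ((y, t), \<omega>))"
    by (simp add: case_prod_unfold)
  have "((\<lambda>p. ((y, t), p)) has_derivative (\<lambda>p. (0, p))) (at (x, \<omega>))"
    by (auto intro!: derivative_eq_intros)
  from has_derivative_compose[OF this d]
  show "((\<lambda>(x, \<omega>). ?\<phi> ((y, t), x, \<omega>)) has_derivative (\<lambda>(l, \<eta>). ?C \<bullet> l + \<eta> * ?s)) (at (x, \<omega>))"
    by (simp add: case_prod_unfold)
qed

lemma grad_radon_phase_frequency:
  "grad (\<lambda>\<omega>. radon_phase A \<iota> ((y, t), x, \<omega>)) \<omega> = t - sqform A (x - centre \<iota> y)"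
  by (rule grad_eqI) (auto intro!: derivative_eq_intros simp: radon_phase_eq inner_real_def)

lemma canonical_relation_eq:
  "canonical_relation (off_axis \<iota>) (radon_phase (signature_matrix k) \<iota>) =
     (\<lambda>p. (chart_left k \<iota> p, chart_right k \<iota> p)) ` chart_domain k \<iota>"
proof (intro equalityI subsetI)
  fix c assume "c \<in> canonical_relation (off_axis \<iota>) (radon_phase (signature_matrix k) \<iota>)"
  then obtain u x \<omega> where ux: "(u, x) \<in> off_axis \<iota>" "\<omega> \<noteq> 0"
      "grad (\<lambda>\<theta>. radon_phase (signature_matrix k) \<iota> (u, x, \<theta>)) \<omega> = 0"
    and cu: "c = ((u, grad (\<lambda>u. radon_phase (signature_matrix k) \<iota> (u, x, \<omega>)) u),
           (x, - grad (\<lambda>x. radon_phase (signature_matrix k) \<iota> (u, x, \<omega>)) x))"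
    unfolding canonical_relation_def by blast
  obtain y t where u: "u = (y, t)" by (cases u)
  note t = ux(3)[unfolded u] and c = cu[unfolded u]
  from ux u have y: "y \<in> Omega \<iota>" and dom: "((y, \<omega>), x) \<in> chart_domain k \<iota>"
    by (auto simp: off_axis_def chart_domain_def grad_radon_phase_frequency)
  have "c = (chart_left k \<iota> ((y, \<omega>), x), chart_right k \<iota> ((y, \<omega>), x))"
    using t unfolding c grad_radon_phase_frequency
      grad_eqI[OF radon_phase_partial_derivatives(1)[OF y]] grad_eqI[OF radon_phase_partial_derivatives(2)[OF y]]
    by (simp add: chart_left_def chart_right_def)
  then show "c \<in> (\<lambda>p. (chart_left k \<iota> p, chart_right k \<iota> p)) ` chart_domain k \<iota>" using dom by blast
next
  fix c assume "c \<in> (\<lambda>p. (chart_left k \<iota> p, chart_right k \<iota> p)) ` chart_domain k \<iota>"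
  then obtain y \<omega> x where dom: "((y, \<omega>), x) \<in> chart_domain k \<iota>"
    and c: "c = (chart_left k \<iota> ((y, \<omega>), x), chart_right k \<iota> ((y, \<omega>), x))" by auto
  let ?t = "sqform (signature_matrix k) (x - centre \<iota> y)"
  from dom have y: "y \<in> Omega \<iota>" and "\<omega> \<noteq> 0" "((y, ?t), x) \<in> off_axis \<iota>"
    by (auto simp: off_axis_def chart_domain_def)
  moreover have "c = (((y, ?t), grad (\<lambda>u. radon_phase (signature_matrix k) \<iota> (u, x, \<omega>)) (y, ?t)),
           (x, - grad (\<lambda>x. radon_phase (signature_matrix k) \<iota> ((y, ?t), x, \<omega>)) x))"
    unfolding c grad_eqI[OF radon_phase_partial_derivatives(1)[OF y]]
      grad_eqI[OF radon_phase_partial_derivatives(2)[OF y]]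
    by (simp add: chart_left_def chart_right_def)
  moreover have "grad (\<lambda>\<theta>. radon_phase (signature_matrix k) \<iota> ((y, ?t), x, \<theta>)) \<omega> = 0"
    by (simp add: grad_radon_phase_frequency)
  ultimately show "c \<in> canonical_relation (off_axis \<iota>) (radon_phase (signature_matrix k) \<iota>)"
    unfolding canonical_relation_def by blast
qed

lemma local_parametrization_chart:
  "local_parametrization ((\<lambda>p. (chart_left k \<iota> p, chart_right k \<iota> p)) ` chart_domain k \<iota>) (chart_domain k \<iota>)
     (\<lambda>p. (chart_left k \<iota> p, chart_right k \<iota> p))"
proof -
  let ?\<kappa> = "\<lambda>p. (chart_left k \<iota> p, chart_right k \<iota> p)"
  define L where "L = (\<lambda>c :: (((real ^ 'a) \<times> real) \<times> ((real ^ 'a) \<times> real)) \<times> ((real ^ 'a option) \<times> (real ^ 'a option)).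
    ((fst (fst (fst c)), snd (snd (fst c))), fst (snd c)))"
  have L: "L (?\<kappa> p) = p" for p
    by (simp add: L_def chart_left_def chart_right_def)
  have smooth: "smooth_on_open (chart_domain k \<iota>) ?\<kappa>"
    by (intro smooth_intros smooth_chart_left smooth_chart_right)
  have "inj (frechet_derivative ?\<kappa> (at p))" if p: "p \<in> chart_domain k \<iota>" for p
  proof -
    have "bounded_linear L"
      unfolding L_def
      by (intro bounded_linear_Pair bounded_linear_compose[OF bounded_linear_fst]
          bounded_linear_compose[OF bounded_linear_snd] bounded_linear_fst bounded_linear_snd bounded_linear_ident)
    from bounded_linear.has_derivative[OF this smooth_has_derivative[OF smooth p]]
    have "((\<lambda>p. p) has_derivative (\<lambda>u. L (frechet_derivative ?\<kappa> (at p) u))) (at p)"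
      unfolding L .
    then have left_inv: "(\<lambda>u. L (frechet_derivative ?\<kappa> (at p) u)) = (\<lambda>u. u)"
      using has_derivative_ident has_derivative_unique by blast
    show ?thesis by (rule inj_on_inverseI[where g = L, OF fun_cong[OF left_inv]])
  qed
  moreover have "homeomorphism (chart_domain k \<iota>) (?\<kappa> ` chart_domain k \<iota>) ?\<kappa> L"
    unfolding homeomorphism_def
  proof (intro conjI ballI smooth_imp_continuous_on[OF smooth])
    show "continuous_on (?\<kappa> ` chart_domain k \<iota>) L"
      unfolding L_def by (intro continuous_intros)
  qed (auto simp: L image_image)
  ultimately show ?thesis
    unfolding local_parametrization_def using smooth by auto
qed

lemma two_sided_fold_radon_phase:
  "two_sided_fold (canonical_relation (off_axis \<iota>) (radon_phase (signature_matrix k) \<iota>))"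
proof -
  have [simp]: "fst \<circ> (\<lambda>p. (chart_left k \<iota> p, chart_right k \<iota> p)) = chart_left k \<iota>"
    "snd \<circ> (\<lambda>p. (chart_left k \<iota> p, chart_right k \<iota> p)) = chart_right k \<iota>"
    by auto
  show ?thesis
    unfolding two_sided_fold_def canonical_relation_eq
    using local_parametrization_chart[of k \<iota>] only_folds_chart_left[of k \<iota>] only_folds_chart_right[of k \<iota>]
    by (intro ballI exI[of _ "chart_domain k \<iota>"] exI[of _ "\<lambda>p. (chart_left k \<iota> p, chart_right k \<iota> p)"]) simp
qed

lemma grad_nonzeroI:
  assumes "(f has_derivative f') (at x)" "f' h \<noteq> 0"
  shows "grad f x \<noteq> 0"
proof
  assume 0: "grad f x = 0"
  have "f' b = grad f x \<bullet> b" if "b \<in> Basis" for b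
    using that frechet_derivative_at[OF assms(1)] by (simp add: grad_def inner_sum_left_Basis)
  moreover have "f' h = (\<Sum>b\<in>Basis. (h \<bullet> b) *\<^sub>R f' b)"
    using frechet_derivative_basis_expansion[of f x h] assms(1) frechet_derivative_at[OF assms(1)]
    by (auto simp: differentiable_def)
  ultimately show False using 0 assms(2) by simp
qed

lemma open_phase_domain: "open Z \<Longrightarrow> open {(u, v, \<theta>). (u, v) \<in> Z}"
proof -
  assume "open Z"
  then have "open ((\<lambda>p. (fst p, fst (snd p))) -` Z)"
    by (intro open_vimage continuous_intros)
  then show ?thesis by (simp add: vimage_def case_prod_unfold)
qed

text \<open>The \<open>\<omega>\<close>-derivative of the phase is \<open>t\<close> minus a function of \<open>y\<close> and \<open>x\<close>, so that its differential never
  vanishes; off the axis the displacement is nonzero, and so is the \<open>x\<close>-gradient.\<close>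

lemma nondegenerate_radon_phase:
  "nondegenerate_phase (off_axis \<iota>) (radon_phase (signature_matrix k) \<iota>)"
proof -
  let ?A = "signature_matrix k"
  let ?Z = "{(u, v, \<theta>). (u, v) \<in> off_axis \<iota> \<and> \<theta> \<noteq> (0::real)}"
  have "?Z = {(u, v, \<theta>). (u, v) \<in> off_axis \<iota>} \<inter> {p. snd (snd p) \<noteq> 0}" by auto
  then have "open ?Z"
    using open_phase_domain[OF open_off_axis]
    by (auto intro!: open_Int open_Collect_neq continuous_intros)
  then have "smooth_on_open ?Z (\<lambda>p. snd (snd p) * (snd (fst p) -
      sqform ?A (fst (snd p) - centre \<iota> (fst (fst p)))))"
    by (intro smooth_intros) (auto simp: off_axis_def)
  then have smooth: "smooth_on_open ?Z (radon_phase ?A \<iota>)"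
    by (rule smooth_cong) (auto simp: radon_phase_eq)
  have submersive: "c = 0" if y: "y \<in> Omega \<iota>" and c: "\<And>h. c \<bullet> frechet_derivative
      (\<lambda>(u, v, \<theta>). grad (\<lambda>\<theta>. radon_phase ?A \<iota> (u, v, \<theta>)) \<theta>) (at ((y, t), x, \<omega>)) h = 0" for c y t x \<omega>
  proof -
    let ?\<psi> = "\<lambda>p. radon_phase ?A \<iota> (fst p, fst (snd p), 1 :: real)"
    have eq: "(\<lambda>(u, v, \<theta>). grad (\<lambda>\<theta>. radon_phase ?A \<iota> (u, v, \<theta>)) \<theta>) = ?\<psi>"
      by (simp only: fun_eq_iff split_paired_all split_paired_All prod.case fst_conv snd_conv
        grad_radon_phase_frequency) (simp add: radon_phase_eq)
    have der: "(?\<psi> has_derivative (\<lambda>h. case (fst h, fst (snd h), 0) of ((h, s), l, \<eta>) \<Rightarrow>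
      \<eta> * (t - sqform ?A (x - centre \<iota> y)) +
      1 * (s - 2 * ((?A *v (x - centre \<iota> y)) \<bullet> (l - d_centre \<iota> y h))))) (at ((y, t), x, \<omega>))"
      by (rule has_derivative_compose[where f = "\<lambda>p. (fst p, fst (snd p), 1 :: real)" and
            f' = "\<lambda>h. (fst h, fst (snd h), 0)" and g = "radon_phase ?A \<iota>"])
         (use radon_phase_has_derivative[OF y, of k t x 1] in \<open>auto intro!: derivative_eq_intros simp: case_prod_unfold\<close>)
    from c[of "((0, 1), 0, 0)"] have "c * (1 - 2 * ((?A *v (x - centre \<iota> y)) \<bullet> (0 - d_centre \<iota> y 0))) = 0"
      unfolding eq frechet_derivative_at[OF der, symmetric] by simp
    moreover have "d_centre \<iota> y 0 = 0" by (simp add: d_centre_def vec_option_eq_iff)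
    ultimately show ?thesis by simp
  qed
  show ?thesis
    unfolding nondegenerate_phase_def
  proof (intro conjI smooth allI impI)
    fix u x and \<omega> :: real assume ux: "(u, x) \<in> off_axis \<iota>" and \<omega>: "\<omega> \<noteq> 0"
    obtain y t where [simp]: "u = (y, t)" by (cases u)
    from ux have y: "y \<in> Omega \<iota>" and w: "x - centre \<iota> y \<noteq> 0"
      using zero_in_axis_line[of \<iota>] by (auto simp: off_axis_def)
    show "radon_phase ?A \<iota> (u, x, r *\<^sub>R \<omega>) = r * radon_phase ?A \<iota> (u, x, \<omega>)" for r
      by (simp add: radon_phase_eq)
    show "grad (\<lambda>(u', \<theta>'). radon_phase ?A \<iota> (u', x, \<theta>')) (u, \<omega>) \<noteq> 0"
      unfolding \<open>u = (y, t)\<close>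
      by (rule grad_nonzeroI[OF radon_phase_partial_derivatives(3)[OF y], where h = "((0, 1), 0)"])
         (use \<omega> in simp)
    show "grad (\<lambda>(v', \<theta>'). radon_phase ?A \<iota> (u, v', \<theta>')) (x, \<omega>) \<noteq> 0"
      unfolding \<open>u = (y, t)\<close>
      by (rule grad_nonzeroI[OF radon_phase_partial_derivatives(4)[OF y],
            where h = "(?A *v (x - centre \<iota> y), 0)"])
         (use \<omega> w in simp)
    fix c assume c: "\<forall>h. c \<bullet> frechet_derivative
      (\<lambda>(u', v', \<theta>'). grad (\<lambda>\<theta>''. radon_phase ?A \<iota> (u', v', \<theta>'')) \<theta>') (at (u, x, \<omega>)) h = 0"
    show "c = 0" by (rule submersive[OF y]) (rule c[unfolded \<open>u = (y, t)\<close>, rule_format])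
  qed
qed


section \<open>A smooth cutoff and a flattened frequency\<close>

text \<open>The functions \<open>x\<^sup>-\<^sup>j exp (-1/x)\<close>, extended by \<open>0\<close>. The derivative of one of them is a linear combination
  of two others, so the whole family is smooth.\<close>

definition flat :: "nat \<Rightarrow> real \<Rightarrow> real" where
  "flat j x = (if x \<le> 0 then 0 else (1 / x) ^ j * exp (- (1 / x)))"

lemma flat_tendsto_0: "(flat j \<longlongrightarrow> 0) (at 0)"
proof -
  have "((\<lambda>x. (inverse x) ^ j / exp (inverse x)) \<longlongrightarrow> 0) (at_right (0::real))"
    by (rule filterlim_compose[OF tendsto_power_div_exp_0 filterlim_inverse_at_top_right])
  moreover have "\<forall>\<^sub>F x in at_right 0. (inverse x) ^ j / exp (inverse x) = flat j x"
    by (auto simp: eventually_at_filter flat_def exp_minus divide_simps)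
  ultimately have "(flat j \<longlongrightarrow> 0) (at_right 0)"
    by (rule Lim_transform_eventually)
  moreover have "(flat j \<longlongrightarrow> 0) (at_left 0)"
    by (rule tendsto_eventually) (auto simp: eventually_at_filter flat_def)
  ultimately show ?thesis by (simp add: filterlim_split_at)
qed

lemma flat_has_derivative:
  "(flat j has_real_derivative flat (j + 2) x - real j * flat (j + 1) x) (at x)"
proof -
  consider "x > 0" | "x < 0" | "x = 0" by linarith
  then show ?thesis
  proof cases
    case 1
    have "((\<lambda>x. (1 / x) ^ j * exp (- (1 / x))) has_real_derivative
        flat (j + 2) x - real j * flat (j + 1) x) (at x)"
    proof (cases j)
      case 0
      then show ?thesis using 1
        by (auto intro!: derivative_eq_intros simp: flat_def field_simps power2_eq_square)
    next
      case (Suc i)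
      have inv: "((\<lambda>x. 1 / x) has_real_derivative - (1 / x)\<^sup>2) (at x)"
        using 1 by (auto intro!: derivative_eq_intros simp: power2_eq_square)
      have "((\<lambda>x. (1 / x) ^ Suc i * exp (- (1 / x))) has_real_derivative
          (1 + real i) * (- (1 / x)\<^sup>2 * (1 / x) ^ i) * exp (- (1 / x)) +
          exp (- (1 / x)) * - (- (1 / x)\<^sup>2) * (1 / x) ^ Suc i) (at x)"
        by (intro DERIV_mult DERIV_power_Suc DERIV_fun_exp DERIV_minus inv)
      then show ?thesis
        using 1 Suc by (simp add: flat_def algebra_simps power2_eq_square)
    qed
    then show ?thesis
      by (rule has_field_derivative_transform_within_open[where S = "{0<..}"]) (use 1 in \<open>auto simp: flat_def\<close>)
  next
    case 2
    have "((\<lambda>x. 0) has_real_derivative flat (j + 2) x - real j * flat (j + 1) x) (at x)"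
      using 2 by (simp add: flat_def)
    then show ?thesis
      by (rule has_field_derivative_transform_within_open[where S = "{..<0}"]) (use 2 in \<open>auto simp: flat_def\<close>)
  next
    case 3
    have "((\<lambda>x. (flat j x - flat j 0) / (x - 0)) \<longlongrightarrow> 0) (at 0)"
      by (rule Lim_transform_eventually[OF flat_tendsto_0[of "Suc j"]])
         (auto simp: eventually_at_filter flat_def)
    then have "(flat j has_real_derivative 0) (at 0)"
      by (simp add: has_field_derivative_iff)
    then show ?thesis using 3 by (simp add: flat_def)
  qed
qed

lemma smooth_flat: "smooth_on_open UNIV (flat j)"
proof -
  have "times_differentiable k UNIV (flat j)" for k j
  proof (induction k arbitrary: j)
    case 0
    then show ?case
      using flat_has_derivative by (auto simp: differentiable_def has_field_derivative_def)
  next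
    case (Suc k)
    show ?case
    proof (rule times_differentiableI[OF open_UNIV flat_has_derivative[unfolded has_field_derivative_def]])
      fix h :: real and i assume "Suc k = Suc i"
      then have "times_differentiable i UNIV (\<lambda>x. h * flat (j + 2) x + (- h * real j) * flat (j + 1) x)"
        using Suc.IH by (intro times_differentiable_add times_differentiable_bilinear[OF _ bounded_bilinear_mult]
          times_differentiable_const) auto
      then show "times_differentiable i UNIV (\<lambda>x. (flat (j + 2) x - real j * flat (j + 1) x) * h)"
        by (simp add: algebra_simps)
    qed
  qed
  then show ?thesis by (simp add: smooth_on_open_iff_times_differentiable)
qed

lemma flat_0_pos_iff: "flat 0 x > 0 \<longleftrightarrow> x > 0" and flat_0_nonneg: "flat 0 x \<ge> 0"
  by (simp_all add: flat_def)

definition high_pass :: "real \<Rightarrow> real" where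
  "high_pass \<theta> = flat 0 (\<theta>\<^sup>2 - 1) / (flat 0 (\<theta>\<^sup>2 - 1) + flat 0 (2 - \<theta>\<^sup>2))"

lemma high_pass_denominator_pos: "flat 0 (\<theta>\<^sup>2 - 1) + flat 0 (2 - \<theta>\<^sup>2) > 0"
proof (cases "\<theta>\<^sup>2 > 1")
  case True
  then show ?thesis using flat_0_pos_iff[of "\<theta>\<^sup>2 - 1"] flat_0_nonneg[of "2 - \<theta>\<^sup>2"] by linarith
next
  case False
  then show ?thesis using flat_0_pos_iff[of "2 - \<theta>\<^sup>2"] flat_0_nonneg[of "\<theta>\<^sup>2 - 1"] by linarith
qed

lemma smooth_flat_compose [smooth_intros]:
  "smooth_on_open W f \<Longrightarrow> smooth_on_open W (\<lambda>x. flat j (f x))"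
  by (rule smooth_compose[OF smooth_flat]) auto

lemma smooth_high_pass: "smooth_on_open UNIV high_pass"
  unfolding high_pass_def by (intro smooth_intros high_pass_denominator_pos open_UNIV)

lemma high_pass_nonneg: "high_pass \<theta> \<ge> 0"
  by (simp add: high_pass_def flat_0_nonneg)

lemma high_pass_low: "\<bar>\<theta>\<bar> \<le> 1 \<Longrightarrow> high_pass \<theta> = 0"
  using abs_square_le_1[of \<theta>] by (simp add: high_pass_def flat_def)

lemma high_pass_high: "\<bar>\<theta>\<bar> \<ge> 2 \<Longrightarrow> high_pass \<theta> = 1"
proof -
  assume "\<bar>\<theta>\<bar> \<ge> 2"
  then have "\<theta>\<^sup>2 \<ge> 4" using power_mono[of 2 "\<bar>\<theta>\<bar>" 2] by simp
  then show ?thesis by (simp add: high_pass_def flat_def)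
qed

lemma low_pass_test_function: "(\<lambda>\<theta>. complex_of_real (1 - high_pass \<theta>)) \<in> test_functions UNIV"
proof -
  have "smooth_on_open UNIV (\<lambda>\<theta>. complex_of_real (1 - high_pass \<theta>))"
    by (intro smooth_intros smooth_high_pass open_UNIV)
  moreover have "\<theta> \<notin> {-2..2} \<Longrightarrow> complex_of_real (1 - high_pass \<theta>) = 0" for \<theta>
    using high_pass_high[of \<theta>] by (auto simp: abs_if)
  ultimately show ?thesis
    unfolding test_functions_def by (auto intro!: exI[of _ "{-2..2::real}"])
qed

text \<open>A reparametrization of the frequency axis: the identity at high frequencies, constant near \<open>0\<close>.
  Written \<open>\<mu>\<close>, it serves in the substitution \<open>\<omega> = \<mu> \<theta>\<close>, which turns \<open>\<bar>\<omega>\<bar> d\<omega>\<close> into \<open>\<bar>\<mu> \<theta>\<bar> \<mu>' \<theta> d\<theta>\<close>, which is smooth at \<open>\<theta> = 0\<close> as well.\<close>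

definition flattened :: "real \<Rightarrow> real" where
  "flattened \<theta> = \<theta> * high_pass \<theta>"

definition flattened' :: "real \<Rightarrow> real" where
  "flattened' \<theta> = frechet_derivative flattened (at \<theta>) 1"

lemma smooth_flattened: "smooth_on_open UNIV flattened"
  unfolding flattened_def by (intro smooth_intros smooth_high_pass open_UNIV)

lemma smooth_flattened': "smooth_on_open UNIV flattened'"
  unfolding flattened'_def by (rule smooth_frechet_derivative[OF smooth_flattened])

lemma flattened_has_derivative: "(flattened has_real_derivative flattened' \<theta>) (at \<theta>)"
proof -
  have d: "(flattened has_derivative frechet_derivative flattened (at \<theta>)) (at \<theta>)"
    by (rule smooth_has_derivative[OF smooth_flattened]) simp
  have "frechet_derivative flattened (at \<theta>) h = flattened' \<theta> * h" for h
    using linear_scale[OF has_derivative_linear[OF d], of h 1] by (simp add: flattened'_def)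
  then have "frechet_derivative flattened (at \<theta>) = (*) (flattened' \<theta>)" by (rule ext)
  then show ?thesis using d by (simp add: has_field_derivative_def)
qed

lemma flattened_low: "\<bar>\<theta>\<bar> \<le> 1 \<Longrightarrow> flattened \<theta> = 0"
  by (simp add: flattened_def high_pass_low)

lemma flattened_high: "\<bar>\<theta>\<bar> \<ge> 2 \<Longrightarrow> flattened \<theta> = \<theta>"
  by (simp add: flattened_def high_pass_high)

lemma flattened'_high: "\<bar>\<theta>\<bar> > 2 \<Longrightarrow> flattened' \<theta> = 1"
proof -
  assume \<theta>: "\<bar>\<theta>\<bar> > 2"
  have "((\<lambda>\<theta>. \<theta>) has_real_derivative flattened' \<theta>) (at \<theta>)"
    by (rule has_field_derivative_transform_within_open[OF flattened_has_derivative, where S = "{\<theta>. \<bar>\<theta>\<bar> > 2}"])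
       (use \<theta> in \<open>auto simp: flattened_high intro!: open_Collect_less continuous_intros\<close>)
  then show ?thesis using DERIV_ident DERIV_unique by blast
qed

text \<open>The absolute value is not smooth at \<open>0\<close>, but here it is taken of a function that
  vanishes near \<open>0\<close>.\<close>

lemma smooth_abs_flattened: "smooth_on_open UNIV (\<lambda>\<theta>. \<bar>flattened \<theta>\<bar>)"
proof (rule smooth_local)
  fix \<theta> :: real
  consider "\<theta> > 0" | "\<theta> < 0" | "\<theta> \<in> {-1<..<1}" by force
  then show "\<exists>V. \<theta> \<in> V \<and> smooth_on_open V (\<lambda>\<theta>. \<bar>flattened \<theta>\<bar>)"
  proof cases
    case 1
    have "smooth_on_open {0<..} (\<lambda>\<theta>. \<bar>flattened \<theta>\<bar>)"
      by (rule smooth_cong[OF smooth_subset[OF smooth_flattened]])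
         (auto simp: flattened_def abs_mult high_pass_nonneg)
    then show ?thesis using 1 by auto
  next
    case 2
    have "smooth_on_open {..<0} (\<lambda>\<theta>. \<bar>flattened \<theta>\<bar>)"
      by (rule smooth_cong[OF smooth_minus[OF smooth_subset[OF smooth_flattened]]])
         (auto simp: flattened_def abs_mult high_pass_nonneg)
    then show ?thesis using 2 by auto
  next
    case 3
    have "smooth_on_open {-1<..<1} (\<lambda>\<theta>. \<bar>flattened \<theta>\<bar>)"
      by (rule smooth_cong[OF smooth_const[where c = 0]]) (auto simp: flattened_low)
    then show ?thesis using 3 by blast
  qed
qed simp

text \<open>Integrands that decay like \<open>1 / (1 + \<omega>\<^sup>2)\<close> keep this decay under the substitution.\<close>

lemma flattened_jacobian_bound:
  "\<exists>B\<ge>0. \<forall>\<theta>. \<bar>flattened' \<theta>\<bar> / (1 + (flattened \<theta>)\<^sup>2) \<le> B / (1 + \<theta>\<^sup>2)"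
proof -
  have "continuous_on {-2..2} (\<lambda>\<theta>. \<bar>flattened' \<theta>\<bar> * (1 + \<theta>\<^sup>2))"
    using smooth_imp_continuous_on[OF smooth_flattened'] continuous_on_subset
    by (intro continuous_intros) auto
  then have "bounded ((\<lambda>\<theta>. \<bar>flattened' \<theta>\<bar> * (1 + \<theta>\<^sup>2)) ` {-2..2})"
    by (intro compact_imp_bounded compact_continuous_image) auto
  then obtain B where "\<forall>z\<in>(\<lambda>\<theta>. \<bar>flattened' \<theta>\<bar> * (1 + \<theta>\<^sup>2)) ` {-2..2}. norm z \<le> B"
    unfolding bounded_iff by blast
  then have B: "\<bar>flattened' \<theta>\<bar> * (1 + \<theta>\<^sup>2) \<le> B" if "\<theta> \<in> {-2..2}" for \<theta>
    using that by fastforce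
  have "\<bar>flattened' \<theta>\<bar> / (1 + (flattened \<theta>)\<^sup>2) \<le> max 1 B / (1 + \<theta>\<^sup>2)" for \<theta>
  proof (cases "\<bar>\<theta>\<bar> > 2")
    case True
    then show ?thesis by (simp add: flattened'_high flattened_high divide_right_mono)
  next
    case False
    have pos: "1 + x\<^sup>2 > 0" "1 + x\<^sup>2 \<ge> 1" for x :: real
      by (simp_all add: add_pos_nonneg)
    have "\<bar>flattened' \<theta>\<bar> / (1 + (flattened \<theta>)\<^sup>2) \<le> \<bar>flattened' \<theta>\<bar> / 1"
      using pos by (intro divide_left_mono) auto
    also have "\<dots> = (\<bar>flattened' \<theta>\<bar> * (1 + \<theta>\<^sup>2)) / (1 + \<theta>\<^sup>2)" using less_imp_neq[OF pos(1)[of \<theta>]] by simp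
    also have "\<dots> \<le> max 1 B / (1 + \<theta>\<^sup>2)"
    proof (intro divide_right_mono)
      have "\<bar>flattened' \<theta>\<bar> * (1 + \<theta>\<^sup>2) \<le> B" using False by (intro B) auto
      then show "\<bar>flattened' \<theta>\<bar> * (1 + \<theta>\<^sup>2) \<le> max 1 B" by simp
    qed (use pos in \<open>simp add: less_imp_le\<close>)
    finally show ?thesis .
  qed
  then show ?thesis by (intro exI[of _ "max 1 B"]) auto
qed


section \<open>Distributions applied to smooth families\<close>

lemma iter_deriv_diff:
  assumes "smooth_on_open W f" "smooth_on_open W g" "x \<in> W"
  shows "iter_deriv hs (\<lambda>x. f x - g x) x = iter_deriv hs f x - iter_deriv hs g x"
  using assms(3)
proof (induction hs arbitrary: x)
  case (Cons h hs)
  have "frechet_derivative (iter_deriv hs (\<lambda>x. f x - g x)) (at x) =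
      frechet_derivative (\<lambda>x. iter_deriv hs f x - iter_deriv hs g x) (at x)"
    by (rule frechet_derivative_cong_open[OF smooth_imp_open[OF assms(1)] Cons.prems Cons.IH])
  moreover have "((\<lambda>x. iter_deriv hs f x - iter_deriv hs g x) has_derivative
      (\<lambda>h. frechet_derivative (iter_deriv hs f) (at x) h - frechet_derivative (iter_deriv hs g) (at x) h)) (at x)"
    by (intro has_derivative_diff smooth_has_derivative[OF smooth_iter_deriv[OF assms(1)] Cons.prems]
        smooth_has_derivative[OF smooth_iter_deriv[OF assms(2)] Cons.prems])
  ultimately show ?case by (simp add: frechet_derivative_at[symmetric])
qed simp

lemma smooth_nearI: "smooth_on_open W g \<Longrightarrow> X \<subseteq> W \<Longrightarrow> smooth_near X g"
  unfolding smooth_near_def by blast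

lemma smooth_near_const: "smooth_near X (\<lambda>x. c)"
  by (rule smooth_nearI[OF smooth_const[OF open_UNIV]]) simp

lemma distribution_linear:
  "T \<in> compact_distributions X \<Longrightarrow> smooth_near X g \<Longrightarrow> smooth_near X h \<Longrightarrow>
     T (\<lambda>x. g x + c * h x) = T g + c * T h"
  unfolding compact_distributions_def by blast

lemma distribution_scale:
  assumes "T \<in> compact_distributions X" "smooth_near X h"
  shows "T (\<lambda>x. c * h x) = c * T h"
proof -
  have "T (\<lambda>x. 0) = 0"
    using distribution_linear[OF assms(1) smooth_near_const[of X 0] smooth_near_const[of X 0], of 1] by simp
  then show ?thesis
    using distribution_linear[OF assms(1) smooth_near_const[of X 0] assms(2), of c] by simp
qed

lemma distribution_diff:
  assumes "T \<in> compact_distributions X" "smooth_near X g" "smooth_near X h"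
  shows "T (\<lambda>x. g x - h x) = T g - T h"
  using distribution_linear[OF assms, of "-1"] by simp

lemma distribution_bound:
  assumes "T \<in> compact_distributions X" "open W" "X \<subseteq> W"
  obtains L N C where "compact L" "L \<subseteq> W"
    "\<And>g M. smooth_on_open W g \<Longrightarrow> derivs_bounded L N M g \<Longrightarrow> norm (T g) \<le> C * M"
proof -
  have "\<exists>L N C. compact L \<and> L \<subseteq> W \<and>
      (\<forall>g M. smooth_on_open W g \<longrightarrow> derivs_bounded L N M g \<longrightarrow> norm (T g) \<le> C * M)"
    using assms by (simp add: compact_distributions_def)
  then obtain L N C where *: "compact L" "L \<subseteq> W"
    and bound: "\<forall>g M. smooth_on_open W g \<longrightarrow> derivs_bounded L N M g \<longrightarrow> norm (T g) \<le> C * M"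
    by (elim exE conjE)
  show thesis by (rule that[OF * bound[rule_format]])
qed

lemma finite_multi_indices: "finite {hs. set hs \<subseteq> (Basis :: 'a::euclidean_space set) \<and> length hs \<le> N}"
  by (rule finite_lists_length_le[OF finite_Basis])

text \<open>The values of a compactly supported distribution are controlled by finitely many derivatives on
  a compact set, and these depend on the parameter continuously and uniformly on that set.\<close>

lemma distribution_family_continuous:
  fixes F :: "'p::euclidean_space \<times> 'v::euclidean_space \<Rightarrow> complex"
  assumes T: "T \<in> compact_distributions X" and F: "smooth_on_open Z F"
    and P: "open P" "p0 \<in> P" and W: "open W" "X \<subseteq> W" "P \<times> W \<subseteq> Z"
  shows "isCont (\<lambda>p. T (\<lambda>v. F (p, v))) p0"
proof -
  obtain L N C where L: "compact L" "L \<subseteq> W"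
    and bound: "\<And>g M. smooth_on_open W g \<Longrightarrow> derivs_bounded L N M g \<Longrightarrow> norm (T g) \<le> C * M"
    using distribution_bound[OF T W(1,2)] by metis
  obtain r where r: "r > 0" "cball p0 r \<subseteq> P"
    using P open_contains_cball by blast
  have slice: "smooth_on_open W (\<lambda>v. F (p, v))" if "p \<in> P" for p
    by (rule smooth_subset[OF smooth_partial[OF F] W(1)]) (use W that in auto)
  define H where "H = {hs :: 'v list. set hs \<subseteq> Basis \<and> length hs \<le> N}"
  let ?G = "\<lambda>hs. iter_deriv (map (\<lambda>h. (0, h)) hs) F"
  have uniform: "\<forall>\<^sub>F p in nhds p0. \<forall>v\<in>L. norm (?G hs (p, v) - ?G hs (p0, v)) \<le> e" if e: "e > 0" for hs e
  proof -
    have "cball p0 r \<times> L \<subseteq> Z" using r L W by auto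
    then have "continuous_on (cball p0 r \<times> L) (?G hs)"
      using smooth_imp_continuous_on[OF smooth_iter_deriv[OF F]] continuous_on_subset by blast
    then have "uniformly_continuous_on (cball p0 r \<times> L) (?G hs)"
      by (intro compact_uniformly_continuous compact_Times compact_cball L)
    then obtain d where d: "d > 0" "\<And>a b. a \<in> cball p0 r \<times> L \<Longrightarrow> b \<in> cball p0 r \<times> L \<Longrightarrow>
        dist a b < d \<Longrightarrow> dist (?G hs a) (?G hs b) < e"
      using e unfolding uniformly_continuous_on_def by metis
    have "norm (?G hs (p, v) - ?G hs (p0, v)) \<le> e" if "dist p p0 < min r d" "v \<in> L" for p v
      using d(2)[of "(p, v)" "(p0, v)"] that r
      by (simp add: dist_Pair_Pair dist_norm norm_minus_commute)
    moreover have "\<forall>\<^sub>F p in nhds p0. dist p p0 < min r d"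
      using r d by (intro eventually_nhds_in_open[of "ball p0 (min r d)", simplified, THEN eventually_mono])
        (auto simp: dist_commute)
    ultimately show ?thesis by (auto elim!: eventually_mono)
  qed
  have "((\<lambda>p. T (\<lambda>v. F (p, v))) \<longlongrightarrow> T (\<lambda>v. F (p0, v))) (nhds p0)"
  proof (rule tendstoI)
    fix e :: real assume e: "e > 0"
    define d where "d = e / (\<bar>C\<bar> + 1)"
    have d: "d > 0" "\<bar>C\<bar> * d < e" using e by (auto simp: d_def divide_simps)
    have "\<forall>\<^sub>F p in nhds p0. \<forall>hs\<in>H. \<forall>v\<in>L. norm (?G hs (p, v) - ?G hs (p0, v)) \<le> d"
      using finite_multi_indices uniform[OF d(1)] unfolding H_def by (intro eventually_ball_finite) auto
    moreover have "\<forall>\<^sub>F p in nhds p0. p \<in> P"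
      using P by (rule eventually_nhds_in_open)
    ultimately show "\<forall>\<^sub>F p in nhds p0. dist (T (\<lambda>v. F (p, v))) (T (\<lambda>v. F (p0, v))) < e"
    proof eventually_elim
      case (elim p)
      have "derivs_bounded L N d (\<lambda>v. F (p, v) - F (p0, v))"
        unfolding derivs_bounded_def
      proof (intro allI impI ballI)
        fix hs v assume hs: "set hs \<subseteq> (Basis :: 'v set)" "length hs \<le> N" and v: "v \<in> L"
        have "iter_deriv hs (\<lambda>v. F (p, v) - F (p0, v)) v = ?G hs (p, v) - ?G hs (p0, v)"
        proof -
          have z: "v \<in> W" "(p, v) \<in> Z" "(p0, v) \<in> Z" using v L W elim P by auto
          show ?thesis
            unfolding iter_deriv_diff[OF slice[OF elim(2)] slice[OF P(2)] z(1)]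
              iter_deriv_partial[OF F z(2)] iter_deriv_partial[OF F z(3)] ..
        qed
        then show "norm (iter_deriv hs (\<lambda>v. F (p, v) - F (p0, v)) v) \<le> d"
          using elim hs v by (simp add: H_def)
      qed
      then have "norm (T (\<lambda>v. F (p, v) - F (p0, v))) \<le> C * d"
        using elim P slice by (intro bound smooth_diff) auto
      also have "\<dots> \<le> \<bar>C\<bar> * d" using d by (intro mult_right_mono) auto
      also have "\<dots> < e" by (rule d)
      finally have "norm (T (\<lambda>v. F (p, v) - F (p0, v))) < e" .
      moreover have "T (\<lambda>v. F (p, v) - F (p0, v)) = T (\<lambda>v. F (p, v)) - T (\<lambda>v. F (p0, v))"
        using elim P slice W by (intro distribution_diff[OF T]) (auto intro: smooth_nearI)
      ultimately show ?case by (simp add: dist_norm)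
    qed
  qed
  then show ?thesis unfolding isCont_def by (rule tendsto_mono[rotated]) (simp add: at_within_def)
qed

text \<open>Each derivative of \<open>e\<^sup>-\<^sup>i\<^sup>\<omega>\<^sup>Q c\<close> brings down at most one factor \<open>\<omega>\<close>.\<close>

lemma iter_deriv_oscillation:
  fixes Q :: "'p::euclidean_space \<times> 'v::euclidean_space \<Rightarrow> real" and c :: "'p \<times> 'v \<Rightarrow> complex"
  assumes Q: "smooth_on_open Z Q" and c: "smooth_on_open Z c"
  shows "\<exists>n d. (\<forall>j. smooth_on_open Z (d j)) \<and> (\<forall>p v \<omega>. (p, v) \<in> Z \<longrightarrow>
    iter_deriv hs (\<lambda>v. exp (- (\<i> * of_real (\<omega> * Q (p, v)))) * c (p, v)) v =
    exp (- (\<i> * of_real (\<omega> * Q (p, v)))) * (\<Sum>j\<le>n. of_real \<omega> ^ j * d j (p, v)))"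
proof (induction hs)
  case Nil
  show ?case using c by (intro exI[of _ 0] exI[of _ "\<lambda>_. c"]) simp
next
  case (Cons h hs)
  then obtain n d where d': "\<forall>j. smooth_on_open Z (d j)"
    and IH: "\<forall>p v \<omega>. (p, v) \<in> Z \<longrightarrow>
      iter_deriv hs (\<lambda>v. exp (- (\<i> * of_real (\<omega> * Q (p, v)))) * c (p, v)) v =
      exp (- (\<i> * of_real (\<omega> * Q (p, v)))) * (\<Sum>j\<le>n. of_real \<omega> ^ j * d j (p, v))"
    by (elim exE conjE)
  note d = d'[rule_format]
  have op: "open Z" using Q smooth_imp_open by blast
  let ?Dh = "\<lambda>f z. frechet_derivative f (at z) (0, h)"
  define a where "a = (\<lambda>j. ?Dh (d j))"
  define b where "b = (\<lambda>j z. - (\<i> * of_real (?Dh Q z) * d j z))"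
  define d' where "d' = (\<lambda>j z. (if j \<le> n then a j z else 0) + (case j of 0 \<Rightarrow> 0 | Suc i \<Rightarrow> b i z))"
  have smooth_a: "smooth_on_open Z (a j)" for j
    unfolding a_def by (rule smooth_frechet_derivative[OF d])
  have smooth_b: "smooth_on_open Z (b j)" for j
    unfolding b_def by (intro smooth_intros smooth_frechet_derivative[OF Q] d op)
  have smooth_d': "smooth_on_open Z (d' j)" for j
    unfolding d'_def by (cases "j \<le> n"; cases j) (auto intro!: smooth_intros smooth_a smooth_b op)
  have sum_d': "(\<Sum>j\<le>Suc n. of_real \<omega> ^ j * d' j z) =
      (\<Sum>j\<le>n. of_real \<omega> ^ j * a j z) + of_real \<omega> * (\<Sum>j\<le>n. of_real \<omega> ^ j * b j z)" for \<omega> :: real and z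
  proof -
    have "(\<Sum>j\<le>Suc n. of_real \<omega> ^ j * (if j \<le> n then a j z else 0)) = (\<Sum>j\<le>n. of_real \<omega> ^ j * a j z)"
      by simp
    moreover have "(\<Sum>j\<le>Suc n. of_real \<omega> ^ j * (case j of 0 \<Rightarrow> 0 | Suc i \<Rightarrow> b i z)) =
        of_real \<omega> * (\<Sum>j\<le>n. of_real \<omega> ^ j * b j z)"
      by (subst sum.atMost_Suc_shift) (simp add: sum_distrib_left mult.assoc)
    ultimately show ?thesis
      unfolding d'_def by (simp only: ring_distribs sum.distrib)
  qed
  have "iter_deriv (h # hs) (\<lambda>v. exp (- (\<i> * of_real (\<omega> * Q (p, v)))) * c (p, v)) v =
      exp (- (\<i> * of_real (\<omega> * Q (p, v)))) * (\<Sum>j\<le>Suc n. of_real \<omega> ^ j * d' j (p, v))"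
    if z: "(p, v) \<in> Z" for p v \<omega>
  proof -
    let ?E = "\<lambda>z. exp (- (\<i> * of_real (\<omega> * Q z)))" and ?S = "\<lambda>z. \<Sum>j\<le>n. of_real \<omega> ^ j * d j z"
    have opv: "open {v. (p, v) \<in> Z}"
      using smooth_imp_open[OF smooth_partial[OF Q]] .
    have part: "((\<lambda>v. f (p, v)) has_derivative (\<lambda>k. frechet_derivative f (at (p, v)) (0, k))) (at v)"
      if "smooth_on_open Z f" for f :: "'p \<times> 'v \<Rightarrow> 'c::real_normed_vector"
      by (rule has_derivative_compose[where f = "Pair p" and f' = "Pair 0" and g = f])
         (auto intro!: derivative_eq_intros smooth_has_derivative[OF that z])
    have der: "((\<lambda>v. ?E (p, v) * ?S (p, v)) has_derivative
        (\<lambda>k. ?E (p, v) * (\<Sum>j\<le>n. of_real \<omega> ^ j * frechet_derivative (d j) (at (p, v)) (0, k)) +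
          (?E (p, v) * - (\<i> * of_real (\<omega> * frechet_derivative Q (at (p, v)) (0, k)))) * ?S (p, v))) (at v)"
    proof -
      have "((\<lambda>v. - (\<i> * of_real (\<omega> * Q (p, v)))) has_derivative
          (\<lambda>k. - (\<i> * of_real (\<omega> * frechet_derivative Q (at (p, v)) (0, k))))) (at v)"
        by (intro has_derivative_minus has_derivative_mult_right has_derivative_of_real part[OF Q])
      note E = has_derivative_compose[OF this DERIV_exp[unfolded has_field_derivative_def]]
      have "((\<lambda>v. ?S (p, v)) has_derivative
          (\<lambda>k. \<Sum>j\<le>n. of_real \<omega> ^ j * frechet_derivative (d j) (at (p, v)) (0, k))) (at v)"
        by (intro has_derivative_sum has_derivative_mult_right part[OF d])
      from has_derivative_mult[OF E this] show ?thesis .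
    qed
    have "frechet_derivative (\<lambda>v. ?E (p, v) * ?S (p, v)) (at v) h =
        ?E (p, v) * (\<Sum>j\<le>n. of_real \<omega> ^ j * a j (p, v)) +
          (?E (p, v) * - (\<i> * of_real (\<omega> * ?Dh Q (p, v)))) * ?S (p, v)"
      unfolding a_def frechet_derivative_at[OF der, symmetric] ..
    also have "\<dots> = ?E (p, v) * (\<Sum>j\<le>Suc n. of_real \<omega> ^ j * d' j (p, v))"
      unfolding sum_d' b_def by (simp add: algebra_simps sum_distrib_left sum_negf)
    finally show ?thesis
      using frechet_derivative_cong_open[OF opv, of v "iter_deriv hs (\<lambda>v. ?E (p, v) * c (p, v))"
          "\<lambda>v. ?E (p, v) * ?S (p, v)"] IH z by simp
  qed
  then show ?case using smooth_d' by (intro exI[of _ "Suc n"] exI[of _ d']) blast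
qed

text \<open>Finitely many derivatives on a compact set control the distribution, and each of them is bounded by
  a polynomial in \<open>\<omega>\<close>, uniformly for the parameters in a compact set.\<close>

lemma distribution_oscillation_growth:
  fixes Q :: "'p::euclidean_space \<times> 'v::euclidean_space \<Rightarrow> real" and c :: "'p \<times> 'v \<Rightarrow> complex"
  assumes T: "T \<in> compact_distributions X" and Q: "smooth_on_open Z Q" and c: "smooth_on_open Z c"
    and K: "compact K" and W: "open W" "X \<subseteq> W" "K \<times> W \<subseteq> Z"
  shows "\<exists>C n. \<forall>p\<in>K. \<forall>\<omega>.
    norm (T (\<lambda>v. exp (- (\<i> * of_real (\<omega> * Q (p, v)))) * c (p, v))) \<le> C * (1 + \<bar>\<omega>\<bar>) ^ n"
proof -
  let ?F = "\<lambda>p \<omega> v. exp (- (\<i> * of_real (\<omega> * Q (p, v)))) * c (p, v)"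
  obtain L N C where L: "compact L" "L \<subseteq> W"
    and bound: "\<And>g M. smooth_on_open W g \<Longrightarrow> derivs_bounded L N M g \<Longrightarrow> norm (T g) \<le> C * M"
    using distribution_bound[OF T W(1,2)] by metis
  define H where "H = {hs :: 'v list. set hs \<subseteq> Basis \<and> length hs \<le> N}"
  have H: "finite H" unfolding H_def by (rule finite_multi_indices)
  define growth where "growth = (\<lambda>hs C n. C \<ge> 0 \<and>
    (\<forall>p\<in>K. \<forall>v\<in>L. \<forall>\<omega>. norm (iter_deriv hs (?F p \<omega>) v) \<le> C * (1 + \<bar>\<omega>\<bar>) ^ n))"
  have "\<exists>C n. growth hs C n" for hs
  proof -
    obtain n d where d': "\<forall>j. smooth_on_open Z (d j)"
      and eq': "\<forall>p v \<omega>. (p, v) \<in> Z \<longrightarrow> iter_deriv hs (?F p \<omega>) v =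
        exp (- (\<i> * of_real (\<omega> * Q (p, v)))) * (\<Sum>j\<le>n. of_real \<omega> ^ j * d j (p, v))"
      using iter_deriv_oscillation[OF Q c, of hs] by (elim exE conjE)
    note d = d'[rule_format] and eq = eq'[rule_format]
    have KL: "K \<times> L \<subseteq> Z" using L W by auto
    have "\<exists>M. \<forall>z\<in>K \<times> L. norm (d j z) \<le> M" for j
    proof -
      have "bounded (d j ` (K \<times> L))"
        using continuous_on_subset[OF smooth_imp_continuous_on[OF d] KL]
        by (intro compact_imp_bounded compact_continuous_image compact_Times K L)
      then show ?thesis unfolding bounded_iff by blast
    qed
    then obtain M where M: "\<And>j z. z \<in> K \<times> L \<Longrightarrow> norm (d j z) \<le> M j" by metis
    have "norm (iter_deriv hs (?F p \<omega>) v) \<le> (\<Sum>j\<le>n. \<bar>M j\<bar>) * (1 + \<bar>\<omega>\<bar>) ^ n"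
      if "p \<in> K" "v \<in> L" for p v \<omega>
    proof -
      have z: "(p, v) \<in> Z" "(p, v) \<in> K \<times> L" using that KL by auto
      have "norm (iter_deriv hs (?F p \<omega>) v) = norm (\<Sum>j\<le>n. of_real \<omega> ^ j * d j (p, v))"
        unfolding eq[OF z(1)] norm_mult by (simp add: norm_exp_eq_Re)
      also have "\<dots> \<le> (\<Sum>j\<le>n. \<bar>\<omega>\<bar> ^ j * norm (d j (p, v)))"
        by (rule order.trans[OF norm_sum]) (simp add: norm_mult norm_power)
      also have "\<dots> \<le> (\<Sum>j\<le>n. (1 + \<bar>\<omega>\<bar>) ^ n * \<bar>M j\<bar>)"
      proof (intro sum_mono mult_mono)
        fix j assume j: "j \<in> {..n}"
        have "\<bar>\<omega>\<bar> ^ j \<le> (1 + \<bar>\<omega>\<bar>) ^ j" by (intro power_mono) auto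
        also have "\<dots> \<le> (1 + \<bar>\<omega>\<bar>) ^ n" using j by (intro power_increasing) auto
        finally show "\<bar>\<omega>\<bar> ^ j \<le> (1 + \<bar>\<omega>\<bar>) ^ n" .
        show "norm (d j (p, v)) \<le> \<bar>M j\<bar>" using M[OF z(2), of j] by linarith
      qed auto
      finally show ?thesis by (simp add: sum_distrib_left mult.commute)
    qed
    then show ?thesis
      unfolding growth_def by (intro exI[of _ "\<Sum>j\<le>n. \<bar>M j\<bar>"] exI[of _ n]) (auto intro: sum_nonneg)
  qed
  then obtain A n where "\<And>hs. growth hs (A hs) (n hs)" by metis
  then have A: "A hs \<ge> 0" "p \<in> K \<Longrightarrow> v \<in> L \<Longrightarrow>
      norm (iter_deriv hs (?F p \<omega>) v) \<le> A hs * (1 + \<bar>\<omega>\<bar>) ^ n hs" for hs p v \<omega>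
    unfolding growth_def by auto
  have "norm (T (?F p \<omega>)) \<le> (\<bar>C\<bar> * sum A H) * (1 + \<bar>\<omega>\<bar>) ^ sum n H" if p: "p \<in> K" for p \<omega>
  proof -
    let ?M = "sum A H * (1 + \<bar>\<omega>\<bar>) ^ sum n H"
    have "derivs_bounded L N ?M (?F p \<omega>)"
      unfolding derivs_bounded_def
    proof (intro allI impI ballI)
      fix hs v assume "set hs \<subseteq> (Basis :: 'v set)" "length hs \<le> N" and v: "v \<in> L"
      then have hs: "hs \<in> H" by (simp add: H_def)
      have "norm (iter_deriv hs (?F p \<omega>) v) \<le> A hs * (1 + \<bar>\<omega>\<bar>) ^ n hs" by (rule A(2)[OF p v])
      also have "\<dots> \<le> ?M"
        using hs H A(1) by (intro mult_mono power_increasing member_le_sum sum_nonneg) auto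
      finally show "norm (iter_deriv hs (?F p \<omega>) v) \<le> ?M" .
    qed
    moreover have "smooth_on_open W (?F p \<omega>)"
    proof -
      have "smooth_on_open {v. (p, v) \<in> Z} (?F p \<omega>)"
        by (intro smooth_intros smooth_partial Q c smooth_imp_open[OF smooth_partial[OF Q]])
      then show ?thesis by (rule smooth_subset) (use p W in auto)
    qed
    ultimately have "norm (T (?F p \<omega>)) \<le> C * ?M" by (intro bound)
    also have "\<dots> \<le> \<bar>C\<bar> * ?M" using A(1) by (intro mult_right_mono mult_nonneg_nonneg sum_nonneg) auto
    finally show ?thesis by (simp add: mult.assoc)
  qed
  then show ?thesis by blast
qed


section \<open>Oscillatory integrals\<close>

lemma integrable_compact_support:
  fixes f :: "'a::euclidean_space \<Rightarrow> 'b::{banach, second_countable_topology}"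
  assumes "continuous_on UNIV f" "compact K" "\<And>x. x \<notin> K \<Longrightarrow> f x = 0"
  shows "integrable lborel f"
proof -
  have "(\<lambda>x. indicator K x *\<^sub>R f x) = f"
    using assms(3) by (auto simp: fun_eq_iff indicator_def)
  then show ?thesis
    using borel_integrable_compact[OF assms(2) continuous_on_subset[OF assms(1)]] by simp
qed

lemma integrable_inverse_quadratic: "integrable lborel (\<lambda>x::real. 1 / (1 + x\<^sup>2))"
proof -
  let ?f = "\<lambda>x::real. 1 / (1 + x\<^sup>2)"
  have pos: "1 + x\<^sup>2 > 0" for x :: real by (simp add: add_pos_nonneg)
  have meas: "?f \<in> borel_measurable borel" by measurable
  have "(\<integral>\<^sup>+x. ennreal (?f x) * indicator {0..} x \<partial>lborel) = ennreal (pi / 2 - arctan 0)"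
  proof (rule nn_integral_FTC_atLeast[OF meas])
    show "(arctan has_real_derivative ?f x) (at x)" for x
      using DERIV_arctan[of x] by (simp add: divide_inverse)
    show "(arctan \<longlongrightarrow> pi / 2) at_top" by (rule tendsto_arctan_at_top)
  qed (use pos less_imp_le in auto)
  moreover have "ennreal (?f x) * indicator {0..} x = ennreal (norm (?f x * indicator {0..} x))" for x
    using pos[of x] by (auto simp: indicator_def)
  ultimately have half: "integrable lborel (\<lambda>x. ?f x * indicator {0..} x)"
    by (subst integrable_iff_bounded) simp
  from lborel_integrable_real_affine[OF this, of "-1" 0]
  have half': "integrable lborel (\<lambda>x. ?f x * indicator {0..} (- x))" by simp
  show ?thesis
    by (rule Bochner_Integration.integrable_bound[OF Bochner_Integration.integrable_add[OF half half']])
       (use pos in \<open>auto simp: indicator_def less_imp_le add_nonneg_nonneg\<close>)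
qed

text \<open>Fubini's theorem in the form in which it moves the integration in \<open>t\<close> inside.\<close>

lemma iterated_integral_swap:
  fixes \<psi> :: "('y::euclidean_space \<times> real) \<times> real \<Rightarrow> complex"
  assumes cont: "continuous_on UNIV \<psi>" and K: "compact K" and supp: "\<And>z. z \<notin> K \<Longrightarrow> \<psi> z = 0"
  shows "(\<integral>u. (\<integral>\<theta>. \<psi> (u, \<theta>) \<partial>lborel) \<partial>lborel) =
    (\<integral>y. (\<integral>\<theta>. (\<integral>t. \<psi> ((y, t), \<theta>) \<partial>lborel) \<partial>lborel) \<partial>lborel)"
proof -
  have "integrable (lborel \<Otimes>\<^sub>M lborel) \<psi>"
    unfolding lborel_prod by (rule integrable_compact_support[OF cont K supp])
  then have "integrable lborel (\<lambda>u. \<integral>\<theta>. \<psi> (u, \<theta>) \<partial>lborel)"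
    by (rule lborel_pair.integrable_fst')
  then have outer: "(\<integral>u. (\<integral>\<theta>. \<psi> (u, \<theta>) \<partial>lborel) \<partial>lborel) =
      (\<integral>y. (\<integral>t. (\<integral>\<theta>. \<psi> ((y, t), \<theta>) \<partial>lborel) \<partial>lborel) \<partial>lborel)"
    unfolding lborel_prod[symmetric] by (rule lborel_pair.integral_fst'[symmetric])
  have "(\<integral>t. (\<integral>\<theta>. \<psi> ((y, t), \<theta>) \<partial>lborel) \<partial>lborel) =
      (\<integral>\<theta>. (\<integral>t. \<psi> ((y, t), \<theta>) \<partial>lborel) \<partial>lborel)" for y
  proof (rule lborel_pair.Fubini_integral[symmetric])
    have "compact ((\<lambda>z. (snd (fst z), snd z)) ` K)"
      by (intro compact_continuous_image continuous_intros K)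
    then have "integrable lborel (\<lambda>p. \<psi> ((y, fst p), snd p))"
    proof (rule integrable_compact_support[rotated])
      show "continuous_on UNIV (\<lambda>p. \<psi> ((y, fst p), snd p))"
        by (rule continuous_on_compose2[OF cont]) (auto intro!: continuous_intros)
      show "\<psi> ((y, fst p), snd p) = 0" if "p \<notin> (\<lambda>z. (snd (fst z), snd z)) ` K" for p
        using that by (intro supp) force
    qed
    then show "integrable (lborel \<Otimes>\<^sub>M lborel) (\<lambda>(t, \<theta>). \<psi> ((y, t), \<theta>))"
      by (simp add: lborel_prod case_prod_unfold)
  qed
  with outer show ?thesis by simp
qed

lemma integral_over_quadratic_bound:
  fixes \<Phi> :: "'y::euclidean_space \<times> real \<Rightarrow> complex"
  assumes \<Phi>: "\<Phi> \<in> borel_measurable borel" and K: "compact K" and B: "B \<ge> 0"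
    and bound: "\<And>y \<omega>. norm (\<Phi> (y, \<omega>)) \<le> B * indicator K y / (1 + \<omega>\<^sup>2)"
  defines "c \<equiv> (\<integral>\<omega>. 1 / (1 + (\<omega>::real)\<^sup>2) \<partial>lborel)"
  shows "integrable lborel (\<lambda>\<omega>. \<Phi> (y, \<omega>))"
    and "norm (\<integral>\<omega>. \<Phi> (y, \<omega>) \<partial>lborel) \<le> B * indicator K y * c"
    and "(\<lambda>y. \<integral>\<omega>. \<Phi> (y, \<omega>) \<partial>lborel) \<in> borel_measurable borel"
    and "integrable lborel (\<lambda>y. \<integral>\<omega>. \<Phi> (y, \<omega>) \<partial>lborel)"
    and "norm (\<integral>y. (\<integral>\<omega>. \<Phi> (y, \<omega>) \<partial>lborel) \<partial>lborel) \<le> B * c * measure lborel K"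
proof -
  have prod: "(\<lambda>(y, \<omega>). \<Phi> (y, \<omega>)) \<in> borel_measurable (lborel \<Otimes>\<^sub>M lborel)"
    using \<Phi> by (simp add: lborel_prod)
  then have meas: "(\<lambda>\<omega>. \<Phi> (y, \<omega>)) \<in> borel_measurable lborel" for y
    using \<Phi> by measurable
  have dom: "integrable lborel (\<lambda>\<omega>::real. B * indicator K y / (1 + \<omega>\<^sup>2))" for y
    using Bochner_Integration.integrable_mult_right[OF integrable_inverse_quadratic, of "B * indicator K y"] by simp
  show int: "integrable lborel (\<lambda>\<omega>. \<Phi> (y, \<omega>))" for y
    by (rule Bochner_Integration.integrable_bound[OF dom meas])
       (use order.trans[OF bound abs_ge_self] in auto)
  show inner: "norm (\<integral>\<omega>. \<Phi> (y, \<omega>) \<partial>lborel) \<le> B * indicator K y * c" for y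
  proof -
    have "norm (\<integral>\<omega>. \<Phi> (y, \<omega>) \<partial>lborel) \<le> (\<integral>\<omega>. B * indicator K y / (1 + \<omega>\<^sup>2) \<partial>lborel)"
      by (rule Bochner_Integration.integral_norm_bound_integral[OF int dom bound])
    also have "\<dots> = B * indicator K y * c"
      unfolding c_def
      using Bochner_Integration.integral_mult_right_zero[of lborel "B * indicator K y" "\<lambda>\<omega>. 1 / (1 + \<omega>\<^sup>2)"]
      by simp
    finally show ?thesis .
  qed
  show meas': "(\<lambda>y. \<integral>\<omega>. \<Phi> (y, \<omega>) \<partial>lborel) \<in> borel_measurable borel"
    using lborel.borel_measurable_lebesgue_integral[OF prod] by simp
  have c: "c \<ge> 0" unfolding c_def by (intro Bochner_Integration.integral_nonneg) (simp add: add_nonneg_nonneg)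
  have fin: "emeasure lborel K < \<infinity>" by (rule emeasure_compact_finite[OF K])
  have K': "K \<in> sets lborel" using K by (simp add: borel_compact)
  have dom': "integrable lborel (\<lambda>y. B * indicator K y * c)"
    using fin K' by simp
  show int': "integrable lborel (\<lambda>y. \<integral>\<omega>. \<Phi> (y, \<omega>) \<partial>lborel)"
    by (rule Bochner_Integration.integrable_bound[OF dom']) (use meas' order.trans[OF inner abs_ge_self] in auto)
  have "norm (\<integral>y. (\<integral>\<omega>. \<Phi> (y, \<omega>) \<partial>lborel) \<partial>lborel) \<le> (\<integral>y. B * indicator K y * c \<partial>lborel)"
    by (rule Bochner_Integration.integral_norm_bound_integral[OF int' dom' inner])
  also have "\<dots> = B * c * measure lborel K" using K' by simp
  finally show "norm (\<integral>y. (\<integral>\<omega>. \<Phi> (y, \<omega>) \<partial>lborel) \<partial>lborel) \<le> B * c * measure lborel K" .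
qed

text \<open>The two integrands differ only on \<open>[-R, R]\<close>, and there the difference is the derivative of
  \<open>\<Psi> \<circ> \<mu> - \<Psi>\<close>, with \<open>\<Psi>\<close> an antiderivative of \<open>\<Phi>\<close>, which vanishes at both end points.\<close>

lemma substitution_identity_at_infinity:
  fixes \<Phi> :: "real \<Rightarrow> complex"
  assumes \<Phi>: "continuous_on UNIV \<Phi>" "integrable lborel \<Phi>"
    and comp: "integrable lborel (\<lambda>\<theta>. \<mu>' \<theta> *\<^sub>R \<Phi> (\<mu> \<theta>))"
    and \<mu>: "\<And>\<theta>. (\<mu> has_real_derivative \<mu>' \<theta>) (at \<theta>)" "continuous_on UNIV \<mu>'"
    and id: "\<And>\<theta>. \<bar>\<theta>\<bar> \<ge> R \<Longrightarrow> \<mu> \<theta> = \<theta>" "\<And>\<theta>. \<bar>\<theta>\<bar> > R \<Longrightarrow> \<mu>' \<theta> = 1" and R: "R \<ge> 0"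
  shows "(\<integral>\<theta>. \<mu>' \<theta> *\<^sub>R \<Phi> (\<mu> \<theta>) \<partial>lborel) = (\<integral>\<omega>. \<Phi> \<omega> \<partial>lborel)"
proof -
  let ?d = "\<lambda>\<theta>. \<mu>' \<theta> *\<^sub>R \<Phi> (\<mu> \<theta>) - \<Phi> \<theta>"
  have cont_\<mu>: "continuous_on UNIV \<mu>"
    using \<mu>(1) by (meson DERIV_continuous continuous_at_imp_continuous_on)
  then have "bounded (\<mu> ` {-R..R})"
    by (intro compact_imp_bounded compact_continuous_image) (auto intro: continuous_on_subset)
  then obtain S0 where "\<forall>z\<in>\<mu> ` {-R..R}. norm z \<le> S0"
    unfolding bounded_iff by blast
  then have S0: "\<bar>\<mu> \<theta>\<bar> \<le> S0" if "\<theta> \<in> {-R..R}" for \<theta>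
    using that by fastforce
  define S where "S = max R S0"
  define \<Psi> where "\<Psi> = (\<lambda>x. integral {-S..x} \<Phi>)"
  have \<Psi>: "(\<Psi> has_vector_derivative \<Phi> x) (at x within {-S..S})" if "x \<in> {-S..S}" for x
    unfolding \<Psi>_def using \<Phi>(1) that
    by (intro integral_has_vector_derivative) (auto intro: continuous_on_subset)
  have range: "\<mu> ` {-R..R} \<subseteq> {-S..S}" "{-R..R} \<subseteq> {-S..S}"
    using S0 unfolding S_def by (fastforce simp: abs_le_iff)+
  have deriv: "((\<lambda>\<theta>. \<Psi> (\<mu> \<theta>) - \<Psi> \<theta>) has_vector_derivative ?d \<theta>) (at \<theta> within {-R..R})"
    if \<theta>: "\<theta> \<in> {-R..R}" for \<theta>
  proof (rule has_vector_derivative_diff)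
    have "(\<mu> has_vector_derivative \<mu>' \<theta>) (at \<theta> within {-R..R})"
      using \<mu>(1) has_real_derivative_iff_has_vector_derivative has_vector_derivative_at_within by blast
    moreover have "(\<Psi> has_vector_derivative \<Phi> (\<mu> \<theta>)) (at (\<mu> \<theta>) within \<mu> ` {-R..R})"
      using \<theta> range by (intro has_vector_derivative_within_subset[OF \<Psi>]) (auto simp: image_subset_iff)
    ultimately show "((\<lambda>\<theta>. \<Psi> (\<mu> \<theta>)) has_vector_derivative \<mu>' \<theta> *\<^sub>R \<Phi> (\<mu> \<theta>)) (at \<theta> within {-R..R})"
      using vector_diff_chain_within[of \<mu> "\<mu>' \<theta>" \<theta> "{-R..R}" \<Psi> "\<Phi> (\<mu> \<theta>)"] by (simp add: o_def)
    show "(\<Psi> has_vector_derivative \<Phi> \<theta>) (at \<theta> within {-R..R})"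
      using \<theta> range by (intro has_vector_derivative_within_subset[OF \<Psi>]) (auto simp: image_subset_iff)
  qed
  have "continuous_on UNIV ?d"
    using \<Phi>(1) \<mu>(2) continuous_on_compose2[OF \<Phi>(1) cont_\<mu>] by (intro continuous_intros) auto
  then have "(\<integral>\<theta>. indicator {-R..R} \<theta> *\<^sub>R ?d \<theta> \<partial>lborel) =
      (\<Psi> (\<mu> R) - \<Psi> R) - (\<Psi> (\<mu> (-R)) - \<Psi> (-R))"
    using R deriv by (intro integral_FTC_Icc) (auto intro: continuous_on_subset)
  also have "\<dots> = 0" using R by (simp add: id)
  also have "(\<lambda>\<theta>. indicator {-R..R} \<theta> *\<^sub>R ?d \<theta>) = ?d"
  proof
    fix \<theta>
    show "indicator {-R..R} \<theta> *\<^sub>R ?d \<theta> = ?d \<theta>"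
    proof (cases "\<bar>\<theta>\<bar> \<le> R")
      case True
      then show ?thesis by (simp add: abs_le_iff indicator_def)
    next
      case False
      then show ?thesis by (simp add: id)
    qed
  qed
  finally show ?thesis
    using comp \<Phi>(2) by simp
qed

subsection \<open>The partial Fourier transform of a test function\<close>

definition partial_fourier :: "('y::euclidean_space \<times> real \<Rightarrow> complex) \<Rightarrow> 'y \<times> real \<Rightarrow> complex" where
  "partial_fourier g = (\<lambda>(y, \<omega>). \<integral>t. g (y, t) * exp (\<i> * of_real (\<omega> * t)) \<partial>lborel)"

lemma bounded_second_component:
  assumes "compact (K :: ('y::metric_space \<times> real) set)"
  obtains \<tau> where "\<tau> > 0" "\<And>y t. (y, t) \<in> K \<Longrightarrow> \<bar>t\<bar> < \<tau>"
proof -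
  have "bounded (snd ` K)"
    using assms by (intro compact_imp_bounded compact_continuous_image continuous_intros)
  then obtain B where "\<forall>t\<in>snd ` K. norm t \<le> B" unfolding bounded_iff by blast
  then have "\<bar>t\<bar> < max 0 B + 1" if "(y, t) \<in> K" for y t
    using that by fastforce
  then show thesis using that[of "max 0 B + 1"] by fastforce
qed

lemma integrable_slice:
  fixes g :: "'y::euclidean_space \<times> real \<Rightarrow> complex"
  assumes "continuous_on UNIV g" "compact K" "\<And>z. z \<notin> K \<Longrightarrow> g z = 0"
  shows "integrable lborel (\<lambda>t. g (y, t) * exp (\<i> * of_real (\<omega> * t)))"
proof (rule integrable_compact_support[where K = "snd ` K"])
  show "continuous_on UNIV (\<lambda>t. g (y, t) * exp (\<i> * of_real (\<omega> * t)))"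
    by (intro continuous_intros continuous_on_compose2[OF assms(1)]) auto
  show "compact (snd ` K)" by (intro compact_continuous_image continuous_intros assms)
  show "g (y, t) * exp (\<i> * of_real (\<omega> * t)) = 0" if "t \<notin> snd ` K" for t
  proof -
    have "(y, t) \<notin> K" using that by force
    then show ?thesis using assms(3) by simp
  qed
qed

lemma partial_fourier_continuous:
  fixes g :: "'y::euclidean_space \<times> real \<Rightarrow> complex"
  assumes g: "continuous_on UNIV g" and K: "compact K" and supp: "\<And>z. z \<notin> K \<Longrightarrow> g z = 0"
  shows "continuous_on UNIV (partial_fourier g)"
proof -
  obtain \<tau> where \<tau>: "\<tau> > 0" "\<And>y t. (y, t) \<in> K \<Longrightarrow> \<bar>t\<bar> < \<tau>" using bounded_second_component[OF K] by metis
  let ?f = "\<lambda>z t. g (fst z, t) * exp (\<i> * of_real (snd z * t))"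
  have cont: "continuous_on (UNIV \<times> cbox (-\<tau>) \<tau>) (\<lambda>(z, t). ?f z t)"
    unfolding case_prod_unfold
    by (intro continuous_intros continuous_on_compose2[OF g]) auto
  have "partial_fourier g z = integral (cbox (-\<tau>) \<tau>) (?f z)" for z
  proof -
    have ind: "indicator (cbox (-\<tau>) \<tau>) t *\<^sub>R ?f z t = ?f z t" for t
    proof (cases "\<bar>t\<bar> \<le> \<tau>")
      case False
      then have "(fst z, t) \<notin> K" using \<tau>(2) by force
      then show ?thesis using supp by simp
    qed (auto simp: indicator_def)
    have "set_integrable lborel (cbox (-\<tau>) \<tau>) (?f z)"
      unfolding set_integrable_def ind by (rule integrable_slice[OF g K supp])
    from set_borel_integral_eq_integral(2)[OF this] show ?thesis
      unfolding set_lebesgue_integral_def ind by (simp add: partial_fourier_def case_prod_unfold)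
  qed
  then show ?thesis
    using integral_continuous_on_param[OF cont] by simp
qed

lemma iter_deriv_zero: "iter_deriv hs (\<lambda>x::'a::euclidean_space. 0 :: 'b::real_normed_vector) x = 0"
proof (induction hs arbitrary: x)
  case (Cons h hs)
  then have "iter_deriv hs (\<lambda>x::'a. 0 :: 'b) = (\<lambda>x. 0)" by (simp add: fun_eq_iff)
  then show ?case by (simp add: frechet_derivative_const)
qed simp

lemma iter_deriv_outside:
  assumes "closed K" "\<And>z. z \<notin> K \<Longrightarrow> g z = 0" "z \<notin> K"
  shows "iter_deriv hs g z = 0"
  using iter_deriv_cong_open[of "- K" g "\<lambda>x. 0" z hs] assms iter_deriv_zero by (auto simp: open_Compl)

text \<open>Integration by parts in \<open>t\<close>, without boundary terms since the support is compact.\<close>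

lemma partial_fourier_derivative:
  fixes g :: "'y::euclidean_space \<times> real \<Rightarrow> complex"
  assumes g: "smooth_on_open UNIV g" and K: "compact K" and supp: "\<And>z. z \<notin> K \<Longrightarrow> g z = 0"
  shows "partial_fourier (\<lambda>z. frechet_derivative g (at z) (0, 1)) (y, \<omega>) =
    - (\<i> * of_real \<omega>) * partial_fourier g (y, \<omega>)"
proof -
  obtain \<tau> where \<tau>: "\<tau> > 0" "\<And>y t. (y, t) \<in> K \<Longrightarrow> \<bar>t\<bar> < \<tau>" using bounded_second_component[OF K] by metis
  let ?g' = "\<lambda>z. frechet_derivative g (at z) (0, 1)" and ?e = "\<lambda>t. exp (\<i> * of_real (\<omega> * t))"
  have g': "smooth_on_open UNIV ?g'" by (rule smooth_frechet_derivative[OF g])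
  have supp': "?g' z = 0" if "z \<notin> K" for z
    using iter_deriv_outside[OF compact_imp_closed[OF K] supp that, where hs = "[(0, 1)]"] by simp
  note int = integrable_slice[OF smooth_imp_continuous_on[OF g] K supp, of y \<omega>]
    and int' = integrable_slice[OF smooth_imp_continuous_on[OF g'] K supp', of y \<omega>]
  let ?d = "\<lambda>t. ?g' (y, t) * ?e t + (\<i> * of_real \<omega>) * (g (y, t) * ?e t)"
  have deriv: "((\<lambda>t. g (y, t) * ?e t) has_vector_derivative ?d t) (at t within {-\<tau>..\<tau>})" for t
  proof -
    have slice: "((\<lambda>t. g (y, t)) has_derivative (\<lambda>h. frechet_derivative g (at (y, t)) (0, h))) (at t)"
      by (rule has_derivative_compose[where f = "Pair y" and f' = "Pair 0" and g = g])
         (auto intro!: derivative_eq_intros smooth_has_derivative[OF g])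
    have scale: "frechet_derivative g (at (y, t)) (0, h) = h *\<^sub>R ?g' (y, t)" for h
      using linear_scale[OF linear_frechet_derivative[OF smooth_imp_differentiable[OF g]], of "(y, t)" h "(0, 1)"]
      by simp
    have gt: "((\<lambda>t. g (y, t)) has_vector_derivative ?g' (y, t)) (at t)"
      unfolding has_vector_derivative_def by (rule has_derivative_eq_rhs[OF slice ext[OF scale]])
    have "((\<lambda>t. \<i> * of_real (\<omega> * t)) has_vector_derivative \<i> * of_real \<omega>) (at t)"
      by (auto intro!: derivative_eq_intros simp: has_vector_derivative_def scaleR_conv_of_real algebra_simps)
    from field_vector_diff_chain_at[OF this DERIV_exp]
    have "(?e has_vector_derivative \<i> * of_real \<omega> * ?e t) (at t)" by (simp add: o_def)
    from has_vector_derivative_mult[OF gt this] show ?thesis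
      by - (rule has_vector_derivative_at_within, erule has_vector_derivative_eq_rhs, simp only: ac_simps)
  qed
  have zero: "g (y, t) = 0" "?g' (y, t) = 0" if "\<bar>t\<bar> \<ge> \<tau>" for t
  proof -
    have "(y, t) \<notin> K" using \<tau>(2)[of y t] that by force
    then show "g (y, t) = 0" "?g' (y, t) = 0" using supp supp' by auto
  qed
  have cont: "continuous_on UNIV (\<lambda>t. f (y, t))" if "smooth_on_open UNIV f" for f :: "'y \<times> real \<Rightarrow> complex"
    by (rule continuous_on_compose2[OF smooth_imp_continuous_on[OF that]]) (auto intro!: continuous_intros)
  have "continuous_on UNIV ?d" by (intro continuous_intros cont g g')
  then have "(\<integral>t. indicator {-\<tau>..\<tau>} t *\<^sub>R ?d t \<partial>lborel) = g (y, \<tau>) * ?e \<tau> - g (y, - \<tau>) * ?e (- \<tau>)"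
    using \<tau>(1) deriv by (intro integral_FTC_Icc) (auto intro: continuous_on_subset)
  also have "\<dots> = 0" using \<tau>(1) by (simp add: zero)
  also have "(\<lambda>t. indicator {-\<tau>..\<tau>} t *\<^sub>R ?d t) = ?d"
  proof
    fix t show "indicator {-\<tau>..\<tau>} t *\<^sub>R ?d t = ?d t"
      using zero[of t] by (cases "\<bar>t\<bar> \<le> \<tau>") (auto simp: indicator_def abs_le_iff)
  qed
  finally have "(\<integral>t. ?g' (y, t) * ?e t \<partial>lborel) + (\<i> * of_real \<omega>) * (\<integral>t. g (y, t) * ?e t \<partial>lborel) = 0"
    using int int' by simp
  then show ?thesis
    unfolding partial_fourier_def by (simp add: eq_neg_iff_add_eq_0)
qed

text \<open>The constant depends on the size of the support only, and not on the test function; this is what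
  makes the limit below a distribution.\<close>

lemma partial_fourier_decay:
  fixes K :: "('y::euclidean_space \<times> real) set"
  assumes K: "compact K"
  shows "\<exists>\<tau>\<ge>0. \<forall>g N M j y \<omega>. smooth_on_open UNIV g \<longrightarrow> (\<forall>z. z \<notin> K \<longrightarrow> g z = 0) \<longrightarrow>
    derivs_bounded K N M g \<longrightarrow> M \<ge> 0 \<longrightarrow> j \<le> N \<longrightarrow> \<bar>\<omega>\<bar> ^ j * norm (partial_fourier g (y, \<omega>)) \<le> \<tau> * M"
proof -
  obtain \<tau> where \<tau>: "\<tau> > 0" "\<And>y t. (y, t) \<in> K \<Longrightarrow> \<bar>t\<bar> < \<tau>" using bounded_second_component[OF K] by metis
  have "\<bar>\<omega>\<bar> ^ j * norm (partial_fourier g (y, \<omega>)) \<le> 2 * \<tau> * M"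
    if g: "smooth_on_open UNIV g" and supp: "\<And>z. z \<notin> K \<Longrightarrow> g z = 0"
      and bd: "derivs_bounded K N M g" and M: "M \<ge> 0" and j: "j \<le> N" for g N M j y \<omega>
  proof -
    let ?D = "\<lambda>j. iter_deriv (replicate j (0, 1)) g"
    have D: "smooth_on_open UNIV (?D j)" for j by (rule smooth_iter_deriv[OF g])
    have out: "?D j z = 0" if "z \<notin> K" for j z
      by (rule iter_deriv_outside[OF compact_imp_closed[OF K] supp that])
    have "partial_fourier (?D j) (y, \<omega>) = (- (\<i> * of_real \<omega>)) ^ j * partial_fourier g (y, \<omega>)"
    proof (induction j)
      case (Suc j)
      have "partial_fourier (?D (Suc j)) (y, \<omega>) = - (\<i> * of_real \<omega>) * partial_fourier (?D j) (y, \<omega>)"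
        using partial_fourier_derivative[OF D K out, of j y \<omega>] by simp
      then show ?case using Suc by simp
    qed simp
    then have "\<bar>\<omega>\<bar> ^ j * norm (partial_fourier g (y, \<omega>)) = norm (partial_fourier (?D j) (y, \<omega>))"
      by (simp add: norm_mult norm_power)
    also have "\<dots> \<le> (\<integral>t. M * indicator {-\<tau>..\<tau>} t \<partial>lborel)"
      unfolding partial_fourier_def prod.case
    proof (rule Bochner_Integration.integral_norm_bound_integral)
      show "integrable lborel (\<lambda>t. ?D j (y, t) * exp (\<i> * of_real (\<omega> * t)))"
        by (rule integrable_slice[OF smooth_imp_continuous_on[OF D] K out])
      show "integrable lborel (\<lambda>t. M * indicator {-\<tau>..\<tau>} t)"
        by (intro Bochner_Integration.integrable_mult_right integrable_real_indicator)
           (auto simp: emeasure_lborel_Icc_eq)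
      fix t
      show "norm (?D j (y, t) * exp (\<i> * of_real (\<omega> * t))) \<le> M * indicator {-\<tau>..\<tau>} t"
      proof (cases "(y, t) \<in> K")
        case True
        have "set (replicate j (0, 1)) \<subseteq> (Basis :: ('y \<times> real) set)"
          by (auto simp: Basis_prod_def)
        then have "norm (?D j (y, t)) \<le> M"
          using bd j True unfolding derivs_bounded_def by auto
        moreover have "t \<in> {-\<tau>..\<tau>}" using \<tau>(2)[OF True] by auto
        ultimately show ?thesis by (simp add: norm_mult norm_exp_eq_Re)
      next
        case False
        then show ?thesis using M by (simp add: out)
      qed
    qed
    also have "\<dots> = 2 * \<tau> * M" using \<tau>(1) by simp
    finally show ?thesis .
  qed
  then show ?thesis using \<tau>(1) by (intro exI[of _ "2 * \<tau>"]) auto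
qed


subsection \<open>Regularized oscillatory integrals converge\<close>

definition polynomial_growth :: "'y::euclidean_space set \<Rightarrow> ('y \<times> real \<Rightarrow> complex) \<Rightarrow> bool" where
  "polynomial_growth Y E \<longleftrightarrow> continuous_on (Y \<times> UNIV) E \<and>
     (\<forall>K. compact K \<longrightarrow> K \<subseteq> Y \<longrightarrow> (\<exists>C n. \<forall>y\<in>K. \<forall>\<omega>. norm (E (y, \<omega>)) \<le> C * (1 + \<bar>\<omega>\<bar>) ^ n))"

text \<open>The oscillatory integral of \<open>g (y, t) E (y, \<omega>) e\<^sup>i\<^sup>\<omega>\<^sup>t\<close>, in which the integration in \<open>t\<close> comes first.\<close>

definition pairing :: "('y::euclidean_space \<times> real \<Rightarrow> complex) \<Rightarrow> ('y \<times> real \<Rightarrow> complex) \<Rightarrow> complex" where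
  "pairing E g = (\<integral>y. (\<integral>\<omega>. E (y, \<omega>) * partial_fourier g (y, \<omega>) \<partial>lborel) \<partial>lborel)"

text \<open>The decay of the Fourier transform, to an order that depends on the growth of \<open>E\<close> over the support,
  leaves a factor \<open>1 / (1 + \<omega>\<^sup>2)\<close> to spare.\<close>

lemma pairing_integrand_bound:
  fixes E :: "'y::euclidean_space \<times> real \<Rightarrow> complex"
  assumes E: "polynomial_growth Y E" and K: "compact K" "K \<subseteq> Y \<times> UNIV"
  shows "\<exists>N C. C \<ge> 0 \<and> (\<forall>g M. smooth_on_open UNIV g \<longrightarrow> (\<forall>z. z \<notin> K \<longrightarrow> g z = 0) \<longrightarrow>
    derivs_bounded K N M g \<longrightarrow> M \<ge> 0 \<longrightarrow>
    (\<forall>y \<omega>. norm (E (y, \<omega>) * partial_fourier g (y, \<omega>)) \<le> (C * M) * indicator (fst ` K) y / (1 + \<omega>\<^sup>2)))"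
proof -
  have "compact (fst ` K)" "fst ` K \<subseteq> Y"
    using K by (auto intro!: compact_continuous_image continuous_intros)
  then obtain C0 n where C0: "\<forall>y\<in>fst ` K. \<forall>\<omega>. norm (E (y, \<omega>)) \<le> C0 * (1 + \<bar>\<omega>\<bar>) ^ n"
    using E unfolding polynomial_growth_def by metis
  obtain \<tau> where \<tau>: "\<tau> \<ge> 0" and decay: "\<forall>g N M j y \<omega>. smooth_on_open UNIV g \<longrightarrow> (\<forall>z. z \<notin> K \<longrightarrow> g z = 0) \<longrightarrow>
    derivs_bounded K N M g \<longrightarrow> M \<ge> 0 \<longrightarrow> j \<le> N \<longrightarrow> \<bar>\<omega>\<bar> ^ j * norm (partial_fourier g (y, \<omega>)) \<le> \<tau> * M"
    using partial_fourier_decay[OF K(1)] by (elim exE conjE)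
  define C where "C = \<bar>C0\<bar> * (2 ^ (n + 2) * (2 * \<tau>))"
  have "norm (E (y, \<omega>) * partial_fourier g (y, \<omega>)) \<le> (C * M) * indicator (fst ` K) y / (1 + \<omega>\<^sup>2)"
    if g: "smooth_on_open UNIV g" and supp: "\<forall>z. z \<notin> K \<longrightarrow> g z = 0"
      and bd: "derivs_bounded K (n + 2) M g" and M: "M \<ge> 0" for g M y \<omega>
  proof (cases "y \<in> fst ` K")
    case False
    then have "g (y, t) = 0" for t using supp by force
    then show ?thesis using False by (simp add: partial_fourier_def)
  next
    case True
    \<comment> \<open>The exponent \<open>n + 2\<close> pays for the growth of \<open>E\<close> and for the factor \<open>1 + \<omega>\<^sup>2\<close>.\<close>
    let ?G = "norm (partial_fourier g (y, \<omega>))"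
    have pos: "1 + \<omega>\<^sup>2 > 0" by (simp add: add_pos_nonneg)
    have "(1 + \<bar>\<omega>\<bar>) ^ (n + 2) \<le> 2 ^ (n + 2) * (1 + \<bar>\<omega>\<bar> ^ (n + 2))"
    proof -
      have "(1 + \<bar>\<omega>\<bar>) ^ (n + 2) \<le> (2 * max 1 \<bar>\<omega>\<bar>) ^ (n + 2)" by (intro power_mono) auto
      also have "\<dots> = 2 ^ (n + 2) * max 1 \<bar>\<omega>\<bar> ^ (n + 2)" by (rule power_mult_distrib)
      also have "\<dots> \<le> 2 ^ (n + 2) * (1 + \<bar>\<omega>\<bar> ^ (n + 2))"
        by (intro mult_left_mono) (auto simp: max_def)
      finally show ?thesis .
    qed
    then have "(1 + \<bar>\<omega>\<bar>) ^ (n + 2) * ?G \<le> 2 ^ (n + 2) * (1 + \<bar>\<omega>\<bar> ^ (n + 2)) * ?G"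
      by (intro mult_right_mono) auto
    also have "\<dots> = 2 ^ (n + 2) * (\<bar>\<omega>\<bar> ^ 0 * ?G + \<bar>\<omega>\<bar> ^ (n + 2) * ?G)"
      by (simp add: algebra_simps)
    also have "\<dots> \<le> 2 ^ (n + 2) * (\<tau> * M + \<tau> * M)"
    proof (intro mult_left_mono add_mono)
      note dec = decay[rule_format, OF g supp[rule_format] bd M]
      show "\<bar>\<omega>\<bar> ^ 0 * ?G \<le> \<tau> * M" by (rule dec) auto
      show "\<bar>\<omega>\<bar> ^ (n + 2) * ?G \<le> \<tau> * M" by (rule dec) auto
    qed auto
    also have "\<dots> = 2 ^ (n + 2) * (2 * \<tau>) * M" by (simp only: mult_2 ring_distribs mult.assoc)
    finally have G: "(1 + \<bar>\<omega>\<bar>) ^ (n + 2) * ?G \<le> 2 ^ (n + 2) * (2 * \<tau>) * M" .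
    have "norm (E (y, \<omega>) * partial_fourier g (y, \<omega>)) * (1 + \<omega>\<^sup>2) = norm (E (y, \<omega>)) * (1 + \<omega>\<^sup>2) * ?G"
      by (simp add: norm_mult)
    also have "\<dots> \<le> (\<bar>C0\<bar> * (1 + \<bar>\<omega>\<bar>) ^ n) * (1 + \<bar>\<omega>\<bar>)\<^sup>2 * ?G"
    proof (intro mult_right_mono mult_mono)
      have "norm (E (y, \<omega>)) \<le> C0 * (1 + \<bar>\<omega>\<bar>) ^ n" using C0 True by blast
      also have "\<dots> \<le> \<bar>C0\<bar> * (1 + \<bar>\<omega>\<bar>) ^ n" by (intro mult_right_mono) auto
      finally show "norm (E (y, \<omega>)) \<le> \<bar>C0\<bar> * (1 + \<bar>\<omega>\<bar>) ^ n" .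
      show "1 + \<omega>\<^sup>2 \<le> (1 + \<bar>\<omega>\<bar>)\<^sup>2" by (simp add: power2_sum)
    qed (use pos in auto)
    also have "\<dots> = \<bar>C0\<bar> * ((1 + \<bar>\<omega>\<bar>) ^ (n + 2) * ?G)" by (simp only: power_add mult.assoc)
    also have "\<dots> \<le> \<bar>C0\<bar> * (2 ^ (n + 2) * (2 * \<tau>) * M)" by (intro mult_left_mono G) auto
    also have "\<dots> = C * M" by (simp add: C_def mult.assoc)
    finally show ?thesis using pos True by (simp add: pos_le_divide_eq)
  qed
  moreover have "C \<ge> 0" using \<tau> by (simp add: C_def)
  ultimately show ?thesis by (intro exI[of _ "n + 2"] exI[of _ C]) blast
qed

lemma test_functionE:
  assumes "g \<in> test_functions U"
  obtains K where "smooth_on_open UNIV g" "compact K" "K \<subseteq> U" "\<And>z. z \<notin> K \<Longrightarrow> g z = 0"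
  using assms unfolding test_functions_def by blast

lemma smooth_derivs_bounded:
  fixes g :: "'a::euclidean_space \<Rightarrow> complex"
  assumes "smooth_on_open UNIV g" "compact K"
  shows "\<exists>M\<ge>0. derivs_bounded K N M g"
proof -
  have "\<exists>B. \<forall>x\<in>K. norm (iter_deriv hs g x) \<le> B" for hs
  proof -
    have "bounded (iter_deriv hs g ` K)"
      using smooth_imp_continuous_on[OF smooth_iter_deriv[OF assms(1)]] assms(2)
      by (intro compact_imp_bounded compact_continuous_image) (auto intro: continuous_on_subset)
    then show ?thesis unfolding bounded_iff by blast
  qed
  then obtain B where B: "\<And>hs x. x \<in> K \<Longrightarrow> norm (iter_deriv hs g x) \<le> B hs" by metis
  let ?H = "{hs :: 'a list. set hs \<subseteq> Basis \<and> length hs \<le> N}"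
  have "norm (iter_deriv hs g x) \<le> (\<Sum>hs\<in>?H. \<bar>B hs\<bar>)" if "hs \<in> ?H" "x \<in> K" for hs x
  proof -
    have "norm (iter_deriv hs g x) \<le> \<bar>B hs\<bar>" using B[OF that(2), of hs] by linarith
    also have "\<dots> \<le> (\<Sum>hs\<in>?H. \<bar>B hs\<bar>)"
      using that finite_multi_indices by (intro member_le_sum) auto
    finally show ?thesis .
  qed
  then show ?thesis
    unfolding derivs_bounded_def by (intro exI[of _ "\<Sum>hs\<in>?H. \<bar>B hs\<bar>"]) (auto intro: sum_nonneg)
qed

lemma continuous_on_vanishing_outside:
  assumes "open Y" "continuous_on Y f" "closed K" "K \<subseteq> Y" "\<And>x. x \<notin> K \<Longrightarrow> f x = 0"
  shows "continuous_on UNIV f"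
proof -
  have "continuous_on (- K) f"
    by (rule continuous_on_eq[OF continuous_on_const[where c = 0]]) (simp add: assms(5))
  then have "continuous_on (Y \<union> - K) f"
    using assms by (intro continuous_on_open_Un) (auto simp: open_Compl)
  moreover have "Y \<union> - K = UNIV" using assms(4) by blast
  ultimately show ?thesis by simp
qed

lemma pairing_integrand:
  fixes E :: "'y::euclidean_space \<times> real \<Rightarrow> complex"
  assumes Y: "open Y" and E: "polynomial_growth Y E" and g: "g \<in> test_functions (Y \<times> T)"
  obtains K C where "compact K" "C \<ge> 0" "continuous_on UNIV (\<lambda>z. E z * partial_fourier g z)"
    "\<And>y \<omega>. norm (E (y, \<omega>) * partial_fourier g (y, \<omega>)) \<le> C * indicator K y / (1 + \<omega>\<^sup>2)"
proof -
  obtain K where sm: "smooth_on_open UNIV g" and K: "compact K" "K \<subseteq> Y \<times> T"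
    and supp: "\<And>z. z \<notin> K \<Longrightarrow> g z = 0" using test_functionE[OF g] by metis
  have KY: "K \<subseteq> Y \<times> UNIV" using K by auto
  have fK: "compact (fst ` K)" using K by (intro compact_continuous_image continuous_intros)
  obtain N C where C: "C \<ge> 0" and bound: "\<forall>g M. smooth_on_open UNIV g \<longrightarrow> (\<forall>z. z \<notin> K \<longrightarrow> g z = 0) \<longrightarrow>
    derivs_bounded K N M g \<longrightarrow> M \<ge> 0 \<longrightarrow>
    (\<forall>y \<omega>. norm (E (y, \<omega>) * partial_fourier g (y, \<omega>)) \<le> (C * M) * indicator (fst ` K) y / (1 + \<omega>\<^sup>2))"
    using pairing_integrand_bound[OF E K(1) KY] by (elim exE conjE)
  obtain M where M: "M \<ge> 0" "derivs_bounded K N M g" using smooth_derivs_bounded[OF sm K(1)] by blast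
  have b: "norm (E (y, \<omega>) * partial_fourier g (y, \<omega>)) \<le> (C * M) * indicator (fst ` K) y / (1 + \<omega>\<^sup>2)" for y \<omega>
    using bound[rule_format, OF sm _ M(2,1)] supp by blast
  have "continuous_on UNIV (\<lambda>z. E z * partial_fourier g z)"
  proof (rule continuous_on_vanishing_outside)
    show "open (Y \<times> (UNIV :: real set))" using Y by (intro open_Times) auto
    show "continuous_on (Y \<times> UNIV) (\<lambda>z. E z * partial_fourier g z)"
      using E continuous_on_subset[OF partial_fourier_continuous[OF smooth_imp_continuous_on[OF sm] K(1) supp]]
      unfolding polynomial_growth_def by (intro continuous_on_mult) auto
    show "closed (fst ` K \<times> (UNIV :: real set))"
      by (rule closed_Times[OF compact_imp_closed[OF fK] closed_UNIV])
    show "fst ` K \<times> UNIV \<subseteq> Y \<times> (UNIV :: real set)" using K by auto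
    show "E z * partial_fourier g z = 0" if "z \<notin> fst ` K \<times> UNIV" for z
      using b[of "fst z" "snd z"] that by (cases z) auto
  qed
  then show thesis using that[OF fK _ _ b] C M by simp
qed

lemma pairing_bounded:
  fixes E :: "'y::euclidean_space \<times> real \<Rightarrow> complex"
  assumes Y: "open Y" and E: "polynomial_growth Y E" and K: "compact K" "K \<subseteq> Y \<times> T"
  shows "\<exists>N C. \<forall>g\<in>test_functions (Y \<times> T). \<forall>M. (\<forall>z. z \<notin> K \<longrightarrow> g z = 0) \<longrightarrow>
    derivs_bounded K N M g \<longrightarrow> norm (pairing E g) \<le> C * M"
proof (cases "K = {}")
  case True
  have "pairing E g = 0" if "\<forall>z. z \<notin> K \<longrightarrow> g z = 0" for g
    using that True by (simp add: pairing_def partial_fourier_def case_prod_unfold)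
  then show ?thesis by (intro exI[of _ 0] exI[of _ "0 :: real"]) auto
next
  case False
  have KY: "K \<subseteq> Y \<times> UNIV" using K by auto
  have fK: "compact (fst ` K)" using K by (intro compact_continuous_image continuous_intros)
  obtain N C where C: "C \<ge> 0" and bound: "\<forall>g M. smooth_on_open UNIV g \<longrightarrow> (\<forall>z. z \<notin> K \<longrightarrow> g z = 0) \<longrightarrow>
    derivs_bounded K N M g \<longrightarrow> M \<ge> 0 \<longrightarrow>
    (\<forall>y \<omega>. norm (E (y, \<omega>) * partial_fourier g (y, \<omega>)) \<le> (C * M) * indicator (fst ` K) y / (1 + \<omega>\<^sup>2))"
    using pairing_integrand_bound[OF E K(1) KY] by (elim exE conjE)
  let ?c = "(\<integral>\<omega>. 1 / (1 + (\<omega>::real)\<^sup>2) \<partial>lborel) * measure lborel (fst ` K)"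
  have "norm (pairing E g) \<le> (C * ?c) * M"
    if g: "g \<in> test_functions (Y \<times> T)" and supp: "\<forall>z. z \<notin> K \<longrightarrow> g z = 0" and bd: "derivs_bounded K N M g" for g M
  proof -
    have sm: "smooth_on_open UNIV g" using test_functionE[OF g] by metis
    obtain x where "x \<in> K" using False by blast
    then have "norm (iter_deriv [] g x) \<le> M" by (intro bd[unfolded derivs_bounded_def, rule_format]) auto
    then have M: "M \<ge> 0" using norm_ge_zero order.trans by blast
    have "continuous_on UNIV (\<lambda>z. E z * partial_fourier g z)"
      using pairing_integrand[OF Y E g] by metis
    then have meas: "(\<lambda>z. E z * partial_fourier g z) \<in> borel_measurable borel"
      by (rule borel_measurable_continuous_onI)
    have CM: "C * M \<ge> 0" using C M by simp
    from integral_over_quadratic_bound(5)[OF meas fK CM] bound[rule_format, OF sm _ bd M] supp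
    have "norm (pairing E g) \<le> C * M * (\<integral>\<omega>. 1 / (1 + (\<omega>::real)\<^sup>2) \<partial>lborel) * measure lborel (fst ` K)"
      unfolding pairing_def by simp
    then show ?thesis by (simp add: mult_ac)
  qed
  then show ?thesis by blast
qed

lemma test_functions_linear:
  assumes g: "g \<in> test_functions U" and h: "h \<in> test_functions U"
  shows "(\<lambda>x. g x + c * h x) \<in> test_functions U"
proof -
  obtain K where K: "smooth_on_open UNIV g" "compact K" "K \<subseteq> U" "\<And>z. z \<notin> K \<Longrightarrow> g z = 0"
    using test_functionE[OF g] by metis
  obtain L where L: "smooth_on_open UNIV h" "compact L" "L \<subseteq> U" "\<And>z. z \<notin> L \<Longrightarrow> h z = 0"
    using test_functionE[OF h] by metis
  have "smooth_on_open UNIV (\<lambda>x. g x + c * h x)"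
    by (intro smooth_intros K L open_UNIV)
  moreover have "compact (K \<union> L)" "K \<union> L \<subseteq> U" using K L by (auto intro: compact_Un)
  moreover have "\<forall>x. x \<notin> K \<union> L \<longrightarrow> g x + c * h x = 0" using K(4) L(4) by simp
  ultimately show ?thesis unfolding test_functions_def by blast
qed

lemma pairing_linear:
  fixes E :: "'y::euclidean_space \<times> real \<Rightarrow> complex"
  assumes Y: "open Y" and E: "polynomial_growth Y E"
    and g: "g \<in> test_functions (Y \<times> T)" and h: "h \<in> test_functions (Y \<times> T)"
  shows "pairing E (\<lambda>x. g x + c * h x) = pairing E g + c * pairing E h"
proof -
  have slice: "integrable lborel (\<lambda>t. f (y, t) * exp (\<i> * of_real (\<omega> * t)))"
    if "f \<in> test_functions (Y \<times> T)" for f y \<omega>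
  proof (rule test_functionE[OF that])
    fix K assume "smooth_on_open UNIV f" "compact K" "\<And>z. z \<notin> K \<Longrightarrow> f z = 0"
    then show ?thesis by (intro integrable_slice smooth_imp_continuous_on) auto
  qed
  have pf: "partial_fourier (\<lambda>x. g x + c * h x) z = partial_fourier g z + c * partial_fourier h z" for z
    using slice[OF g] slice[OF h] by (simp add: partial_fourier_def case_prod_unfold ring_distribs mult.assoc)
  have int: "integrable lborel (\<lambda>\<omega>. E (y, \<omega>) * partial_fourier f (y, \<omega>))"
    "integrable lborel (\<lambda>y. \<integral>\<omega>. E (y, \<omega>) * partial_fourier f (y, \<omega>) \<partial>lborel)"
    if f: "f \<in> test_functions (Y \<times> T)" for f y
  proof -
    obtain K C where K: "compact K" "C \<ge> 0" "continuous_on UNIV (\<lambda>z. E z * partial_fourier f z)"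
      and b: "\<And>y \<omega>. norm (E (y, \<omega>) * partial_fourier f (y, \<omega>)) \<le> C * indicator K y / (1 + \<omega>\<^sup>2)"
      using pairing_integrand[OF Y E f] by metis
    note quad = integral_over_quadratic_bound[OF borel_measurable_continuous_onI[OF K(3)] K(1,2) b]
    show "integrable lborel (\<lambda>\<omega>. E (y, \<omega>) * partial_fourier f (y, \<omega>))"
      "integrable lborel (\<lambda>y. \<integral>\<omega>. E (y, \<omega>) * partial_fourier f (y, \<omega>) \<partial>lborel)"
      using quad(1)[of y] quad(4) by simp_all
  qed
  have "pairing E (\<lambda>x. g x + c * h x) = (\<integral>y. (\<integral>\<omega>. E (y, \<omega>) * partial_fourier g (y, \<omega>) \<partial>lborel) +
      c * (\<integral>\<omega>. E (y, \<omega>) * partial_fourier h (y, \<omega>) \<partial>lborel) \<partial>lborel)"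
    unfolding pairing_def pf using int(1)[OF g] int(1)[OF h]
    by (simp add: ring_distribs mult.left_commute[of _ c])
  also have "\<dots> = pairing E g + c * pairing E h"
    unfolding pairing_def using int(2)[OF g] int(2)[OF h] by simp
  finally show ?thesis .
qed

lemma pairing_distribution:
  assumes "open Y" "polynomial_growth Y E"
    and "\<And>g. g \<in> test_functions (Y \<times> T) \<Longrightarrow> F g = pairing E g"
  shows "F \<in> distributions (Y \<times> T)"
  unfolding distributions_def
proof (intro CollectI conjI ballI allI impI)
  fix g h and c :: complex assume g: "g \<in> test_functions (Y \<times> T)" and h: "h \<in> test_functions (Y \<times> T)"
  then show "F (\<lambda>x. g x + c * h x) = F g + c * F h"
    using pairing_linear[OF assms(1,2) g h] by (simp add: assms(3) test_functions_linear)
next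
  fix K assume "compact K" "K \<subseteq> Y \<times> T"
  from pairing_bounded[OF assms(1,2) this]
  show "\<exists>N C. \<forall>g\<in>test_functions (Y \<times> T). \<forall>M. (\<forall>x. x \<notin> K \<longrightarrow> g x = 0) \<longrightarrow>
    derivs_bounded K N M g \<longrightarrow> norm (F g) \<le> C * M"
    by (simp add: assms(3))
qed

text \<open>The cutoff makes Fubini's theorem applicable; the integration in \<open>t\<close> then produces the Fourier
  transform of the test function at the frequency \<open>\<mu> \<theta>\<close>, and its decay dominates the amplitude
  uniformly in \<open>\<epsilon>\<close>.\<close>

lemma oscillatory_limit:
  fixes E :: "'y::euclidean_space \<times> real \<Rightarrow> complex" and \<mu> :: "real \<Rightarrow> real"
  assumes Y: "open Y" and E: "polynomial_growth Y E" and g: "g \<in> test_functions (Y \<times> T)"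
    and \<rho>: "\<rho> \<in> test_functions UNIV" "\<rho> 0 = 1"
    and \<mu>: "\<And>\<theta>. (\<mu> has_real_derivative \<mu>' \<theta>) (at \<theta>)" "continuous_on UNIV \<mu>'"
    and id: "\<And>\<theta>. \<bar>\<theta>\<bar> \<ge> R \<Longrightarrow> \<mu> \<theta> = \<theta>" "\<And>\<theta>. \<bar>\<theta>\<bar> > R \<Longrightarrow> \<mu>' \<theta> = 1" and R: "R \<ge> 0"
    and B: "\<And>\<theta>. \<bar>\<mu>' \<theta>\<bar> / (1 + (\<mu> \<theta>)\<^sup>2) \<le> B / (1 + \<theta>\<^sup>2)" "B \<ge> 0"
  shows "((\<lambda>\<epsilon>. \<integral>u. g u * (\<integral>\<theta>. \<rho> (\<epsilon> *\<^sub>R \<theta>) * (exp (\<i> * of_real (\<mu> \<theta> * snd u)) *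
      (of_real (\<mu>' \<theta>) * E (fst u, \<mu> \<theta>))) \<partial>lborel) \<partial>lborel) \<longlongrightarrow> pairing E g) (at_right 0)"
proof -
  obtain K where sm: "smooth_on_open UNIV g" and K: "compact K" "K \<subseteq> Y \<times> T"
    and supp: "\<And>z. z \<notin> K \<Longrightarrow> g z = 0" using test_functionE[OF g] by metis
  obtain K\<rho> where sm\<rho>: "smooth_on_open UNIV \<rho>" and K\<rho>: "compact K\<rho>" "\<And>\<theta>. \<theta> \<notin> K\<rho> \<Longrightarrow> \<rho> \<theta> = 0"
    using test_functionE[OF \<rho>(1)] by metis
  have cont_g: "continuous_on UNIV g" and cont_\<rho>: "continuous_on UNIV \<rho>"
    using sm sm\<rho> smooth_imp_continuous_on by blast+
  have cont_\<mu>: "continuous_on UNIV \<mu>"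
    using \<mu>(1) by (meson DERIV_continuous continuous_at_imp_continuous_on)
  obtain R0 where R0: "R0 \<ge> 0" "\<And>\<theta>. norm (\<rho> \<theta>) \<le> R0"
  proof -
    have "bounded (\<rho> ` K\<rho>)"
      using cont_\<rho> K\<rho> by (intro compact_imp_bounded compact_continuous_image) (auto intro: continuous_on_subset)
    then obtain b where "\<forall>z\<in>\<rho> ` K\<rho>. norm z \<le> b" unfolding bounded_iff by blast
    then have "norm (\<rho> \<theta>) \<le> max 0 b" for \<theta>
      using K\<rho>(2)[of \<theta>] by (cases "\<theta> \<in> K\<rho>") (auto simp: le_max_iff_disj)
    then show thesis by (intro that[of "max 0 b"]) simp_all
  qed
  define \<Phi> where "\<Phi> = (\<lambda>z. E z * partial_fourier g z)"
  obtain L C where L: "compact L" "C \<ge> 0" "continuous_on UNIV \<Phi>"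
    and \<Phi>: "\<And>y \<omega>. norm (\<Phi> (y, \<omega>)) \<le> C * indicator L y / (1 + \<omega>\<^sup>2)"
    using pairing_integrand[OF Y E g] unfolding \<Phi>_def by metis
  define J where "J = (\<lambda>\<epsilon> y \<theta>. \<rho> (\<epsilon> *\<^sub>R \<theta>) * (of_real (\<mu>' \<theta>) * \<Phi> (y, \<mu> \<theta>)))"
  have J_cont: "continuous_on UNIV (\<lambda>z. J \<epsilon> (fst z) (snd z))" for \<epsilon>
    unfolding J_def
    by (intro continuous_intros continuous_on_compose2[OF cont_\<rho>] continuous_on_compose2[OF \<mu>(2)]
        continuous_on_compose2[OF L(3)] continuous_on_compose2[OF cont_\<mu>]) auto
  have sub_bound: "norm (of_real (\<mu>' \<theta>) * \<Phi> (y, \<mu> \<theta>)) \<le> (C * B) * indicator L y / (1 + \<theta>\<^sup>2)" for y \<theta>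
  proof -
    have "norm (of_real (\<mu>' \<theta>) * \<Phi> (y, \<mu> \<theta>)) \<le> \<bar>\<mu>' \<theta>\<bar> * (C * indicator L y / (1 + (\<mu> \<theta>)\<^sup>2))"
      unfolding norm_mult norm_of_real using \<Phi> by (intro mult_left_mono) auto
    also have "\<dots> = C * indicator L y * (\<bar>\<mu>' \<theta>\<bar> / (1 + (\<mu> \<theta>)\<^sup>2))" by simp
    also have "\<dots> \<le> C * indicator L y * (B / (1 + \<theta>\<^sup>2))"
      using L(2) B(1) by (intro mult_left_mono) auto
    finally show ?thesis by (simp add: mult_ac)
  qed
  have J_bound: "norm (J \<epsilon> y \<theta>) \<le> (R0 * (C * B)) * indicator L y / (1 + \<theta>\<^sup>2)" for \<epsilon> y \<theta>
  proof -
    have "norm (J \<epsilon> y \<theta>) \<le> R0 * ((C * B) * indicator L y / (1 + \<theta>\<^sup>2))"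
      unfolding J_def norm_mult[of "\<rho> _"] using R0 sub_bound by (intro mult_mono) auto
    then show ?thesis by simp
  qed
  have J_nonneg: "R0 * (C * B) \<ge> 0" "C * B \<ge> 0" using R0 L(2) B(2) by simp_all
  have J_meas: "(\<lambda>z. J \<epsilon> (fst z) (snd z)) \<in> borel_measurable borel" for \<epsilon>
    by (rule borel_measurable_continuous_onI[OF J_cont])
  have J_bound': "norm (J \<epsilon> (fst (y, \<theta>)) (snd (y, \<theta>))) \<le> (R0 * (C * B)) * indicator L y / (1 + \<theta>\<^sup>2)" for \<epsilon> y \<theta>
    using J_bound by simp
  note J_quad = integral_over_quadratic_bound[OF J_meas L(1) J_nonneg(1) J_bound', simplified fst_conv snd_conv]
  have sub_cont: "continuous_on UNIV (\<lambda>z. of_real (\<mu>' (snd z)) * \<Phi> (fst z, \<mu> (snd z)))"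
    by (intro continuous_intros continuous_on_compose2[OF \<mu>(2)]
        continuous_on_compose2[OF L(3)] continuous_on_compose2[OF cont_\<mu>]) auto
  have sub_bound': "norm (of_real (\<mu>' (snd (y, \<theta>))) * \<Phi> (fst (y, \<theta>), \<mu> (snd (y, \<theta>)))) \<le>
      (C * B) * indicator L y / (1 + \<theta>\<^sup>2)" for y \<theta>
    using sub_bound by simp
  note sub_quad = integral_over_quadratic_bound[OF borel_measurable_continuous_onI[OF sub_cont] L(1)
      J_nonneg(2) sub_bound', simplified fst_conv snd_conv]
  have regularized: "(\<integral>u. g u * (\<integral>\<theta>. \<rho> (\<epsilon> *\<^sub>R \<theta>) * (exp (\<i> * of_real (\<mu> \<theta> * snd u)) *
      (of_real (\<mu>' \<theta>) * E (fst u, \<mu> \<theta>))) \<partial>lborel) \<partial>lborel) = (\<integral>y. (\<integral>\<theta>. J \<epsilon> y \<theta> \<partial>lborel) \<partial>lborel)"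
    if \<epsilon>: "\<epsilon> > 0" for \<epsilon>
  proof -
    define \<psi> where "\<psi> = (\<lambda>z. g (fst z) * (\<rho> (\<epsilon> *\<^sub>R snd z) * (exp (\<i> * of_real (\<mu> (snd z) * snd (fst z))) *
      (of_real (\<mu>' (snd z)) * E (fst (fst z), \<mu> (snd z))))))"
    have "(\<integral>u. g u * (\<integral>\<theta>. \<rho> (\<epsilon> *\<^sub>R \<theta>) * (exp (\<i> * of_real (\<mu> \<theta> * snd u)) *
      (of_real (\<mu>' \<theta>) * E (fst u, \<mu> \<theta>))) \<partial>lborel) \<partial>lborel) = (\<integral>u. (\<integral>\<theta>. \<psi> (u, \<theta>) \<partial>lborel) \<partial>lborel)"
      by (simp add: \<psi>_def)
    also have "\<dots> = (\<integral>y. (\<integral>\<theta>. (\<integral>t. \<psi> ((y, t), \<theta>) \<partial>lborel) \<partial>lborel) \<partial>lborel)"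
    proof (rule iterated_integral_swap)
      show "continuous_on UNIV \<psi>"
      proof (rule continuous_on_vanishing_outside)
        show "open ((Y \<times> (UNIV :: real set)) \<times> (UNIV :: real set))" using Y by (intro open_Times) auto
        have "continuous_on (Y \<times> UNIV) E" using E by (simp add: polynomial_growth_def)
        then show "continuous_on ((Y \<times> UNIV) \<times> UNIV) \<psi>"
          unfolding \<psi>_def
          by (intro continuous_intros continuous_on_compose2[OF cont_\<rho>] continuous_on_compose2[OF \<mu>(2)]
              continuous_on_compose2[OF cont_g] continuous_on_compose2[where f = "\<lambda>z. (fst (fst z), \<mu> (snd z))" and g = E]
              continuous_on_compose2[OF cont_\<mu>]) auto
        show "closed (K \<times> (UNIV :: real set))"
          by (rule closed_Times[OF compact_imp_closed[OF K(1)] closed_UNIV])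
        show "K \<times> UNIV \<subseteq> (Y \<times> UNIV) \<times> (UNIV :: real set)" using K by auto
        show "\<psi> z = 0" if "z \<notin> K \<times> UNIV" for z
          using that supp[of "fst z"] by (cases z) (auto simp: \<psi>_def)
      qed
      show "compact (K \<times> ((\<lambda>\<theta>. \<theta> /\<^sub>R \<epsilon>) ` K\<rho>))"
        using K K\<rho> by (intro compact_Times compact_continuous_image continuous_intros) auto
      show "\<psi> z = 0" if "z \<notin> K \<times> ((\<lambda>\<theta>. \<theta> /\<^sub>R \<epsilon>) ` K\<rho>)" for z
      proof (cases "fst z \<in> K")
        case True
        have "\<epsilon> *\<^sub>R snd z \<notin> K\<rho>"
        proof
          assume "\<epsilon> *\<^sub>R snd z \<in> K\<rho>"
          then have "(\<epsilon> *\<^sub>R snd z) /\<^sub>R \<epsilon> \<in> (\<lambda>\<theta>. \<theta> /\<^sub>R \<epsilon>) ` K\<rho>" by (rule imageI)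
          moreover have "(\<epsilon> *\<^sub>R snd z) /\<^sub>R \<epsilon> = snd z" using \<epsilon> by simp
          ultimately show False using that True by (simp only: mem_Times_iff simp_thms)
        qed
        then show ?thesis using K\<rho>(2) by (simp add: \<psi>_def)
      qed (simp add: \<psi>_def supp)
    qed
    also have "\<dots> = (\<integral>y. (\<integral>\<theta>. J \<epsilon> y \<theta> \<partial>lborel) \<partial>lborel)"
    proof -
      have "(\<integral>t. \<psi> ((y, t), \<theta>) \<partial>lborel) = J \<epsilon> y \<theta>" for y \<theta>
      proof -
        have "(\<integral>t. \<psi> ((y, t), \<theta>) \<partial>lborel) =
          (\<integral>t. (\<rho> (\<epsilon> *\<^sub>R \<theta>) * (of_real (\<mu>' \<theta>) * E (y, \<mu> \<theta>))) * (g (y, t) * exp (\<i> * of_real (\<mu> \<theta> * t))) \<partial>lborel)"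
          by (intro Bochner_Integration.integral_cong) (auto simp: \<psi>_def)
        also have "\<dots> = J \<epsilon> y \<theta>"
          unfolding Bochner_Integration.integral_mult_right_zero
          by (simp add: J_def \<Phi>_def partial_fourier_def)
        finally show ?thesis .
      qed
      then show ?thesis by simp
    qed
    finally show ?thesis .
  qed
  have "((\<lambda>\<epsilon>. \<integral>y. (\<integral>\<theta>. J \<epsilon> y \<theta> \<partial>lborel) \<partial>lborel) \<longlongrightarrow>
      (\<integral>y. (\<integral>\<theta>. of_real (\<mu>' \<theta>) * \<Phi> (y, \<mu> \<theta>) \<partial>lborel) \<partial>lborel)) (at_right 0)"
    unfolding tendsto_at_iff_sequentially o_def
  proof (intro allI impI)
    fix X :: "nat \<Rightarrow> real" assume X: "X \<longlonglongrightarrow> 0"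
    have inner: "(\<lambda>i. \<integral>\<theta>. J (X i) y \<theta> \<partial>lborel) \<longlonglongrightarrow> (\<integral>\<theta>. of_real (\<mu>' \<theta>) * \<Phi> (y, \<mu> \<theta>) \<partial>lborel)" for y
    proof (rule integral_dominated_convergence[where w = "\<lambda>\<theta>. (R0 * (C * B)) * indicator L y / (1 + \<theta>\<^sup>2)"])
      show "integrable lborel (\<lambda>\<theta>::real. (R0 * (C * B)) * indicator L y / (1 + \<theta>\<^sup>2))"
        using Bochner_Integration.integrable_mult_right[OF integrable_inverse_quadratic,
            of "(R0 * (C * B)) * indicator L y"] by simp
      show "AE \<theta> in lborel. (\<lambda>i. J (X i) y \<theta>) \<longlonglongrightarrow> of_real (\<mu>' \<theta>) * \<Phi> (y, \<mu> \<theta>)"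
      proof (rule AE_I2)
        fix \<theta> :: real
        have "isCont \<rho> 0" using cont_\<rho> by (simp add: continuous_on_eq_continuous_at)
        moreover have "(\<lambda>i. X i *\<^sub>R \<theta>) \<longlonglongrightarrow> 0" using tendsto_scaleR[OF X tendsto_const, of \<theta>] by simp
        ultimately have "(\<lambda>i. \<rho> (X i *\<^sub>R \<theta>)) \<longlonglongrightarrow> \<rho> 0" by (rule isCont_tendsto_compose)
        then show "(\<lambda>i. J (X i) y \<theta>) \<longlonglongrightarrow> of_real (\<mu>' \<theta>) * \<Phi> (y, \<mu> \<theta>)"
          using tendsto_mult[OF _ tendsto_const, of _ 1 _ "of_real (\<mu>' \<theta>) * \<Phi> (y, \<mu> \<theta>)"]
          by (simp add: J_def \<rho>(2))
      qed
    qed (use J_bound J_quad(1) sub_quad(1) borel_measurable_integrable in \<open>auto\<close>)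
    show "(\<lambda>i. \<integral>y. (\<integral>\<theta>. J (X i) y \<theta> \<partial>lborel) \<partial>lborel) \<longlonglongrightarrow>
        (\<integral>y. (\<integral>\<theta>. of_real (\<mu>' \<theta>) * \<Phi> (y, \<mu> \<theta>) \<partial>lborel) \<partial>lborel)"
    proof (rule integral_dominated_convergence)
      show "integrable lborel (\<lambda>y. (R0 * (C * B)) * indicator L y * (\<integral>\<omega>. 1 / (1 + (\<omega>::real)\<^sup>2) \<partial>lborel))"
        using emeasure_compact_finite[OF L(1)] L(1) by (simp add: borel_compact)
    qed (use J_quad(2,3) sub_quad(3) inner in auto)
  qed
  moreover have "(\<integral>\<theta>. of_real (\<mu>' \<theta>) * \<Phi> (y, \<mu> \<theta>) \<partial>lborel) = (\<integral>\<omega>. \<Phi> (y, \<omega>) \<partial>lborel)" for y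
  proof -
    have slice: "continuous_on UNIV (\<lambda>\<omega>. \<Phi> (y, \<omega>))"
      by (rule continuous_on_compose2[OF L(3)]) (auto intro!: continuous_intros)
    have int: "integrable lborel (\<lambda>\<omega>. \<Phi> (y, \<omega>))"
      by (rule integral_over_quadratic_bound(1)[OF borel_measurable_continuous_onI[OF L(3)] L(1,2) \<Phi>])
    have "integrable lborel (\<lambda>\<theta>. \<mu>' \<theta> *\<^sub>R \<Phi> (y, \<mu> \<theta>))"
      using sub_quad(1)[of y] by (simp add: scaleR_conv_of_real)
    from substitution_identity_at_infinity[OF slice int this \<mu> id R]
    show ?thesis by (simp add: scaleR_conv_of_real)
  qed
  ultimately have "((\<lambda>\<epsilon>. \<integral>y. (\<integral>\<theta>. J \<epsilon> y \<theta> \<partial>lborel) \<partial>lborel) \<longlongrightarrow> pairing E g) (at_right 0)"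
    by (simp add: pairing_def \<Phi>_def)
  then show ?thesis
    by (rule Lim_transform_eventually)
       (rule eventually_mono[OF eventually_at_right_less[of 0]], simp only: regularized)
qed


section \<open>Symbols\<close>

lemma iter_deriv_append: "iter_deriv (hs @ ks) f = iter_deriv hs (iter_deriv ks f)"
  by (induction hs) auto

lemma affine_frequency_derivative:
  fixes b :: "'u::euclidean_space \<times> 'v::euclidean_space \<Rightarrow> complex"
  assumes b: "smooth_on_open Z b" and z: "(u, v) \<in> Z"
  shows "frechet_derivative (\<lambda>(u, v, \<theta>::real). of_real (p + q * \<theta>) * b (u, v)) (at (u, v, \<theta>)) (k, l, d) =
    of_real (p + q * \<theta>) * frechet_derivative b (at (u, v)) (k, l) + of_real (q * d) * b (u, v)"
proof -
  have B: "((\<lambda>z. b (fst z, fst (snd z))) has_derivative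
      (\<lambda>h. frechet_derivative b (at (u, v)) (fst h, fst (snd h)))) (at (u, v, \<theta>))"
    by (rule has_derivative_compose[where f = "\<lambda>z. (fst z, fst (snd z))" and
          f' = "\<lambda>h. (fst h, fst (snd h))" and g = b])
       (use smooth_has_derivative[OF b z] in \<open>auto intro!: derivative_eq_intros\<close>)
  have P: "((\<lambda>z. complex_of_real (p + q * snd (snd z))) has_derivative
      (\<lambda>h. of_real (q * snd (snd h)))) (at (u, v, \<theta>))"
    by (intro has_derivative_of_real) (auto intro!: derivative_eq_intros)
  show ?thesis
    using frechet_derivative_at[OF has_derivative_mult[OF P B], symmetric]
    by (simp add: case_prod_unfold)
qed

lemma iter_deriv_affine_frequency:
  fixes b :: "'u::euclidean_space \<times> 'v::euclidean_space \<Rightarrow> complex"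
  assumes b: "smooth_on_open Z b" and z: "(u, v) \<in> Z"
  shows "iter_deriv (map (\<lambda>(k, l). (k, l, 0)) hs) (\<lambda>(u, v, \<theta>::real). of_real (p + q * \<theta>) * b (u, v)) (u, v, \<theta>) =
    of_real (p + q * \<theta>) * iter_deriv hs b (u, v)"
  using z
proof (induction hs arbitrary: u v \<theta>)
  case (Cons h hs)
  let ?F = "\<lambda>b (u, v, \<theta>::real). of_real (p + q * \<theta>) * b (u, v) :: complex"
  obtain k l where h: "h = (k, l)" by (cases h)
  have op: "open {(u, v, \<theta>::real). (u, v) \<in> Z}"
    by (rule open_phase_domain[OF smooth_imp_open[OF b]])
  have "frechet_derivative (iter_deriv (map (\<lambda>(k, l). (k, l, 0)) hs) (?F b)) (at (u, v, \<theta>)) =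
      frechet_derivative (?F (iter_deriv hs b)) (at (u, v, \<theta>))"
    by (rule frechet_derivative_cong_open[OF op]) (use Cons in auto)
  then show ?case
    using affine_frequency_derivative[OF smooth_iter_deriv[OF b] Cons.prems, of p q hs \<theta> k l 0]
    by (simp add: h)
qed simp

text \<open>Differentiating \<open>s \<theta> b\<close> in \<open>\<theta>\<close> lowers the degree in \<open>\<theta>\<close> by one each time, and gives \<open>0\<close> from the second
  derivative on.\<close>

lemma iter_deriv_linear_frequency:
  fixes b :: "'u::euclidean_space \<times> 'v::euclidean_space \<Rightarrow> complex"
  assumes b: "smooth_on_open Z b"
  shows "\<exists>p q. (ds = [] \<longrightarrow> p = 0 \<and> q = s) \<and> (\<forall>d. ds = [d] \<longrightarrow> p = s * d \<and> q = 0) \<and>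
    (length ds \<ge> 2 \<longrightarrow> p = 0 \<and> q = 0) \<and> (\<forall>u v \<theta>. (u, v) \<in> Z \<longrightarrow>
      iter_deriv (map (\<lambda>d. (0, 0, d)) ds) (\<lambda>(u, v, \<theta>::real). of_real (s * \<theta>) * b (u, v)) (u, v, \<theta>) =
        of_real (p + q * \<theta>) * b (u, v))"
proof (induction ds)
  case Nil
  show ?case by (intro exI[of _ 0] exI[of _ s]) simp
next
  case (Cons d ds)
  let ?F = "\<lambda>p q (u, v, \<theta>::real). of_real (p + q * \<theta>) * b (u, v) :: complex"
  let ?G = "\<lambda>(u, v, \<theta>::real). of_real (s * \<theta>) * b (u, v)"
  from Cons obtain p q where pq: "ds = [] \<longrightarrow> p = 0 \<and> q = s" "\<forall>d. ds = [d] \<longrightarrow> p = s * d \<and> q = 0"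
      "length ds \<ge> 2 \<longrightarrow> p = 0 \<and> q = 0"
    and IH: "\<forall>u v \<theta>. (u, v) \<in> Z \<longrightarrow> iter_deriv (map (\<lambda>d. (0, 0, d)) ds) ?G (u, v, \<theta>) = of_real (p + q * \<theta>) * b (u, v)"
    by (elim exE conjE)
  have op: "open {(u, v, \<theta>::real). (u, v) \<in> Z}"
    by (rule open_phase_domain[OF smooth_imp_open[OF b]])
  have "iter_deriv (map (\<lambda>d. (0, 0, d)) (d # ds)) ?G (u, v, \<theta>) = of_real (q * d + 0 * \<theta>) * b (u, v)"
    if z: "(u, v) \<in> Z" for u v \<theta>
  proof -
    have "frechet_derivative (iter_deriv (map (\<lambda>d. (0, 0, d)) ds) ?G) (at (u, v, \<theta>)) =
        frechet_derivative (?F p q) (at (u, v, \<theta>))"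
      by (rule frechet_derivative_cong_open[OF op]) (use IH z in auto)
    moreover have "frechet_derivative b (at (u, v)) (0, 0) = 0"
      using linear_0[OF linear_frechet_derivative[OF smooth_imp_differentiable[OF b z]]] by (simp add: zero_prod_def)
    ultimately show ?thesis
      using affine_frequency_derivative[OF b z, of p q \<theta> 0 0 d] by simp
  qed
  moreover have "d # ds = [d'] \<Longrightarrow> q * d = s * d'" "length (d # ds) \<ge> 2 \<Longrightarrow> q * d = 0" for d'
    using pq by (cases ds; cases "tl ds"; simp)+
  ultimately show ?case by (intro exI[of _ "q * d"] exI[of _ 0]) simp
qed

text \<open>On the compact set of low frequencies there is nothing to prove, and for high frequencies the
  amplitude is homogeneous of degree \<open>1\<close>.\<close>

lemma symbol_if_linear_at_infinity:
  fixes a :: "'u::euclidean_space \<times> 'v::euclidean_space \<times> real \<Rightarrow> complex"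
  assumes a: "smooth_on_open {(u, v, \<theta>). (u, v) \<in> Z} a" and b: "smooth_on_open Z b"
    and eq: "\<And>u v \<theta>. (u, v) \<in> Z \<Longrightarrow> \<bar>\<theta>\<bar> > 2 \<Longrightarrow> a (u, v, \<theta>) = of_real \<bar>\<theta>\<bar> * b (u, v)"
  shows "symbol Z 1 a"
  unfolding symbol_def
proof (intro conjI a allI impI)
  fix K :: "('u \<times> 'v) set" and \<alpha>s :: "('u \<times> 'v) list" and \<beta>s :: "real list"
  assume K: "compact K" "K \<subseteq> Z"
  let ?\<alpha> = "map (\<lambda>(k, l). (k, l, 0)) \<alpha>s" and ?\<beta> = "map (\<lambda>d. (0, 0, d)) \<beta>s"
  let ?l = "real (length \<beta>s)"
  have op: "open Z" by (rule smooth_imp_open[OF b])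
  obtain B1 where B1: "\<And>u v \<theta>. (u, v) \<in> K \<Longrightarrow> \<bar>\<theta>\<bar> \<le> 3 \<Longrightarrow> norm (iter_deriv (?\<alpha> @ ?\<beta>) a (u, v, \<theta>)) \<le> B1"
  proof -
    let ?c = "\<lambda>z :: ('u \<times> 'v) \<times> real. (fst (fst z), snd (fst z), snd z)"
    have "continuous_on (?c ` (K \<times> {-3..3})) (iter_deriv (?\<alpha> @ ?\<beta>) a)"
      by (rule continuous_on_subset[OF smooth_imp_continuous_on[OF smooth_iter_deriv[OF a]]]) (use K in auto)
    then have "bounded (iter_deriv (?\<alpha> @ ?\<beta>) a ` ?c ` (K \<times> {-3..3}))"
      by (intro compact_imp_bounded compact_continuous_image compact_Times K continuous_intros) auto
    then obtain B where "\<forall>z\<in>iter_deriv (?\<alpha> @ ?\<beta>) a ` ?c ` (K \<times> {-3..3}). norm z \<le> B"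
      unfolding bounded_iff by blast
    then have "norm (iter_deriv (?\<alpha> @ ?\<beta>) a (u, v, \<theta>)) \<le> B" if "(u, v) \<in> K" "\<bar>\<theta>\<bar> \<le> 3" for u v \<theta>
      using that by (auto simp: image_image abs_le_iff dest!: bspec[where x = "((u, v), \<theta>)"])
    then show thesis by (rule that)
  qed
  obtain B2 where B2: "\<And>u v. (u, v) \<in> K \<Longrightarrow> norm (iter_deriv \<alpha>s b (u, v)) \<le> B2"
  proof -
    have "bounded (iter_deriv \<alpha>s b ` K)"
      using continuous_on_subset[OF smooth_imp_continuous_on[OF smooth_iter_deriv[OF b]] K(2)]
      by (intro compact_imp_bounded compact_continuous_image K)
    then show thesis using that unfolding bounded_iff by blast
  qed
  define S where "S = 1 + (\<Sum>d\<leftarrow>\<beta>s. \<bar>d\<bar>)"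
  have S: "S \<ge> 1" unfolding S_def by (auto intro!: sum_list_nonneg)
  define C where "C = \<bar>B1\<bar> * 4 powr ?l + S * \<bar>B2\<bar>"
  have C: "\<bar>B1\<bar> * 4 powr ?l \<le> C" "S * \<bar>B2\<bar> \<le> C" using S by (simp_all add: C_def)
  have "norm (iter_deriv (?\<alpha> @ ?\<beta>) a (u, v, \<theta>)) \<le> C * (1 + norm \<theta>) powr (1 - ?l)"
    if uv: "(u, v) \<in> K" for u v \<theta>
  proof (cases "\<bar>\<theta>\<bar> \<le> 3")
    case True
    have "4 powr (- ?l) \<le> (1 + norm \<theta>) powr (- ?l)"
      using True by (intro powr_mono2') auto
    also have "\<dots> \<le> (1 + norm \<theta>) powr (1 - ?l)" by (intro powr_mono) auto
    finally have p: "4 powr (- ?l) \<le> (1 + norm \<theta>) powr (1 - ?l)" .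
    have "norm (iter_deriv (?\<alpha> @ ?\<beta>) a (u, v, \<theta>)) \<le> \<bar>B1\<bar>" using B1[OF uv True] by linarith
    also have "\<dots> = (\<bar>B1\<bar> * 4 powr ?l) * 4 powr (- ?l)" by (simp add: powr_minus)
    also have "\<dots> \<le> C * (1 + norm \<theta>) powr (1 - ?l)"
      using C p S by (intro mult_mono) (auto simp: C_def)
    finally show ?thesis .
  next
    case False
    define s where "s = sgn \<theta>"
    let ?O = "{(u, v, \<theta>). (u, v) \<in> Z} \<inter> {z :: 'u \<times> 'v \<times> real. s * snd (snd z) > 2}"
    have opO: "open ?O"
      by (intro open_Int open_phase_domain op open_Collect_less continuous_intros)
    have z: "(u, v) \<in> Z" using uv K by blast
    have s: "s * \<theta> = \<bar>\<theta>\<bar>" "\<bar>s\<bar> = 1" using False by (auto simp: s_def abs_sgn sgn_if mult.commute)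
    have inO: "(u, v, \<theta>) \<in> ?O" using z s False by auto
    have abs: "\<bar>\<theta>'\<bar> = s * \<theta>'" if "s * \<theta>' > 2" for \<theta>'
      using that s(2) by (auto simp: abs_if split: if_splits)
    obtain p q where pq: "\<beta>s = [] \<longrightarrow> p = 0 \<and> q = s" "\<forall>d. \<beta>s = [d] \<longrightarrow> p = s * d \<and> q = 0"
        "length \<beta>s \<ge> 2 \<longrightarrow> p = 0 \<and> q = 0"
      and lin: "\<forall>u v \<theta>. (u, v) \<in> Z \<longrightarrow> iter_deriv ?\<beta> (\<lambda>(u, v, \<theta>). of_real (s * \<theta>) * b (u, v)) (u, v, \<theta>) =
        of_real (p + q * \<theta>) * b (u, v)"
      using iter_deriv_linear_frequency[OF b, of \<beta>s s] by (elim exE conjE)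
    have "iter_deriv ?\<beta> a z = (\<lambda>(u, v, \<theta>). of_real (p + q * \<theta>) * b (u, v)) z" if z: "z \<in> ?O" for z
    proof -
      have "iter_deriv ?\<beta> a z = iter_deriv ?\<beta> (\<lambda>(u, v, \<theta>). of_real (s * \<theta>) * b (u, v)) z"
        by (rule iter_deriv_cong_open[OF opO _ z]) (use eq abs in auto)
      then show ?thesis using lin z by auto
    qed
    then have "iter_deriv (?\<alpha> @ ?\<beta>) a (u, v, \<theta>) =
        iter_deriv ?\<alpha> (\<lambda>(u, v, \<theta>). of_real (p + q * \<theta>) * b (u, v)) (u, v, \<theta>)"
      unfolding iter_deriv_append by (rule iter_deriv_cong_open[OF opO _ inO])
    also have "\<dots> = of_real (p + q * \<theta>) * iter_deriv \<alpha>s b (u, v)"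
      by (rule iter_deriv_affine_frequency[OF b z])
    finally have "norm (iter_deriv (?\<alpha> @ ?\<beta>) a (u, v, \<theta>)) = \<bar>p + q * \<theta>\<bar> * norm (iter_deriv \<alpha>s b (u, v))"
      by (simp add: norm_mult del: of_real_add of_real_mult)
    also have "\<dots> \<le> (S * (1 + norm \<theta>) powr (1 - ?l)) * \<bar>B2\<bar>"
    proof (intro mult_mono)
      show "norm (iter_deriv \<alpha>s b (u, v)) \<le> \<bar>B2\<bar>" using B2[OF uv] by linarith
      consider "\<beta>s = []" | d where "\<beta>s = [d]" | "length \<beta>s \<ge> 2"
        by (cases \<beta>s; cases "tl \<beta>s") auto
      then show "\<bar>p + q * \<theta>\<bar> \<le> S * (1 + norm \<theta>) powr (1 - ?l)"
      proof cases
        case 1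
        then show ?thesis using pq(1) s by (simp add: S_def)
      next
        case 2
        moreover have "1 + \<bar>\<theta>\<bar> \<noteq> 0" using abs_ge_zero[of \<theta>] by linarith
        ultimately show ?thesis using pq(2) s by (simp add: S_def abs_mult)
      next
        case 3
        then show ?thesis using pq(3) S by simp
      qed
    qed (use S in auto)
    also have "\<dots> = (S * \<bar>B2\<bar>) * (1 + norm \<theta>) powr (1 - ?l)" by simp
    also have "\<dots> \<le> C * (1 + norm \<theta>) powr (1 - ?l)" by (intro mult_right_mono C) auto
    finally show ?thesis .
  qed
  then show "\<exists>C. \<forall>u v \<theta>. (u, v) \<in> K \<longrightarrow>
      norm (iter_deriv (?\<alpha> @ ?\<beta>) a (u, v, \<theta>)) \<le> C * (1 + norm \<theta>) powr (1 - real (length \<beta>s))"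
    by blast
qed

section \<open>The Radon transform\<close>

text \<open>The given amplitude is not smooth at \<open>\<omega> = 0\<close>. This amplitude is made so that its product with the
  exponential of the phase is the original integrand after the substitution of the flattened
  frequency for \<open>\<omega>\<close>; it is smooth, it agrees with the given amplitude for \<open>\<bar>\<theta>\<bar> > 2\<close>, and it defines
  exactly the same operator, so that no smooth error in the kernel arises.\<close>

definition flattened_amplitude :: "'m::finite option \<Rightarrow> 'm \<Rightarrow>
    ((real ^ 'm) \<times> real) \<times> (real ^ 'm option) \<times> real \<Rightarrow> complex" where
  "flattened_amplitude k \<iota> = (\<lambda>((y, t), x, \<theta>).
     exp (\<i> * of_real ((flattened \<theta> - \<theta>) * (t - sqform (signature_matrix k) (x - centre \<iota> y)))) *
     of_real (\<bar>flattened \<theta>\<bar> * flattened' \<theta> * (2 * norm (x - centre \<iota> y))))"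

lemma symbol_flattened_amplitude: "symbol (off_axis \<iota>) 1 (flattened_amplitude k \<iota>)"
proof (rule symbol_if_linear_at_infinity)
  let ?W = "{(u, v, \<theta>::real). (u, v) \<in> off_axis \<iota>}"
  have op: "open ?W" by (rule open_phase_domain[OF open_off_axis])
  have \<theta>: "smooth_on_open ?W (\<lambda>p. snd (snd p))" by (intro smooth_intros op)
  have flat: "smooth_on_open ?W (\<lambda>p. flattened (snd (snd p)))"
    "smooth_on_open ?W (\<lambda>p. flattened' (snd (snd p)))" "smooth_on_open ?W (\<lambda>p. \<bar>flattened (snd (snd p))\<bar>)"
    by (rule smooth_compose[OF smooth_flattened \<theta>] smooth_compose[OF smooth_flattened' \<theta>]
        smooth_compose[OF smooth_abs_flattened \<theta>], simp)+
  have ne: "fst (snd p) - centre \<iota> (fst (fst p)) \<noteq> 0" if "p \<in> ?W" for p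
    using that zero_in_axis_line[of \<iota>] by (auto simp: off_axis_def)
  have "smooth_on_open ?W (\<lambda>p. exp (\<i> * of_real ((flattened (snd (snd p)) - snd (snd p)) *
      (snd (fst p) - sqform (signature_matrix k) (fst (snd p) - centre \<iota> (fst (fst p)))))) *
     of_real (\<bar>flattened (snd (snd p))\<bar> * flattened' (snd (snd p)) *
       (2 * norm (fst (snd p) - centre \<iota> (fst (fst p))))))"
    by (intro smooth_intros op flat ne) (auto simp: off_axis_def)
  then show "smooth_on_open ?W (flattened_amplitude k \<iota>)"
    by (rule smooth_cong) (auto simp: flattened_amplitude_def)
  have "smooth_on_open (off_axis \<iota>) (displacement \<iota>)"
    by (rule smooth_subset[OF smooth_displacement open_off_axis]) (auto simp: off_axis_def)
  then show "smooth_on_open (off_axis \<iota>) (\<lambda>p. of_real (2 * norm (displacement \<iota> p)))"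
    using zero_in_axis_line[of \<iota>]
    by (intro smooth_intros open_off_axis) (auto simp: off_axis_def)
  show "flattened_amplitude k \<iota> (u, v, \<theta>) = of_real \<bar>\<theta>\<bar> * of_real (2 * norm (displacement \<iota> (u, v)))"
    if "\<bar>\<theta>\<bar> > 2" for u v \<theta>
    using that by (cases u) (simp add: flattened_amplitude_def flattened_high flattened'_high)
qed

lemma radon_amplitude_eq:
  assumes "y \<in> Omega \<iota>"
  shows "radon_amplitude (signature_matrix k) \<iota> ((y, t), x, \<omega>) = of_real (\<bar>\<omega>\<bar> * (2 * norm (x - centre \<iota> y)))"
  unfolding radon_amplitude_def prod.case grad_eqI[OF radon_phase_partial_derivatives(2)[OF assms]]
  by (simp add: abs_mult)

text \<open>The phase depends on \<open>t\<close> only through the factor \<open>e\<^sup>i\<^sup>\<omega>\<^sup>t\<close>, which can be taken out of the distribution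
  together with \<open>\<bar>\<omega>\<bar>\<close>. What remains is a function of the base point and the frequency.\<close>

definition frequency_profile :: "'m::finite option \<Rightarrow> 'm \<Rightarrow> ((real ^ 'm option \<Rightarrow> complex) \<Rightarrow> complex) \<Rightarrow>
    (real ^ 'm) \<times> real \<Rightarrow> complex" where
  "frequency_profile k \<iota> f = (\<lambda>(y, \<omega>). of_real \<bar>\<omega>\<bar> *
     f (\<lambda>x. exp (- (\<i> * of_real (\<omega> * sqform (signature_matrix k) (x - centre \<iota> y)))) *
       of_real (2 * norm (x - centre \<iota> y))))"

definition off_centre :: "'m::finite \<Rightarrow> ((real ^ 'm) \<times> (real ^ 'm option)) set" where
  "off_centre \<iota> = {(y, x). y \<in> Omega \<iota> \<and> x \<noteq> centre \<iota> y}"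

lemma open_off_centre: "open (off_centre \<iota>)"
proof -
  have "open ((Omega \<iota> \<times> UNIV) \<inter> (\<lambda>p. snd p - centre \<iota> (fst p)) -` (- {0}))"
    by (intro continuous_open_preimage continuous_intros open_Times open_Omega open_UNIV
        continuous_on_compose2[OF smooth_imp_continuous_on[OF smooth_centre]]) auto
  moreover have "off_centre \<iota> = (Omega \<iota> \<times> UNIV) \<inter> (\<lambda>p. snd p - centre \<iota> (fst p)) -` (- {0})"
    by (auto simp: off_centre_def)
  ultimately show ?thesis by simp
qed

lemma smooth_off_centre:
  "smooth_on_open (off_centre \<iota>) (\<lambda>p. sqform (signature_matrix k) (snd p - centre \<iota> (fst p)))"
  "smooth_on_open (off_centre \<iota>) (\<lambda>p. complex_of_real (2 * norm (snd p - centre \<iota> (fst p))))"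
  by (intro smooth_intros open_off_centre; auto simp: off_centre_def)+

text \<open>The complement of the half-cylinder need not be open, but a distribution supported in it is also
  supported away from the centres over a given compact set of base points.\<close>

lemma compact_centres:
  assumes "compact K" "K \<subseteq> Omega \<iota>"
  shows "open (- centre \<iota> ` K)" "- half_cylinder \<iota> \<subseteq> - centre \<iota> ` K" "K \<times> (- centre \<iota> ` K) \<subseteq> off_centre \<iota>"
proof -
  have "compact (centre \<iota> ` K)"
    by (rule compact_continuous_image[OF continuous_on_subset[OF smooth_imp_continuous_on[OF smooth_centre] assms(2)] assms(1)])
  then show "open (- centre \<iota> ` K)" by (simp add: compact_imp_closed open_Compl)
  show "- half_cylinder \<iota> \<subseteq> - centre \<iota> ` K" "K \<times> (- centre \<iota> ` K) \<subseteq> off_centre \<iota>"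
    using assms(2) by (auto simp: half_cylinder_def off_centre_def)
qed

lemma frequency_profile_growth:
  assumes f: "f \<in> compact_distributions (- half_cylinder \<iota>)"
  shows "polynomial_growth (Omega \<iota>) (frequency_profile k \<iota> f)"
  unfolding polynomial_growth_def
proof (intro conjI allI impI)
  let ?H = "\<lambda>p. f (\<lambda>x. exp (- (\<i> * of_real (snd p * sqform (signature_matrix k) (x - centre \<iota> (fst p))))) *
       of_real (2 * norm (x - centre \<iota> (fst p))))"
  have "isCont ?H p0" if p0: "p0 \<in> Omega \<iota> \<times> UNIV" for p0
  proof -
    obtain r where r: "r > 0" "cball (fst p0) r \<subseteq> Omega \<iota>"
      using p0 open_Omega[of \<iota>] open_contains_cball by (metis mem_Times_iff)
    note W = compact_centres[OF compact_cball r(2)]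
    let ?Z = "{z. (fst (fst z), snd z) \<in> off_centre \<iota>}"
    have opZ: "open ?Z"
    proof -
      have "open ((\<lambda>z. (fst (fst z), snd z)) -` off_centre \<iota>)"
        by (intro open_vimage open_off_centre continuous_intros)
      then show ?thesis by (simp add: vimage_def)
    qed
    have "smooth_on_open ?Z (\<lambda>z. exp (- (\<i> * of_real (snd (fst z) *
        sqform (signature_matrix k) (snd z - centre \<iota> (fst (fst z)))))) * of_real (2 * norm (snd z - centre \<iota> (fst (fst z)))))"
      by (intro smooth_intros opZ) (auto simp: off_centre_def)
    from distribution_family_continuous[OF f this, of "ball (fst p0) r \<times> UNIV" p0 "- centre \<iota> ` cball (fst p0) r"]
    show ?thesis
      using W r p0 by (auto simp: open_Times mem_Times_iff subset_iff)
  qed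
  then have "continuous_on (Omega \<iota> \<times> UNIV) ?H"
    by (intro continuous_at_imp_continuous_on) blast
  then have "continuous_on (Omega \<iota> \<times> UNIV) (\<lambda>p. of_real \<bar>snd p\<bar> * ?H p)"
    by (intro continuous_intros)
  then show "continuous_on (Omega \<iota> \<times> UNIV) (frequency_profile k \<iota> f)"
    by (simp add: frequency_profile_def case_prod_unfold)
next
  fix K assume K: "compact K" "K \<subseteq> Omega \<iota>"
  from distribution_oscillation_growth[OF f smooth_off_centre(1)[where k = k] smooth_off_centre(2) K(1) compact_centres[OF K]]
  obtain C n where C: "\<forall>y\<in>K. \<forall>\<omega>. norm (f (\<lambda>x. exp (- (\<i> * of_real (\<omega> * sqform (signature_matrix k) (x - centre \<iota> y)))) *
       of_real (2 * norm (x - centre \<iota> y)))) \<le> C * (1 + \<bar>\<omega>\<bar>) ^ n" by auto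
  have "norm (frequency_profile k \<iota> f (y, \<omega>)) \<le> C * (1 + \<bar>\<omega>\<bar>) ^ Suc n" if "y \<in> K" for y \<omega>
  proof -
    have "norm (frequency_profile k \<iota> f (y, \<omega>)) \<le> (1 + \<bar>\<omega>\<bar>) * (C * (1 + \<bar>\<omega>\<bar>) ^ n)"
      unfolding frequency_profile_def prod.case norm_mult
      using C that by (intro mult_mono) auto
    then show ?thesis by (simp add: mult_ac)
  qed
  then show "\<exists>C n. \<forall>y\<in>K. \<forall>\<omega>. norm (frequency_profile k \<iota> f (y, \<omega>)) \<le> C * (1 + \<bar>\<omega>\<bar>) ^ n" by blast
qed

lemma smooth_near_oscillation:
  assumes "y \<in> Omega \<iota>"
  shows "smooth_near (- half_cylinder \<iota>) (\<lambda>x. exp (- (\<i> * of_real (\<omega> * sqform (signature_matrix k) (x - centre \<iota> y)))) *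
       of_real (2 * norm (x - centre \<iota> y)))"
proof (rule smooth_nearI)
  show "smooth_on_open (- {centre \<iota> y}) (\<lambda>x. exp (- (\<i> * of_real (\<omega> * sqform (signature_matrix k) (x - centre \<iota> y)))) *
       of_real (2 * norm (x - centre \<iota> y)))"
    by (intro smooth_intros) (auto simp: open_Compl)
  show "- half_cylinder \<iota> \<subseteq> - {centre \<iota> y}" using assms by (auto simp: half_cylinder_def)
qed

text \<open>Both amplitudes, the given one (\<open>\<mu> \<theta> = \<theta>\<close>) and the flattened one, arise from the same profile
  by the substitution \<open>\<omega> = \<mu> \<theta>\<close>.\<close>

lemma osc_pairing_profile:
  assumes f: "f \<in> compact_distributions (- half_cylinder \<iota>)" and g: "g \<in> test_functions (Omega \<iota> \<times> {0<..})"
    and a: "\<And>y t x \<theta>. y \<in> Omega \<iota> \<Longrightarrow> exp (\<i> * of_real (radon_phase (signature_matrix k) \<iota> ((y, t), x, \<theta>))) * a ((y, t), x, \<theta>) =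
      (exp (\<i> * of_real (\<mu> \<theta> * t)) * of_real (\<mu>' \<theta>) * of_real \<bar>\<mu> \<theta>\<bar>) *
      (exp (- (\<i> * of_real (\<mu> \<theta> * sqform (signature_matrix k) (x - centre \<iota> y)))) * of_real (2 * norm (x - centre \<iota> y)))"
    and \<mu>: "\<And>\<theta>. (\<mu> has_real_derivative \<mu>' \<theta>) (at \<theta>)" "continuous_on UNIV \<mu>'"
    and id: "\<And>\<theta>. \<bar>\<theta>\<bar> \<ge> R \<Longrightarrow> \<mu> \<theta> = \<theta>" "\<And>\<theta>. \<bar>\<theta>\<bar> > R \<Longrightarrow> \<mu>' \<theta> = 1" and R: "R \<ge> 0"
    and B: "\<And>\<theta>. \<bar>\<mu>' \<theta>\<bar> / (1 + (\<mu> \<theta>)\<^sup>2) \<le> B / (1 + \<theta>\<^sup>2)" "B \<ge> 0"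
  shows "osc_pairing (radon_phase (signature_matrix k) \<iota>) a f g (pairing (frequency_profile k \<iota> f) g)"
  unfolding osc_pairing_def
proof (intro ballI impI)
  fix \<rho> :: "real \<Rightarrow> complex" assume \<rho>: "\<rho> \<in> test_functions UNIV" "\<rho> 0 = 1"
  have regularized: "g u * osc_regularized (radon_phase (signature_matrix k) \<iota>) a \<rho> \<epsilon> f u =
      g u * (\<integral>\<theta>. \<rho> (\<epsilon> *\<^sub>R \<theta>) * (exp (\<i> * of_real (\<mu> \<theta> * snd u)) *
        (of_real (\<mu>' \<theta>) * frequency_profile k \<iota> f (fst u, \<mu> \<theta>))) \<partial>lborel)" for u \<epsilon>
  proof (cases "fst u \<in> Omega \<iota>")
    case False
    then have "g u = 0" using g by (cases u) (auto elim!: test_functionE)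
    then show ?thesis by simp
  next
    case True
    obtain y t where u: "u = (y, t)" and y: "y \<in> Omega \<iota>" using True by (cases u) auto
    have "f (\<lambda>x. exp (\<i> * of_real (radon_phase (signature_matrix k) \<iota> (u, x, \<theta>))) * a (u, x, \<theta>)) =
        exp (\<i> * of_real (\<mu> \<theta> * t)) * (of_real (\<mu>' \<theta>) * frequency_profile k \<iota> f (y, \<mu> \<theta>))" for \<theta>
      unfolding u a[OF y] distribution_scale[OF f smooth_near_oscillation[OF y]]
      by (simp add: frequency_profile_def)
    then show ?thesis by (simp add: osc_regularized_def u)
  qed
  show "((\<lambda>\<epsilon>. \<integral>u. g u * osc_regularized (radon_phase (signature_matrix k) \<iota>) a \<rho> \<epsilon> f u \<partial>lborel) \<longlongrightarrow>
      pairing (frequency_profile k \<iota> f) g) (at_right 0)"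
    unfolding regularized
    by (rule oscillatory_limit[OF open_Omega frequency_profile_growth[OF f] g \<rho> \<mu> id R B])
qed

lemma osc_pairing_radon_amplitude:
  assumes "f \<in> compact_distributions (- half_cylinder \<iota>)" "g \<in> test_functions (Omega \<iota> \<times> {0<..})"
  shows "osc_pairing (radon_phase (signature_matrix k) \<iota>) (radon_amplitude (signature_matrix k) \<iota>) f g
    (pairing (frequency_profile k \<iota> f) g)"
proof (rule osc_pairing_profile[OF assms, where \<mu> = "\<lambda>\<theta>. \<theta>" and \<mu>' = "\<lambda>\<theta>. 1" and R = 0 and B = 1])
  fix y t x \<theta> assume "y \<in> Omega \<iota>"
  then show "exp (\<i> * of_real (radon_phase (signature_matrix k) \<iota> ((y, t), x, \<theta>))) *
      radon_amplitude (signature_matrix k) \<iota> ((y, t), x, \<theta>) =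
    (exp (\<i> * of_real (\<theta> * t)) * of_real 1 * of_real \<bar>\<theta>\<bar>) *
      (exp (- (\<i> * of_real (\<theta> * sqform (signature_matrix k) (x - centre \<iota> y)))) * of_real (2 * norm (x - centre \<iota> y)))"
    by (simp add: radon_amplitude_eq radon_phase_eq exp_diff exp_minus divide_inverse ring_distribs mult_ac)
qed auto

lemma osc_pairing_flattened_amplitude:
  assumes "f \<in> compact_distributions (- half_cylinder \<iota>)" "g \<in> test_functions (Omega \<iota> \<times> {0<..})"
  shows "osc_pairing (radon_phase (signature_matrix k) \<iota>) (flattened_amplitude k \<iota>) f g
    (pairing (frequency_profile k \<iota> f) g)"
proof -
  obtain B where B: "B \<ge> 0" "\<And>\<theta>. \<bar>flattened' \<theta>\<bar> / (1 + (flattened \<theta>)\<^sup>2) \<le> B / (1 + \<theta>\<^sup>2)"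
    using flattened_jacobian_bound by blast
  show ?thesis
  proof (rule osc_pairing_profile[OF assms _ flattened_has_derivative
        smooth_imp_continuous_on[OF smooth_flattened'] flattened_high flattened'_high _ B(2,1)])
    fix y t x \<theta>
    let ?s = "sqform (signature_matrix k) (x - centre \<iota> y)"
    have "exp (\<i> * of_real (\<theta> * (t - ?s))) * exp (\<i> * of_real ((flattened \<theta> - \<theta>) * (t - ?s))) =
        exp (\<i> * of_real (flattened \<theta> * t)) * exp (- (\<i> * of_real (flattened \<theta> * ?s)))"
      unfolding exp_add[symmetric] by (simp add: algebra_simps)
    then show "exp (\<i> * of_real (radon_phase (signature_matrix k) \<iota> ((y, t), x, \<theta>))) *
        flattened_amplitude k \<iota> ((y, t), x, \<theta>) =
      (exp (\<i> * of_real (flattened \<theta> * t)) * of_real (flattened' \<theta>) * of_real \<bar>flattened \<theta>\<bar>) *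
        (exp (- (\<i> * of_real (flattened \<theta> * ?s))) * of_real (2 * norm (x - centre \<iota> y)))"
      unfolding radon_phase_eq flattened_amplitude_def prod.case mult.assoc[symmetric]
      by (simp add: mult_ac)
    show "(0 :: real) \<le> 2" by simp
  qed
qed

lemma osc_pairing_unique:
  fixes \<phi> :: "'u::euclidean_space \<times> 'v \<times> real \<Rightarrow> real"
  assumes "osc_pairing \<phi> a f g L" "osc_pairing \<phi> a f g L'"
  shows "L = L'"
proof -
  have one: "complex_of_real (1 - high_pass 0) = 1" by (simp add: high_pass_low)
  show ?thesis
    using tendsto_unique[OF trivial_limit_at_right_real
        assms(1)[unfolded osc_pairing_def, rule_format, OF low_pass_test_function one]
        assms(2)[unfolded osc_pairing_def, rule_format, OF low_pass_test_function one]] .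
qed

lemma radon_eq_pairing:
  assumes "f \<in> compact_distributions (- half_cylinder \<iota>)" "g \<in> test_functions (Omega \<iota> \<times> {0<..})"
  shows "radon (signature_matrix k) \<iota> f g = pairing (frequency_profile k \<iota> f) g"
  unfolding radon_def
  using osc_pairing_radon_amplitude[OF assms] osc_pairing_unique by blast

lemma fourier_integral_operator_radon:
  fixes k :: "'m::finite option"
  shows "fourier_integral_operator (Omega \<iota> \<times> {0<..}) (- half_cylinder \<iota>) (off_axis \<iota>)
     (radon_phase (signature_matrix k) \<iota>) (radon (signature_matrix k) \<iota>)"
  unfolding fourier_integral_operator_def
proof (intro conjI ballI)
  show "open (Omega \<iota> \<times> {0::real<..})" by (intro open_Times open_Omega) auto
  show "open (off_axis \<iota>)" by (rule open_off_axis)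
  show "(Omega \<iota> \<times> {0<..}) \<times> - half_cylinder \<iota> \<subseteq> off_axis \<iota>" by (rule product_subset_off_axis)
  show "off_axis \<iota> \<subseteq> (Omega \<iota> \<times> {0<..}) \<times> UNIV" by (auto simp: off_axis_def)
  show "nondegenerate_phase (off_axis \<iota>) (radon_phase (signature_matrix k) \<iota>)" by (rule nondegenerate_radon_phase)
  show "radon (signature_matrix k) \<iota> f \<in> distributions (Omega \<iota> \<times> {0<..})"
    if "f \<in> compact_distributions (- half_cylinder \<iota>)" for f
    by (rule pairing_distribution[OF open_Omega frequency_profile_growth[OF that]]) (rule radon_eq_pairing[OF that])
  show "\<exists>m a kern. symbol (off_axis \<iota>) m a \<and> smooth_on_open (off_axis \<iota>) kern \<and>
    (\<forall>f\<in>compact_distributions (- half_cylinder \<iota>). \<forall>g\<in>test_functions (Omega \<iota> \<times> {0<..}).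
      \<exists>L. osc_pairing (radon_phase (signature_matrix k) \<iota>) a f g L \<and>
        radon (signature_matrix k) \<iota> f g = L + (\<integral>u. g u * f (\<lambda>v. kern (u, v)) \<partial>lborel))"
  proof (intro exI conjI ballI)
    show "symbol (off_axis \<iota>) 1 (flattened_amplitude k \<iota>)" by (rule symbol_flattened_amplitude)
    show "smooth_on_open (off_axis \<iota>) (\<lambda>_. 0)" by (rule smooth_const[OF open_off_axis])
    fix f and g :: "(real ^ 'm) \<times> real \<Rightarrow> complex"
    assume f: "f \<in> compact_distributions (- half_cylinder \<iota>)" and g: "g \<in> test_functions (Omega \<iota> \<times> {0<..})"
    show "osc_pairing (radon_phase (signature_matrix k) \<iota>) (flattened_amplitude k \<iota>) f g
        (pairing (frequency_profile k \<iota> f) g)" by (rule osc_pairing_flattened_amplitude[OF f g])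
    have "f (\<lambda>v. 0) = 0" using distribution_scale[OF f smooth_near_const[of _ 0], of 0] by simp
    then show "radon (signature_matrix k) \<iota> f g =
        pairing (frequency_profile k \<iota> f) g + (\<integral>u. g u * f (\<lambda>v. 0) \<partial>lborel)"
      by (simp add: radon_eq_pairing[OF f g])
  qed
qed

theorem theorem6p3:
  fixes A :: "real ^ 'm::finite option ^ 'm option" and \<iota> :: 'm
  assumes n: "CARD('m option) \<ge> 3"
    and A: "\<exists>k. A = (\<chi> i j. if i = j then (if i = k then 1 else - 1) else 0)"
  defines "U \<equiv> Omega \<iota> \<times> {0<..}"
    and "V \<equiv> - half_cylinder \<iota>"
  shows "(\<forall>f\<in>compact_distributions V. \<forall>g\<in>test_functions U.
            osc_pairing (radon_phase A \<iota>) (radon_amplitude A \<iota>) f g (radon A \<iota> f g)) \<and>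
         (\<exists>Z. fourier_integral_operator U V Z (radon_phase A \<iota>) (radon A \<iota>) \<and>
              two_sided_fold (canonical_relation Z (radon_phase A \<iota>)))"
proof -
  obtain k where k: "A = signature_matrix k" using A unfolding signature_matrix_def by blast
  have "osc_pairing (radon_phase A \<iota>) (radon_amplitude A \<iota>) f g (radon A \<iota> f g)"
    if "f \<in> compact_distributions V" "g \<in> test_functions U" for f g
    using that osc_pairing_radon_amplitude radon_eq_pairing unfolding U_def V_def k by metis
  moreover have "fourier_integral_operator U V (off_axis \<iota>) (radon_phase A \<iota>) (radon A \<iota>)"
    unfolding U_def V_def k by (rule fourier_integral_operator_radon)
  moreover have "two_sided_fold (canonical_relation (off_axis \<iota>) (radon_phase A \<iota>))"
    unfolding k by (rule two_sided_fold_radon_phase)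
  ultimately show ?thesis by blast
qed

end
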